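(* Let $\alpha_0,\alpha_1,\tau\in C^{\log}_{\mathrm{loc}}$ with $\tau^->0$, and let $p_0,p_1,q\in\mathcal{P}^{\log}_0$ with $q^+<\infty$. If $\alpha_0(\cdot)>\alpha_1(\cdot)$ and $\alpha_0(\cdot)-\frac{n}{p_0(\cdot)}=\alpha_1(\cdot)-\frac{n}{p_1(\cdot)}$ with $\big(\frac{p_0}{p_1}\big)^-<1$, then $$\mathfrak{B}^{\alpha_0(\cdot),\tau(\cdot)}_{p_0(\cdot),q(\cdot)}\hookrightarrow\mathfrak{B}^{\alpha_1(\cdot),\tau(\cdot)}_{p_1(\cdot),q(\cdot)},$$ i.e. the first space is contained in the second and there is $c>0$ with $\|f\|_{\mathfrak{B}^{\alpha_1(\cdot),\tau(\cdot)}_{p_1(\cdot),q(\cdot)}}\le c\|f\|_{\mathfrak{B}^{\alpha_0(\cdot),\tau(\cdot)}_{p_0(\cdot),q(\cdot)}}$ for all $f$ in the first space.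
   Context: $g^\pm$: essential sup/inf. $\mathcal{P}_0$: measurable $p:\mathbb{R}^n\to(0,\infty)$ with $p^->0$. $g\in C^{\log}_{\mathrm{loc}}$: $|g(x)-g(y)|\le c/\log(e+1/|x-y|)$; $g\in C^{\log}$: additionally $|g(x)-g_\infty|\le c/\log(e+|x|)$. $\mathcal{P}_0^{\log}=\{p\in\mathcal{P}_0:1/p\in C^{\log}\}$. $\|f\|_{p(\cdot)}=\inf\{\lambda>0:\int|f/\lambda|^{p(x)}dx\le1\}$; $\|(f_v)\|_{\ell^{q(\cdot)}(L^{p(\cdot)})}=\inf\{\mu>0:\sum_v\inf\{\lambda_v>0:\int|f_v(x)/(\mu\lambda_v^{1/q(x)})|^{p(x)}dx\le1\}\le1\}$. Dyadic cubes $Q_{v,m}=\{x:m_i\le2^vx_i<m_i+1\}$ ($v\in\mathbb{Z}$) form $\mathcal{Q}$; $v_P=-\log_2l(P)$, $v_P^+=\max(v_P,0)$. Fix $\Phi,\varphi\in\mathcal{S}$ with $\operatorname{supp}\mathcal{F}\Phi\subset\overline{B(0,2)}$, $|\mathcal{F}\Phi(\xi)|\ge c>0$ for $|\xi|\le5/3$, $\operatorname{supp}\mathcal{F}\varphi\subset\overline{B(0,2)}\setminus B(0,1/2)$, $|\mathcal{F}\varphi(\xi)|\ge c>0$ for $3/5\le|\xi|\le5/3$; $\varphi_v=2^{vn}\varphi(2^v\cdot)$ ($v\ge1$), $\varphi_0:=\Phi$. For $\alpha:\mathbb{R}^n\to\mathbb{R}$, $\tau:\mathbb{R}^n\to[0,\infty)$,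 $p,q\in\mathcal{P}_0$, $\mathfrak{B}^{\alpha(\cdot),\tau(\cdot)}_{p(\cdot),q(\cdot)}$ is the set of $f\in\mathcal{S}'$ with $\|f\|=\sup_{P\in\mathcal{Q}}\|(2^{v\alpha(\cdot)}\varphi_v\ast f\,|P|^{-\tau(\cdot)}\chi_P)_{v\ge v_P^+}\|_{\ell^{q(\cdot)}(L^{p(\cdot)})}<\infty$. *)

theory Defs
  imports "HOL-Analysis.Analysis"
begin

definition ess_sup :: "('a::euclidean_space \<Rightarrow> real) \<Rightarrow> ereal" where
  "ess_sup g = Inf {c. AE x in lborel. ereal (g x) \<le> c}"

definition ess_inf :: "('a::euclidean_space \<Rightarrow> real) \<Rightarrow> ereal" where
  "ess_inf g = Sup {c. AE x in lborel. c \<le> ereal (g x)}"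

definition C_log_loc :: "('a::euclidean_space \<Rightarrow> real) \<Rightarrow> bool" where
  "C_log_loc g \<longleftrightarrow> (\<exists>c. \<forall>x y. \<bar>g x - g y\<bar> \<le> c / ln (exp 1 + 1 / norm (x - y)))"

definition C_log :: "('a::euclidean_space \<Rightarrow> real) \<Rightarrow> bool" where
  "C_log g \<longleftrightarrow> C_log_loc g \<and>
     (\<exists>c g_inf. \<forall>x. \<bar>g x - g_inf\<bar> \<le> c / ln (exp 1 + norm x))"

definition P0 :: "('a::euclidean_space \<Rightarrow> real) \<Rightarrow> bool" where
  "P0 p \<longleftrightarrow> p \<in> borel_measurable lborel \<and> (\<forall>x. 0 < p x) \<and> ess_inf p > 0"

definition P0_log :: "('a::euclidean_space \<Rightarrow> real) \<Rightarrow> bool" where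
  "P0_log p \<longleftrightarrow> P0 p \<and> C_log (\<lambda>x. 1 / p x)"

fun pd :: "'a::euclidean_space list \<Rightarrow> ('a \<Rightarrow> complex) \<Rightarrow> 'a \<Rightarrow> complex" where
  "pd [] g = g"
| "pd (e # es) g = (\<lambda>x. frechet_derivative (pd es g) (at x) e)"

definition schwartz :: "('a::euclidean_space \<Rightarrow> complex) \<Rightarrow> bool" where
  "schwartz g \<longleftrightarrow> (\<forall>es. set es \<subseteq> Basis \<longrightarrow>
      (\<forall>x. pd es g differentiable (at x)) \<and>
      (\<forall>N::nat. bounded (range (\<lambda>x. (1 + norm x) ^ N * norm (pd es g x)))))"

text \<open>Tempered distributions: continuous linear functionals on the Schwartz space
  (only their values on Schwartz functions matter).\<close>
definition tempered :: "(('a::euclidean_space \<Rightarrow> complex) \<Rightarrow> complex) \<Rightarrow> bool" where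
  "tempered T \<longleftrightarrow>
     (\<forall>g h (a::complex) b. schwartz g \<longrightarrow> schwartz h \<longrightarrow>
        T (\<lambda>x. a * g x + b * h x) = a * T g + b * T h) \<and>
     (\<exists>C (N::nat) (K::nat). \<forall>g. schwartz g \<longrightarrow>
        norm (T g) \<le> C * (\<Sum>es\<in>{es. set es \<subseteq> Basis \<and> length es \<le> K}.
                               SUP x. (1 + norm x) ^ N * norm (pd es g x)))"

definition fourier :: "('a::euclidean_space \<Rightarrow> complex) \<Rightarrow> 'a \<Rightarrow> complex" where
  "fourier g \<xi> = integral\<^sup>L lborel (\<lambda>x. g x * cis (- (x \<bullet> \<xi>)))"

definition conv :: "('a::euclidean_space \<Rightarrow> complex) \<Rightarrow> (('a \<Rightarrow> complex) \<Rightarrow> complex) \<Rightarrow> 'a \<Rightarrow> complex" where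
  "conv g T x = T (\<lambda>y. g (x - y))"

definition admissible_pair :: "('a::euclidean_space \<Rightarrow> complex) \<Rightarrow> ('a \<Rightarrow> complex) \<Rightarrow> bool" where
  "admissible_pair Phi phi \<longleftrightarrow> schwartz Phi \<and> schwartz phi \<and>
     closure {\<xi>. fourier Phi \<xi> \<noteq> 0} \<subseteq> cball 0 2 \<and>
     (\<exists>c>0. \<forall>\<xi>. norm \<xi> \<le> 5/3 \<longrightarrow> c \<le> norm (fourier Phi \<xi>)) \<and>
     closure {\<xi>. fourier phi \<xi> \<noteq> 0} \<subseteq> cball 0 2 - ball 0 (1/2) \<and>
     (\<exists>c>0. \<forall>\<xi>. 3/5 \<le> norm \<xi> \<and> norm \<xi> \<le> 5/3 \<longrightarrow> c \<le> norm (fourier phi \<xi>))"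

definition phi_seq :: "('a::euclidean_space \<Rightarrow> complex) \<Rightarrow> ('a \<Rightarrow> complex) \<Rightarrow> nat \<Rightarrow> 'a \<Rightarrow> complex" where
  "phi_seq Phi phi v = (if v = 0 then Phi
      else (\<lambda>x. of_real (2 ^ (v * DIM('a))) * phi ((2 ^ v) *\<^sub>R x)))"

definition dyadic_cube :: "int \<Rightarrow> ('a::euclidean_space \<Rightarrow> int) \<Rightarrow> 'a set" where
  "dyadic_cube v m = {x. \<forall>i\<in>Basis. of_int (m i) \<le> 2 powr v * (x \<bullet> i) \<and> 2 powr v * (x \<bullet> i) < of_int (m i) + 1}"

text \<open>Quasi-norm of l^{q(.)}(L^{p(.)}), values in [0,\<infinity>] (inf of empty set = \<infinity>).\<close>
definition mixed_norm :: "('a::euclidean_space \<Rightarrow> real) \<Rightarrow> ('a \<Rightarrow> real) \<Rightarrow> (nat \<Rightarrow> 'a \<Rightarrow> complex) \<Rightarrow> ennreal" where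
  "mixed_norm p q F = Inf {ennreal \<mu> | \<mu>. 0 < \<mu> \<and>
      (\<Sum>k. Inf {ennreal lam | lam. 0 < lam \<and>
          (\<integral>\<^sup>+ x. ennreal ((norm (F k x) / (\<mu> * lam powr (1 / q x))) powr p x) \<partial>lborel) \<le> 1}) \<le> 1}"

text \<open>Besov-type norm: sup over dyadic cubes P = Q_{v,m} (so v_P = v, |P| = 2^(-vn)) of
  the mixed norm of (2^(w alpha) phi_w * f |P|^(-tau) chi_P)_{w \<ge> v_P^+}, reindexed w = v_P^+ + k.\<close>
definition besov_norm :: "('a::euclidean_space \<Rightarrow> complex) \<Rightarrow> ('a \<Rightarrow> complex) \<Rightarrow>
    ('a \<Rightarrow> real) \<Rightarrow> ('a \<Rightarrow> real) \<Rightarrow> ('a \<Rightarrow> real) \<Rightarrow> ('a \<Rightarrow> real) \<Rightarrow>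
    (('a \<Rightarrow> complex) \<Rightarrow> complex) \<Rightarrow> ennreal" where
  "besov_norm Phi phi \<alpha> \<tau> p q f =
     (SUP vm\<in>(UNIV :: (int \<times> ('a \<Rightarrow> int)) set).
        mixed_norm p q (\<lambda>k x.
          let v = fst vm; P = dyadic_cube v (snd vm); w = nat (max v 0) + k
          in of_real (2 powr (real w * \<alpha> x)) * conv (phi_seq Phi phi w) f x
             * of_real ((2 powr (- real_of_int v * real DIM('a))) powr (- \<tau> x))
             * indicator P x))"

definition besov_space :: "('a::euclidean_space \<Rightarrow> complex) \<Rightarrow> ('a \<Rightarrow> complex) \<Rightarrow>
    ('a \<Rightarrow> real) \<Rightarrow> ('a \<Rightarrow> real) \<Rightarrow> ('a \<Rightarrow> real) \<Rightarrow> ('a \<Rightarrow> real) \<Rightarrow>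
    ((('a \<Rightarrow> complex) \<Rightarrow> complex)) set" where
  "besov_space Phi phi \<alpha> \<tau> p q = {f. tempered f \<and> besov_norm Phi phi \<alpha> \<tau> p q f < top}"

end

theory Submission
  imports Defs
begin

text \<open>
A convolution of a tempered distribution with a function whose spectrum lies in the ball of radius 2
is recovered from its values on any shift of a lattice by a sampling formula with a rapidly decaying
kernel that vanishes at the nonzero integer vectors; this is Poisson summation for a function
without spectrum at the nonzero frequencies of the dual lattice. Averaging over the shifts bounds a
small power of the convolution at a point by a weighted mean of the same power, with constants
independent of the distribution. Together with the log-Hoelder conditions this gives, for x in a
dyadic cube P and \<open>2^(-w) \<le> |P|^(1/n)\<close>, the pointwise bound of
\<open>2^(w \<alpha>0(x)) |P|^(-\<tau>(x)) |\<phi>_w * f(x)|\<close> by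
\<open>C \<mu> 2^(w n/p0(x)) D_w^(1/q(x))\<close>, where \<open>D_w\<close> is a convolution-type sum of the
inner infima of the mixed norms on the cubes of the same size, plus \<open>2^(-\<epsilon> w)\<close>, and so has
bounded sum over w. For large cubes and small w the factor \<open>|P|^(-\<tau>)\<close> is small because
\<open>\<tau>\<close> is bounded away from 0. Raising to the power \<open>p1 > p0\<close> and spending
\<open>p1 - p0\<close> of it on the pointwise bound leaves the \<open>p0\<close>-modular.
\<close>

text \<open>Since \<open>p0\<close> may lie below 1, sums are estimated through a power
  \<open>r \<le> 1\<close>, which is subadditive; with \<open>r \<le> p0\<close> the modular enters
  through \<open>E powr r \<le> 1 + E powr p0\<close>. The Besov norm does not control the order of
  the distribution, so the sampling kernel carries two separate orders of decay. Spectral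
  information is kept as the vanishing of integrals against characters, a form that survives
  translation, differentiation and multiplication by the kernel. The term
  \<open>2^(-\<epsilon> w)\<close> in \<open>D_w\<close> meets two demands. Replacing
  \<open>D_w^(1/q(y))\<close> by \<open>D_w^(1/q(x))\<close> costs \<open>|ln D_w|\<close> times the
  oscillation of \<open>1/q\<close>, which log-Hoelder continuity absorbs only while
  \<open>|ln D_w|\<close> is at most of order \<open>w\<close>; this asks for
  \<open>D_w \<ge> 2^(-w)\<close>, hence \<open>\<epsilon> \<le> 1\<close>. On a cube of side above
  \<open>2^w\<close> the oscillation of \<open>\<tau>\<close> at scale \<open>2^(-w)\<close> cannot
  be multiplied by the logarithm of the side; the bound is then taken from unit cubes, and
  \<open>|P|^(-\<tau>)\<close> has to fit below \<open>D_w^(1/q)\<close>, hence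
  \<open>\<epsilon> sup(1/q) \<le> n inf \<tau>\<close>.\<close>

section \<open>The integer lattice, its unit cell and the polynomial weight\<close>

definition ivecs :: "'a::euclidean_space set" where
  "ivecs = {x. \<forall>i\<in>Basis. x \<bullet> i \<in> \<int>}"

text \<open>A fixed enumeration of the lattice, so that lattice sums can be written with
  \<open>suminf\<close> and \<open>sums\<close>; its order carries no geometry.\<close>

definition ivec :: "nat \<Rightarrow> 'a::euclidean_space" where
  "ivec = from_nat_into ivecs"

definition ucube :: "'a::euclidean_space set" where
  "ucube = {x. \<forall>i\<in>Basis. 0 \<le> x \<bullet> i \<and> x \<bullet> i < 1}"

definition vfloor :: "'a::euclidean_space \<Rightarrow> 'a" where
  "vfloor x = (\<Sum>i\<in>Basis. of_int \<lfloor>x \<bullet> i\<rfloor> *\<^sub>R i)"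

definition wt :: "'a::real_normed_vector \<Rightarrow> real" where
  "wt t = 1 + norm t"

lemma wt_ge_1: "1 \<le> wt t" and wt_pos: "0 < wt t" and wt_nonneg: "0 \<le> wt t"
  by (simp_all add: wt_def add_pos_nonneg)

lemma wt_minus[simp]: "wt (- t) = wt t"
  by (simp add: wt_def)

text \<open>Submultiplicativity is what moves decay estimates from one point to another: a shift
  costs only a factor depending on the shift.\<close>

lemma wt_add_le: "wt (s + t) \<le> wt s * wt t"
proof -
  have "norm (s + t) \<le> norm s + norm t" by (rule norm_triangle_ineq)
  then show ?thesis using mult_nonneg_nonneg[OF norm_ge_zero[of s] norm_ge_zero[of t]]
    unfolding wt_def distrib_left distrib_right mult_1 mult_1_right by linarith
qed

lemma wt_diff_le: "wt (s - t) \<le> wt s * wt t"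
  using wt_add_le[of s "-t"] by simp

lemma borel_measurable_wt[measurable]: "(wt :: 'a::euclidean_space \<Rightarrow> real) \<in> borel_measurable borel"
  unfolding wt_def by measurable

lemma zero_ivecs: "0 \<in> ivecs" and Basis_ivecs: "i \<in> Basis \<Longrightarrow> i \<in> ivecs"
  and ivecs_add: "x \<in> ivecs \<Longrightarrow> y \<in> ivecs \<Longrightarrow> x + y \<in> ivecs"
  and ivecs_diff: "x \<in> ivecs \<Longrightarrow> y \<in> ivecs \<Longrightarrow> x - y \<in> ivecs"
  by (auto simp: ivecs_def inner_Basis inner_add_left inner_diff_left)

lemma countable_ivecs: "countable (ivecs :: 'a::euclidean_space set)"
proof -
  obtain bs :: "'a list" where bs: "set bs = Basis"
    using finite_list[OF finite_Basis] by auto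
  have "inj_on (\<lambda>x. map (\<lambda>i. \<lfloor>x \<bullet> i\<rfloor>) bs) (ivecs :: 'a set)"
  proof (rule inj_onI)
    fix x y :: 'a assume x: "x \<in> ivecs" and y: "y \<in> ivecs"
      and e: "map (\<lambda>i. \<lfloor>x \<bullet> i\<rfloor>) bs = map (\<lambda>i. \<lfloor>y \<bullet> i\<rfloor>) bs"
    show "x = y"
    proof (rule euclidean_eqI)
      fix i :: 'a assume i: "i \<in> Basis"
      then have "\<lfloor>x \<bullet> i\<rfloor> = \<lfloor>y \<bullet> i\<rfloor>" using e bs by auto
      then show "x \<bullet> i = y \<bullet> i" using x y i
        unfolding ivecs_def by (metis (mono_tags, lifting) Ints_cases floor_of_int mem_Collect_eq)
    qed
  qed
  then show ?thesis by (rule countableI')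
qed

lemma infinite_ivecs: "infinite (ivecs :: 'a::euclidean_space set)"
proof -
  obtain b :: 'a where b: "b \<in> Basis" using nonempty_Basis by blast
  have "inj (\<lambda>n::nat. of_nat n *\<^sub>R b)" using b by (auto simp: inj_def nonzero_Basis)
  moreover have "range (\<lambda>n::nat. of_nat n *\<^sub>R b) \<subseteq> ivecs" using b by (auto simp: ivecs_def inner_Basis)
  ultimately show ?thesis by (metis infinite_iff_countable_subset)
qed

lemma bij_ivec: "bij_betw ivec UNIV (ivecs :: 'a::euclidean_space set)"
  unfolding ivec_def by (rule bij_betw_from_nat_into[OF countable_ivecs infinite_ivecs])

lemma ivec_in[simp]: "ivec k \<in> ivecs"
  using bij_ivec bij_betwE by blast

lemma inj_ivec: "ivec k = (ivec l :: 'a::euclidean_space) \<longleftrightarrow> k = l"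
  using bij_ivec[where 'a='a] by (metis bij_betw_def injD)

lemma ivec_surj: "z \<in> ivecs \<Longrightarrow> \<exists>k. ivec k = z"
  using bij_ivec by (metis bij_betw_iff_bijections)

lemma vfloor_inner: "i \<in> Basis \<Longrightarrow> vfloor x \<bullet> i = of_int \<lfloor>x \<bullet> i\<rfloor>"
  unfolding vfloor_def by simp

lemma vfloor_in: "vfloor x \<in> ivecs"
  by (simp add: ivecs_def vfloor_inner)

lemma diff_vfloor_in: "x - vfloor x \<in> ucube"
  by (auto simp: ucube_def vfloor_inner inner_diff_left) linarith

lemma vfloor_unique:
  assumes "z \<in> ivecs" "x - z \<in> ucube" shows "z = vfloor x"
proof (rule euclidean_eqI)
  fix i :: 'a assume i: "i \<in> Basis"
  then obtain a where a: "z \<bullet> i = of_int a" using assms(1) by (auto simp: ivecs_def Ints_def)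
  have "0 \<le> x \<bullet> i - a" "x \<bullet> i - a < 1" using assms(2) i a by (auto simp: ucube_def inner_diff_left)
  then have "\<lfloor>x \<bullet> i\<rfloor> = a" by linarith
  then show "z \<bullet> i = vfloor x \<bullet> i" using a i by (simp add: vfloor_inner)
qed

lemma norm_ucube: "t \<in> (ucube :: 'a::euclidean_space set) \<Longrightarrow> norm t \<le> DIM('a)"
proof -
  assume t: "t \<in> ucube"
  have "norm t \<le> (\<Sum>b\<in>Basis. \<bar>t \<bullet> b\<bar>)" by (rule norm_le_l1)
  also have "\<dots> \<le> (\<Sum>b\<in>(Basis::'a set). 1)" using t by (intro sum_mono) (auto simp: ucube_def)
  finally show ?thesis by simp
qed

lemma wt_ucube: "t \<in> (ucube :: 'a::euclidean_space set) \<Longrightarrow> wt t \<le> 1 + DIM('a)"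
  using norm_ucube[of t] by (simp add: wt_def)

lemma measurable_ucube[measurable]: "(ucube :: 'a::euclidean_space set) \<in> sets borel"
proof -
  have "(ucube :: 'a set) = (\<Inter>i\<in>Basis. {x. 0 \<le> x \<bullet> i} \<inter> {x. x \<bullet> i < 1})"
    by (auto simp: ucube_def)
  also have "\<dots> \<in> sets borel" by (intro sets.finite_INT) auto
  finally show ?thesis .
qed

lemma ucube_cbox: "ucube \<subseteq> cbox 0 One" and box_ucube: "box 0 One \<subseteq> ucube"
  by (auto simp: ucube_def mem_box order_le_less)

lemma emeasure_ucube: "emeasure lborel (ucube :: 'a::euclidean_space set) = 1"
proof (rule antisym)
  have "emeasure lborel (ucube :: 'a set) \<le> emeasure lborel (cbox 0 One :: 'a set)"
    by (intro emeasure_mono ucube_cbox) simp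
  then show "emeasure lborel (ucube :: 'a set) \<le> 1" by (simp add: emeasure_lborel_cbox_eq)
  have "emeasure lborel (box 0 One :: 'a set) \<le> emeasure lborel (ucube :: 'a set)"
    by (intro emeasure_mono box_ucube) simp
  then show "1 \<le> emeasure lborel (ucube :: 'a set)" by (simp add: emeasure_lborel_box_eq)
qed

lemma UN_ucube: "(\<Union>k. (+) (ivec k) ` ucube) = (UNIV :: 'a::euclidean_space set)"
proof -
  have "x \<in> (\<Union>k. (+) (ivec k) ` ucube)" for x :: 'a
  proof -
    obtain k where "ivec k = vfloor x" using ivec_surj[OF vfloor_in] by blast
    then have "x = ivec k + (x - vfloor x)" by simp
    then show ?thesis using diff_vfloor_in by blast
  qed
  then show ?thesis by auto
qed

lemma disjoint_ucube: "k \<noteq> l \<Longrightarrow> (+) (ivec k) ` ucube \<inter> (+) (ivec l) ` (ucube :: 'a::euclidean_space set) = {}"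
proof (rule ccontr)
  assume "k \<noteq> l" "(+) (ivec k) ` ucube \<inter> (+) (ivec l) ` (ucube :: 'a set) \<noteq> {}"
  then obtain x :: 'a where "x \<in> (+) (ivec k) ` ucube" "x \<in> (+) (ivec l) ` ucube" by blast
  then have "x - ivec k \<in> ucube" "x - ivec l \<in> ucube" by (metis imageE add_diff_cancel_left')+
  then have "ivec k = vfloor x" "ivec l = vfloor x" using vfloor_unique ivec_in by blast+
  then show False using inj_ivec \<open>k \<noteq> l\<close> by metis
qed

lemma measurable_shift_ucube[measurable]: "(+) c ` (ucube :: 'a::euclidean_space set) \<in> sets borel"
proof -
  have "(+) c ` (ucube :: 'a set) = (\<lambda>x. x - c) -` ucube \<inter> space borel"
    by (auto simp: image_iff) (metis add.commute diff_add_cancel)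
  also have "\<dots> \<in> sets borel" by (rule measurable_sets[where A=borel]) auto
  finally show ?thesis .
qed

lemma indicator_shift_ucube: "indicator ((+) c ` ucube) x = indicator ucube (x - c :: 'a::euclidean_space)"
  by (auto simp: indicator_def image_iff) (metis add.commute diff_add_cancel)

lemma nn_integral_shift:
  fixes f :: "'a::euclidean_space \<Rightarrow> ennreal"
  assumes "f \<in> borel_measurable borel"
  shows "(\<integral>\<^sup>+x. f (c + x) \<partial>lborel) = (\<integral>\<^sup>+x. f x \<partial>lborel)"
proof -
  have "(\<integral>\<^sup>+x. f x \<partial>distr lborel borel ((+) c)) = (\<integral>\<^sup>+x. f (c + x) \<partial>lborel)"
    using assms by (subst nn_integral_distr) auto
  then show ?thesis by (simp add: lborel_distr_plus)
qed

lemma nn_integral_affine: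
  fixes f :: "'a::euclidean_space \<Rightarrow> ennreal"
  assumes "f \<in> borel_measurable borel" "c \<noteq> 0"
  shows "(\<integral>\<^sup>+x. f x \<partial>lborel) = ennreal (\<bar>c\<bar> ^ DIM('a)) * (\<integral>\<^sup>+x. f (t + c *\<^sub>R x) \<partial>lborel)"
  using assms by (subst lborel_affine[of c t]) (auto simp: nn_integral_density nn_integral_distr nn_integral_cmult)

text \<open>The lattice translates of the half-open cube tile the space, and translation invariance
  moves every tile back to the cube.\<close>

lemma nn_integral_unfold:
  fixes f :: "'a::euclidean_space \<Rightarrow> ennreal"
  assumes [measurable]: "f \<in> borel_measurable borel"
  shows "(\<integral>\<^sup>+x. f x \<partial>lborel) = (\<Sum>k. \<integral>\<^sup>+t. f (ivec k + t) * indicator ucube t \<partial>lborel)"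
proof -
  have "(\<integral>\<^sup>+x. f x \<partial>lborel) = (\<integral>\<^sup>+x\<in>(\<Union>k. (+) (ivec k) ` ucube). f x \<partial>lborel)"
    by (simp add: UN_ucube)
  also have "\<dots> = (\<Sum>k. \<integral>\<^sup>+x\<in>(+) (ivec k) ` ucube. f x \<partial>lborel)"
    by (rule nn_integral_disjoint_family) (auto simp: disjoint_family_on_def disjoint_ucube)
  also have "\<dots> = (\<Sum>k. \<integral>\<^sup>+t. f (ivec k + t) * indicator ucube t \<partial>lborel)"
  proof (rule suminf_cong)
    fix k
    have "(\<integral>\<^sup>+x\<in>(+) (ivec k) ` ucube. f x \<partial>lborel) =
      (\<integral>\<^sup>+x. f (ivec k + x) * indicator ((+) (ivec k) ` ucube) (ivec k + x) \<partial>lborel)"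
      by (rule nn_integral_shift[symmetric]) measurable
    then show "(\<integral>\<^sup>+x\<in>(+) (ivec k) ` ucube. f x \<partial>lborel) = (\<integral>\<^sup>+t. f (ivec k + t) * indicator ucube t \<partial>lborel)"
      by (simp add: indicator_shift_ucube)
  qed
  finally show ?thesis .
qed

section \<open>Integrals and lattice sums of functions with polynomial decay\<close>

lemma nn_integral_inverse_square_finite: "(\<integral>\<^sup>+x. ennreal (1 / (1 + \<bar>x\<bar>)\<^sup>2) \<partial>(lborel :: real measure)) < \<infinity>"
proof -
  have lim: "((\<lambda>x::real. - 1 / (1 + x)) \<longlongrightarrow> 0) at_top"
    by (intro tendsto_divide_0[OF tendsto_const] filterlim_at_top_imp_at_infinity
        filterlim_tendsto_add_at_top[OF tendsto_const] filterlim_ident)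
  have D: "DERIV (\<lambda>x. - 1 / (1 + x)) x :> 1 / (1 + x)\<^sup>2" if "0 \<le> x" for x :: real
    using that by (auto intro!: derivative_eq_intros simp: power2_eq_square)
  have "(\<integral>\<^sup>+x. ennreal (1 / (1 + x)\<^sup>2) * indicator {0..} x \<partial>lborel) = ennreal (0 - (- 1 / (1 + 0)))"
    by (rule nn_integral_FTC_atLeast[OF _ D _ lim]) auto
  then have h: "(\<integral>\<^sup>+x. ennreal (1 / (1 + x)\<^sup>2) * indicator {0..} x \<partial>lborel) = 1" by simp
  have h2: "(\<integral>\<^sup>+x. ennreal (1 / (1 + x)\<^sup>2) * indicator {0..} x \<partial>lborel)
     = ennreal \<bar>- 1\<bar> * (\<integral>\<^sup>+x. ennreal (1 / (1 + (0 + - 1 * x))\<^sup>2) * indicator {0..} (0 + - 1 * x) \<partial>lborel)"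
    by (rule nn_integral_real_affine) auto
  have "(\<integral>\<^sup>+x. ennreal (1 / (1 + \<bar>x\<bar>)\<^sup>2) \<partial>(lborel :: real measure)) \<le>
    (\<integral>\<^sup>+x. ennreal (1 / (1 + x)\<^sup>2) * indicator {0..} x +
      ennreal (1 / (1 + (0 + - 1 * x))\<^sup>2) * indicator {0..} (0 + - 1 * x) \<partial>lborel)"
    by (intro nn_integral_mono) (auto simp: indicator_def)
  also have "\<dots> = 1 + 1" using h h2 by (subst nn_integral_add) auto
  finally show ?thesis by (auto simp: order_le_less_trans)
qed

text \<open>Origin of the decay order \<open>2 * DIM('a)\<close> used throughout: it splits into an
  integrable inverse square in each coordinate.\<close>

lemma wt_power_ge_prod:
  "(\<Prod>b\<in>Basis. (1 + \<bar>t \<bullet> b\<bar>)\<^sup>2) \<le> wt (t :: 'a::euclidean_space) ^ (2 * DIM('a))"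
proof -
  have "(\<Prod>b\<in>Basis. (1 + \<bar>t \<bullet> b\<bar>)\<^sup>2) \<le> (\<Prod>b\<in>(Basis::'a set). (wt t)\<^sup>2)"
    by (intro prod_mono) (auto intro!: power_mono simp: wt_def Basis_le_norm)
  then show ?thesis by (simp add: power_mult)
qed

lemma nn_integral_wt_finite:
  "(\<integral>\<^sup>+t. ennreal (1 / wt t ^ (2 * DIM('a))) \<partial>(lborel :: 'a::euclidean_space measure)) < \<infinity>"
proof -
  have "(\<integral>\<^sup>+t. ennreal (1 / wt t ^ (2 * DIM('a))) \<partial>(lborel :: 'a measure)) \<le>
    (\<integral>\<^sup>+t. (\<Prod>b\<in>Basis. ennreal (1 / (1 + \<bar>t \<bullet> b\<bar>)\<^sup>2)) \<partial>(lborel :: 'a measure))"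
  proof (intro nn_integral_mono)
    fix t :: 'a
    have "1 / wt t ^ (2 * DIM('a)) \<le> 1 / (\<Prod>b\<in>Basis. (1 + \<bar>t \<bullet> b\<bar>)\<^sup>2)"
      by (intro divide_left_mono wt_power_ge_prod mult_pos_pos prod_pos) (auto simp: wt_pos add_pos_nonneg)
    also have "\<dots> = (\<Prod>b\<in>Basis. 1 / (1 + \<bar>t \<bullet> b\<bar>)\<^sup>2)" by (simp add: prod_dividef)
    finally show "ennreal (1 / wt t ^ (2 * DIM('a))) \<le> (\<Prod>b\<in>Basis. ennreal (1 / (1 + \<bar>t \<bullet> b\<bar>)\<^sup>2))"
      by (subst prod_ennreal) (auto intro: ennreal_leI)
  qed
  also have "\<dots> = (\<Prod>b\<in>(Basis::'a set). (\<integral>\<^sup>+x. ennreal (1 / (1 + \<bar>x\<bar>)\<^sup>2) \<partial>(lborel :: real measure)))"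
    by (rule nn_integral_lborel_prod) auto
  also have "\<dots> < \<infinity>" using nn_integral_inverse_square_finite
    by (simp add: power_less_top_ennreal)
  finally show ?thesis .
qed

text \<open>Within one tile the weight grows by at most the factor \<open>1 + DIM('a)\<close>, so
  the sum is compared with the integral tile by tile.\<close>

lemma suminf_wt_finite:
  "(\<Sum>k. ennreal (1 / wt (ivec k :: 'a::euclidean_space) ^ (2 * DIM('a)))) < \<infinity>"
proof -
  let ?N = "2 * DIM('a)" and ?c = "(1 + real DIM('a)) ^ (2 * DIM('a))"
  have le: "ennreal (1 / wt (ivec k :: 'a) ^ ?N) \<le>
      ennreal ?c * (\<integral>\<^sup>+t. ennreal (1 / wt (ivec k + t :: 'a) ^ ?N) * indicator ucube t \<partial>lborel)" for k
  proof -
    have "ennreal (1 / wt (ivec k :: 'a) ^ ?N) = (\<integral>\<^sup>+t. ennreal (1 / wt (ivec k :: 'a) ^ ?N) * indicator ucube (t::'a) \<partial>lborel)"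
      by (simp add: nn_integral_cmult_indicator emeasure_ucube)
    also have "\<dots> \<le> (\<integral>\<^sup>+t. ennreal ?c * (ennreal (1 / wt (ivec k + t :: 'a) ^ ?N) * indicator ucube t) \<partial>lborel)"
    proof (intro nn_integral_mono)
      fix t :: 'a
      have "1 / wt (ivec k :: 'a) ^ ?N \<le> ?c * (1 / wt (ivec k + t :: 'a) ^ ?N)" if t: "t \<in> ucube"
      proof -
        have "wt (ivec k + t) \<le> wt (ivec k :: 'a) * (1 + DIM('a))"
          using order_trans[OF wt_add_le mult_left_mono[OF wt_ucube[OF t] wt_nonneg], of "ivec k :: 'a"] by simp
        then have "wt (ivec k + t) ^ ?N \<le> wt (ivec k :: 'a) ^ ?N * ?c"
          using power_mono[of "wt (ivec k + t)" "wt (ivec k :: 'a) * (1 + DIM('a))" ?N]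
          by (simp add: wt_nonneg power_mult_distrib)
        then show ?thesis by (simp add: field_simps wt_pos)
      qed
      then show "ennreal (1 / wt (ivec k :: 'a) ^ ?N) * indicator ucube t \<le> ennreal ?c * (ennreal (1 / wt (ivec k + t :: 'a) ^ ?N) * indicator ucube t)"
        by (auto simp: indicator_def ennreal_mult[symmetric] wt_nonneg intro!: ennreal_leI)
    qed
    also have "\<dots> = ennreal ?c * (\<integral>\<^sup>+t. ennreal (1 / wt (ivec k + t :: 'a) ^ ?N) * indicator ucube t \<partial>lborel)"
      by (rule nn_integral_cmult) measurable
    finally show ?thesis .
  qed
  have "(\<Sum>k. ennreal (1 / wt (ivec k :: 'a) ^ ?N)) \<le>
    (\<Sum>k. ennreal ?c * (\<integral>\<^sup>+t. ennreal (1 / wt (ivec k + t :: 'a) ^ ?N) * indicator ucube t \<partial>lborel))"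
    by (intro suminf_le le) auto
  also have "\<dots> = ennreal ?c * (\<integral>\<^sup>+t. ennreal (1 / wt t ^ ?N) \<partial>(lborel :: 'a measure))"
    by (subst nn_integral_unfold) auto
  also have "\<dots> < \<infinity>" using nn_integral_wt_finite[where 'a='a] by (simp add: ennreal_mult_less_top)
  finally show ?thesis .
qed

lemma summable_wt: "summable (\<lambda>k. 1 / wt (ivec k :: 'a::euclidean_space) ^ (2 * DIM('a)))"
  using suminf_wt_finite[where 'a='a] by (intro summable_suminf_not_top) (auto simp: wt_nonneg)

text \<open>A form of Peetre's inequality, from submultiplicativity applied to
  \<open>t = (s + t) - s\<close>.\<close>

lemma inverse_wt_shift:
  "1 / wt (s + t :: 'a::real_normed_vector) ^ N \<le> wt s ^ N * (1 / wt t ^ N)"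
proof -
  have "wt t = wt ((s + t) - s)" by simp
  also have "\<dots> \<le> wt (s + t) * wt s" by (rule wt_diff_le)
  finally have "wt t ^ N \<le> wt (s + t) ^ N * wt s ^ N" by (metis power_mono power_mult_distrib wt_nonneg)
  then show ?thesis by (simp add: field_simps wt_pos)
qed

lemma integrable_wt: "integrable lborel (\<lambda>t::'a::euclidean_space. 1 / wt t ^ (2 * DIM('a)))"
  using nn_integral_wt_finite[where 'a='a] by (intro integrableI_nonneg) (auto simp: wt_nonneg)

lemma decay_const_nonneg:
  assumes "\<And>t. norm (f t) \<le> C / wt t ^ N" shows "0 \<le> C"
  using assms[of 0] by (simp add: wt_def order_trans[OF norm_ge_zero])

lemma integrable_decay:
  fixes f :: "'a::euclidean_space \<Rightarrow> complex"
  assumes "continuous_on UNIV f" "\<And>t. norm (f t) \<le> C / wt t ^ (2 * DIM('a))"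
  shows "integrable lborel f"
proof (rule Bochner_Integration.integrable_bound)
  show "integrable lborel (\<lambda>t::'a. C * (1 / wt t ^ (2 * DIM('a))))"
    by (intro integrable_mult_right integrable_wt)
  show "f \<in> borel_measurable lborel" using assms(1) by (simp add: borel_measurable_continuous_onI)
  show "AE t in lborel. norm (f t) \<le> norm (C * (1 / wt t ^ (2 * DIM('a))))"
    using assms(2) decay_const_nonneg[of f, OF assms(2)] by (simp add: wt_nonneg)
qed

lemma decay_shift:
  assumes "\<And>t. norm (f t) \<le> C / wt t ^ N"
  shows "norm (f (s + t)) \<le> (C * wt s ^ N) / wt (t::'a::real_normed_vector) ^ N"
proof -
  have "norm (f (s + t)) \<le> C * (1 / wt (s + t) ^ N)" using assms by simp
  also have "\<dots> \<le> C * (wt s ^ N * (1 / wt t ^ N))"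
    by (intro mult_left_mono inverse_wt_shift decay_const_nonneg[of f, OF assms])
  finally show ?thesis by simp
qed

lemma summable_decay:
  fixes f :: "'a::euclidean_space \<Rightarrow> complex"
  assumes "\<And>t. norm (f t) \<le> C / wt t ^ (2 * DIM('a))"
  shows "summable (\<lambda>k. norm (f (s + ivec k)))"
proof (rule summable_comparison_test)
  show "summable (\<lambda>k. (C * wt s ^ (2 * DIM('a))) * (1 / wt (ivec k :: 'a) ^ (2 * DIM('a))))"
    by (intro summable_mult summable_wt)
  show "\<exists>N. \<forall>k\<ge>N. norm (norm (f (s + ivec k))) \<le> (C * wt s ^ (2 * DIM('a))) * (1 / wt (ivec k :: 'a) ^ (2 * DIM('a)))"
    using decay_shift[of f, OF assms, of s] by auto
qed

lemma integral_shift: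
  fixes f :: "'a::euclidean_space \<Rightarrow> 'b::{banach, second_countable_topology}"
  assumes "f \<in> borel_measurable borel"
  shows "(\<integral>x. f (c + x) \<partial>lborel) = (\<integral>x. f x \<partial>lborel)"
proof -
  have "(\<integral>x. f x \<partial>distr lborel borel ((+) c)) = (\<integral>x. f (c + x) \<partial>lborel)"
    using assms by (subst integral_distr) auto
  then show ?thesis by (simp add: lborel_distr_plus)
qed

text \<open>The sum is kept inside the integral so that a periodic factor of \<open>f\<close> can be
  pulled out of it, leaving the periodization of the other factor.\<close>

lemma integral_unfold:
  fixes f :: "'a::euclidean_space \<Rightarrow> complex"
  assumes c: "continuous_on UNIV f" and d: "\<And>t. norm (f t) \<le> C / wt t ^ (2 * DIM('a))"
  shows "(\<integral>x. f x \<partial>lborel) = (\<integral>t. (\<Sum>k. indicator ucube t *\<^sub>R f (ivec k + t)) \<partial>lborel)"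
proof -
  let ?N = "2 * DIM('a)"
  have int: "integrable lborel f" by (rule integrable_decay[OF c d])
  have [measurable]: "f \<in> borel_measurable borel" using c by (rule borel_measurable_continuous_onI)
  have C0: "0 \<le> C" using d by (rule decay_const_nonneg)
  define B where "B = C * (1 + real DIM('a)) ^ ?N"
  have bd: "norm (indicator ucube t *\<^sub>R f (ivec k + t)) \<le> indicator ucube t * (B / wt (ivec k :: 'a) ^ ?N)" for k and t :: 'a
  proof (cases "t \<in> ucube")
    case True
    have "norm (f (t + ivec k)) \<le> (C * wt t ^ ?N) / wt (ivec k :: 'a) ^ ?N"
      by (rule decay_shift[of f, OF d])
    also have "\<dots> \<le> B / wt (ivec k :: 'a) ^ ?N" unfolding B_def
      using wt_ucube[OF True] C0 by (intro divide_right_mono mult_left_mono power_mono) (auto simp: wt_nonneg)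
    finally show ?thesis using True by (simp add: add.commute)
  qed simp
  have ib: "integrable lborel (\<lambda>t::'a. indicator ucube t * (B / wt (ivec k :: 'a) ^ ?N))" for k
    by (intro integrable_mult_left) (simp add: emeasure_ucube)
  have i1: "integrable lborel (\<lambda>t. indicator ucube t *\<^sub>R f (ivec k + t))" for k
    by (rule Bochner_Integration.integrable_bound[OF ib[of k]])
       (measurable, rule AE_I2, rule order_trans[OF bd], unfold real_norm_def, rule abs_ge_self)
  have "(\<integral>x. f x \<partial>lborel) = (LINT x:(\<Union>k. (+) (ivec k) ` ucube)|lborel. f x)"
    by (simp add: UN_ucube set_lebesgue_integral_def)
  also have "\<dots> = (\<Sum>k. LINT x:((+) (ivec k) ` ucube)|lborel. f x)"
    by (rule lebesgue_integral_countable_add) (auto simp: disjoint_ucube UN_ucube set_integrable_def int)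
  also have "\<dots> = (\<Sum>k. \<integral>t. indicator ucube t *\<^sub>R f (ivec k + t) \<partial>lborel)"
  proof (rule suminf_cong)
    fix k
    have "(LINT x:((+) (ivec k) ` ucube)|lborel. f x) =
       (\<integral>x. indicator ((+) (ivec k) ` ucube) (ivec k + x) *\<^sub>R f (ivec k + x) \<partial>lborel)"
      unfolding set_lebesgue_integral_def by (rule integral_shift[symmetric]) measurable
    then show "(LINT x:((+) (ivec k) ` ucube)|lborel. f x) = (\<integral>t. indicator ucube t *\<^sub>R f (ivec k + t) \<partial>lborel)"
      by (simp add: indicator_shift_ucube)
  qed
  also have "\<dots> = (\<integral>t. (\<Sum>k. indicator ucube t *\<^sub>R f (ivec k + t)) \<partial>lborel)"
  proof (rule integral_suminf[symmetric, OF i1])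
    have s: "summable (\<lambda>k. B / wt (ivec k :: 'a) ^ ?N)"
      using summable_mult[OF summable_wt[where 'a='a], of B] by simp
    show "AE t in lborel. summable (\<lambda>k. norm (indicator ucube t *\<^sub>R f (ivec k + t)))"
    proof (rule AE_I2)
      fix t :: 'a
      have "summable (\<lambda>k. indicator ucube t * (B / wt (ivec k :: 'a) ^ ?N) :: real)"
        by (intro summable_mult s)
      then show "summable (\<lambda>k. norm (indicator ucube t *\<^sub>R f (ivec k + t)))"
        by (rule summable_comparison_test[rotated]) (use bd in auto)
    qed
    show "summable (\<lambda>k. \<integral>t. norm (indicator ucube t *\<^sub>R f (ivec k + t)) \<partial>lborel)"
    proof (rule summable_comparison_test[OF _ s], intro exI allI impI)
      fix k
      have "(\<integral>t. norm (indicator ucube t *\<^sub>R f (ivec k + t)) \<partial>lborel) \<le> (\<integral>t. indicator (ucube::'a set) t * (B / wt (ivec k :: 'a) ^ ?N) \<partial>lborel)"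
        by (intro integral_mono integrable_norm i1 ib bd)
      also have "\<dots> = B / wt (ivec k :: 'a) ^ ?N"
        by (simp add: measure_def emeasure_ucube)
      finally show "norm (\<integral>t. norm (indicator ucube t *\<^sub>R f (ivec k + t)) \<partial>lborel) \<le> B / wt (ivec k :: 'a) ^ ?N"
        by simp
    qed
  qed
  finally show ?thesis .
qed

text \<open>The Weierstrass test is applied on balls, because the majorant of the shifted terms
  grows with the shift.\<close>

lemma continuous_on_periodization:
  fixes f :: "'a::euclidean_space \<Rightarrow> complex"
  assumes c: "continuous_on UNIV f" and d: "\<And>t. norm (f t) \<le> C / wt t ^ (2 * DIM('a))"
  shows "continuous_on UNIV (\<lambda>t. \<Sum>k. f (ivec k + t))"
proof -
  let ?N = "2 * DIM('a)"
  have C0: "0 \<le> C" using d by (rule decay_const_nonneg)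
  have "continuous_on (ball 0 R) (\<lambda>t. \<Sum>k. f (ivec k + t))" for R
  proof (rule uniform_limit_theorem)
    show "uniform_limit (ball 0 R) (\<lambda>n t. \<Sum>k<n. f (ivec k + t)) (\<lambda>t. \<Sum>k. f (ivec k + t)) sequentially"
    proof (rule Weierstrass_m_test)
      fix k and t :: 'a assume t: "t \<in> ball 0 R"
      have "norm (f (t + ivec k)) \<le> (C * wt t ^ ?N) / wt (ivec k :: 'a) ^ ?N"
        by (rule decay_shift[of f, OF d])
      also have "\<dots> \<le> (C * (1 + R) ^ ?N) / wt (ivec k :: 'a) ^ ?N"
        using t C0 by (intro divide_right_mono mult_left_mono power_mono) (auto simp: wt_def)
      finally show "norm (f (ivec k + t)) \<le> (C * (1 + R) ^ ?N) * (1 / wt (ivec k :: 'a) ^ ?N)"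
        by (simp add: add.commute)
    qed (intro summable_mult summable_wt)
    show "\<forall>\<^sub>F n in sequentially. continuous_on (ball 0 R) (\<lambda>t. \<Sum>k<n. f (ivec k + t))"
      by (intro always_eventually allI continuous_intros continuous_on_compose2[OF c]) auto
  qed simp
  then show ?thesis
    unfolding continuous_on_eq_continuous_at[OF open_ball] continuous_on_eq_continuous_at[OF open_UNIV]
    by (metis mem_ball_0 gt_ex)
qed

section \<open>Poisson summation, by testing periodizations against a trigonometric bump\<close>

text \<open>A trigonometric polynomial with integer frequencies that reaches its maximum 1 over the
  closed unit cube only at the centre. The first property keeps products with it inside the spectral
  condition \<open>nullspec\<close>, the second makes its powers concentrate.\<close>

definition bump :: "'a::euclidean_space \<Rightarrow> real" where
  "bump t = (\<Prod>i\<in>Basis. (sin (pi * (t \<bullet> i)))\<^sup>2)"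

lemma bump_nonneg: "0 \<le> bump t"
  unfolding bump_def by (intro prod_nonneg) auto

lemma sin_square_le_1: "(sin x)\<^sup>2 \<le> (1::real)"
  by (simp add: abs_square_le_1)

lemma bump_le_1: "bump t \<le> 1"
  unfolding bump_def by (intro prod_le_1) (auto intro!: sin_square_le_1)

lemma continuous_on_bump: "continuous_on A bump"
  unfolding bump_def by (intro continuous_intros)

lemma bump_centre: "bump ((1/2) *\<^sub>R One :: 'a::euclidean_space) = 1"
  unfolding bump_def by (intro prod.neutral) simp

lemma bump_less_1:
  assumes t: "t \<in> cbox 0 One" "t \<noteq> (1/2) *\<^sub>R (One :: 'a::euclidean_space)"
  shows "bump t < 1"
proof -
  have "\<exists>i\<in>Basis. t \<bullet> i \<noteq> 1/2"
    using t(2) by (auto simp: euclidean_eq_iff[where 'a='a])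
  then obtain i where i: "i \<in> Basis" "t \<bullet> i \<noteq> 1/2" by auto
  have ti: "0 \<le> t \<bullet> i" "t \<bullet> i \<le> 1" using t(1) i by (auto simp: mem_box)
  have "cos (pi * (t \<bullet> i)) \<noteq> 0"
  proof
    assume z: "cos (pi * (t \<bullet> i)) = 0"
    have "0 \<le> pi * (t \<bullet> i)" "pi * (t \<bullet> i) \<le> pi"
      using ti mult_left_mono[of "t \<bullet> i" 1 pi] by auto
    then have "pi * (t \<bullet> i) = pi / 2" using z
      by (metis cos_pi_half cos_inj_pi pi_half_ge_zero pi_half_le_two divide_le_eq_1_pos field_sum_of_halves le_add_same_cancel1 order_trans)
    then have "t \<bullet> i = 1/2" using pi_gt_zero by (simp add: field_simps)
    with i show False by simp
  qed
  then have s: "(sin (pi * (t \<bullet> i)))\<^sup>2 < 1"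
    using sin_cos_squared_add[of "pi * (t \<bullet> i)"] zero_less_power2[of "cos (pi * (t \<bullet> i))"] by linarith
  have "bump t = (sin (pi * (t \<bullet> i)))\<^sup>2 * (\<Prod>j\<in>Basis-{i}. (sin (pi * (t \<bullet> j)))\<^sup>2)"
    unfolding bump_def using i by (simp add: prod.remove)
  also have "\<dots> \<le> (sin (pi * (t \<bullet> i)))\<^sup>2 * 1"
    by (intro mult_left_mono prod_le_1) (auto intro!: sin_square_le_1)
  finally show ?thesis using s by simp
qed

lemma sin_square_periodic: "m \<in> \<int> \<Longrightarrow> (sin (pi * (m + x)))\<^sup>2 = (sin (pi * x))\<^sup>2" for x m :: real
proof -
  assume m: "m \<in> \<int>"
  have "sin (pi * m) = 0" using m by (auto simp: Ints_def mult.commute)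
  moreover from this have "(cos (pi * m))\<^sup>2 = 1" using sin_cos_squared_add[of "pi * m"] by simp
  ultimately show ?thesis by (simp add: distrib_left sin_add power_mult_distrib)
qed

lemma bump_periodic: "z \<in> ivecs \<Longrightarrow> bump (z + t) = bump t"
  unfolding bump_def by (intro prod.cong) (auto simp: inner_add_left sin_square_periodic ivecs_def)

text \<open>The powers of the bump concentrate at the centre of the cube, so orthogonality to all of them
  forces a continuous function to vanish there.\<close>

lemma zero_at_centre_if_orthogonal:
  fixes F :: "'a::euclidean_space \<Rightarrow> complex"
  assumes c: "continuous_on UNIV F"
    and orth: "\<And>M. (\<integral>t. (indicator ucube t * bump t ^ M) *\<^sub>R F t \<partial>lborel) = 0"
  shows "F ((1/2) *\<^sub>R One) = 0"
proof (rule ccontr)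
  define h :: 'a where "h = (1/2) *\<^sub>R One"
  assume "F ((1/2) *\<^sub>R One) \<noteq> 0"
  then have d: "0 < norm (F h)" (is "0 < ?d") by (simp add: h_def)
  have [measurable]: "F \<in> borel_measurable borel" "(bump :: 'a \<Rightarrow> real) \<in> borel_measurable borel"
    by (intro borel_measurable_continuous_onI c continuous_on_bump)+
  obtain \<eta> where \<eta>: "\<eta> > 0" "\<And>t. dist t h < \<eta> \<Longrightarrow> dist (F t) (F h) < ?d / 2"
    using c d unfolding continuous_on_iff by (metis UNIV_I half_gt_zero)
  obtain B where B: "\<And>t. t \<in> cbox 0 One \<Longrightarrow> norm (F t - F h) \<le> B"
  proof -
    have "compact ((\<lambda>t. F t - F h) ` cbox 0 One)"
      by (intro compact_continuous_image continuous_intros continuous_on_subset[OF c]) auto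
    then show ?thesis using that by (metis compact_imp_bounded bounded_iff imageI)
  qed
  have hbox: "h \<in> box 0 One" by (auto simp: h_def mem_box)
  then have "h \<in> cbox 0 One" using box_subset_cbox by blast
  then have B0: "0 \<le> B" using B[of h] by simp
  \<comment> \<open>Away from the centre the bump attains its maximum on a compact set, and this
    maximum is below 1.\<close>
  obtain \<theta> where \<theta>: "0 \<le> \<theta>" "\<theta> < 1" "\<And>t. t \<in> cbox 0 One \<Longrightarrow> \<not> dist t h < \<eta> \<Longrightarrow> bump t \<le> \<theta>"
  proof -
    let ?K = "cbox 0 One - ball h \<eta>"
    have K: "compact ?K" by (intro compact_diff compact_cbox open_ball)
    show ?thesis
    proof (cases "?K = {}")
      case True
      show ?thesis by (rule that[of 0]) (use True in \<open>auto simp: dist_commute\<close>)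
    next
      case False
      then obtain x where x: "x \<in> ?K" "\<And>t. t \<in> ?K \<Longrightarrow> bump t \<le> bump x"
        using continuous_attains_sup[OF K False continuous_on_bump] by blast
      then have "x \<noteq> h" using \<eta>(1) by auto
      then have "bump x < 1" using x(1) bump_less_1[of x] by (auto simp: h_def)
      then show ?thesis by (intro that[of "bump x"] bump_nonneg) (use x(2) in \<open>auto simp: dist_commute\<close>)
    qed
  qed
  \<comment> \<open>Strictly between \<open>\<theta>\<close> and 1. Near the centre the bump exceeds
    \<open>\<theta>'\<close>, so the integral of its \<open>M\<close>-th power is at least
    \<open>b * \<theta>' ^ M\<close>, which for large \<open>M\<close> outweighs the contribution
    \<open>B * \<theta> ^ M\<close> from far away.\<close>
  define \<theta>' where "\<theta>' = (\<theta> + 1) / 2"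
  have \<theta>': "\<theta> < \<theta>'" "\<theta>' < 1" "0 < \<theta>'" using \<theta> by (auto simp: \<theta>'_def)
  have "open (box 0 One \<inter> bump -` {\<theta>'<..} :: 'a set)"
    by (intro open_Int open_box open_vimage continuous_on_bump) auto
  moreover have "h \<in> box 0 One \<inter> bump -` {\<theta>'<..}" using hbox bump_centre[where 'a='a] \<theta>' by (simp add: h_def)
  ultimately obtain e where e: "e > 0" "ball h e \<subseteq> box 0 One \<inter> bump -` {\<theta>'<..}"
    by (meson openE)
  define b where "b = measure lborel (ball h e)"
  have b: "b > 0" unfolding b_def using content_ball_pos[OF e(1), of h] by simp
  have intI: "integrable lborel (\<lambda>t::'a. indicator ucube t * g t)"
    if [measurable]: "g \<in> borel_measurable borel" and g: "\<And>t. t \<in> cbox 0 One \<Longrightarrow> \<bar>g t\<bar> \<le> D" for g :: "'a \<Rightarrow> real" and D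
  proof (rule Bochner_Integration.integrable_bound)
    show "integrable lborel (\<lambda>t::'a. indicator ucube t * D)"
      by (intro integrable_mult_left) (simp add: emeasure_ucube)
    show "AE t in lborel. norm (indicator ucube t * g t) \<le> norm (indicator (ucube::'a set) t * D)"
      using g ucube_cbox by (force simp: indicator_def intro: order_trans[OF _ abs_ge_self])
  qed measurable
  have bM: "\<bar>bump t ^ M\<bar> \<le> 1" for M and t :: 'a
    by (simp add: bump_nonneg bump_le_1 power_le_one)
  have key: "b \<le> (2 * B / ?d) * (\<theta> / \<theta>') ^ M" for M
  proof -
    define I where "I = (\<integral>t. indicator (ucube::'a set) t * bump t ^ M \<partial>lborel)"
    have iU: "integrable lborel (\<lambda>t::'a. indicator ucube t * bump t ^ M)"
      by (rule intI[of _ 1]) (auto simp: bM)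
    have iC: "integrable lborel (\<lambda>t. indicator (ucube::'a set) t * (B * \<theta> ^ M))"
      by (rule intI[where D="B * \<theta> ^ M"]) (auto simp: B0 \<theta>(1))
    have iFh: "integrable lborel (\<lambda>t::'a. (indicator ucube t * bump t ^ M) *\<^sub>R F h)"
      using iU by (intro integrable_scaleR_left)
    have iD: "integrable lborel (\<lambda>t::'a. (indicator ucube t * bump t ^ M) *\<^sub>R (F t - F h))"
    proof (rule Bochner_Integration.integrable_bound)
      show "integrable lborel (\<lambda>t::'a. indicator ucube t * B)"
        by (intro integrable_mult_left) (simp add: emeasure_ucube)
      show "AE t in lborel. norm ((indicator ucube t * bump t ^ M) *\<^sub>R (F t - F h)) \<le> norm (indicator (ucube::'a set) t * B)"
      proof (rule AE_I2)
        fix t :: 'a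
        show "norm ((indicator ucube t * bump t ^ M) *\<^sub>R (F t - F h)) \<le> norm (indicator (ucube::'a set) t * B)"
          using mult_mono[OF bM[where M=M and t=t] B[of t]] ucube_cbox B0 by (auto simp: indicator_def)
      qed
    qed measurable
    \<comment> \<open>Orthogonality turns \<open>I\<close> times \<open>F h\<close> into the
      integral of the deviation of \<open>F\<close> from \<open>F h\<close>. That deviation is at
      most half of \<open>norm (F h)\<close> near the centre, so half of the left-hand side can be
      absorbed.\<close>
    have "0 = (\<integral>t. (indicator ucube t * bump t ^ M) *\<^sub>R (F t - F h) + (indicator ucube t * bump t ^ M) *\<^sub>R F h \<partial>lborel)"
      using orth[of M] by (simp add: scaleR_diff_right)
    also have "\<dots> = (\<integral>t. (indicator ucube t * bump t ^ M) *\<^sub>R (F t - F h) \<partial>lborel) + I *\<^sub>R F h"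
      unfolding I_def by (subst Bochner_Integration.integral_add[OF iD iFh]) (simp add: iU)
    finally have "I *\<^sub>R F h = - (\<integral>t. (indicator ucube t * bump t ^ M) *\<^sub>R (F t - F h) \<partial>lborel)"
      by (simp add: eq_neg_iff_add_eq_0 add.commute)
    then have "\<bar>I\<bar> * ?d = norm (\<integral>t. (indicator ucube t * bump t ^ M) *\<^sub>R (F t - F h) \<partial>lborel)"
      by (metis norm_minus_cancel norm_scaleR)
    also have "\<dots> \<le> (\<integral>t. ?d / 2 * (indicator (ucube::'a set) t * bump t ^ M) + indicator (ucube::'a set) t * (B * \<theta> ^ M) \<partial>lborel)"
    proof (rule Bochner_Integration.integral_norm_bound_integral[OF iD])
      show "integrable lborel (\<lambda>t. ?d / 2 * (indicator (ucube::'a set) t * bump t ^ M) + indicator (ucube::'a set) t * (B * \<theta> ^ M))"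
        by (intro Bochner_Integration.integrable_add integrable_mult_right iU iC)
      fix t :: 'a
      show "norm ((indicator ucube t * bump t ^ M) *\<^sub>R (F t - F h)) \<le> ?d / 2 * (indicator (ucube::'a set) t * bump t ^ M) + indicator (ucube::'a set) t * (B * \<theta> ^ M)"
      proof (cases "t \<in> ucube")
        case True
        then have tc: "t \<in> cbox 0 One" using ucube_cbox by blast
        show ?thesis
        proof (cases "dist t h < \<eta>")
          case near: True
          have "bump t ^ M * norm (F t - F h) \<le> bump t ^ M * (?d / 2)"
            using \<eta>(2)[OF near] by (intro mult_left_mono) (auto simp: bump_nonneg dist_norm)
          moreover have "0 \<le> B * \<theta> ^ M" using B0 \<theta>(1) by simp
          ultimately show ?thesis using True by (simp add: bump_nonneg mult.commute)
        next
          case False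
          have "bump t ^ M * norm (F t - F h) \<le> \<theta> ^ M * B"
            using \<theta>(3)[OF tc False] B[OF tc] \<theta>(1) by (intro mult_mono power_mono) (auto simp: bump_nonneg)
          then have "bump t ^ M * norm (F t - F h) \<le> ?d / 2 * bump t ^ M + B * \<theta> ^ M"
          proof -
            have "0 \<le> ?d / 2 * bump t ^ M" by (simp add: bump_nonneg)
            with \<open>bump t ^ M * norm (F t - F h) \<le> \<theta> ^ M * B\<close> show ?thesis
              unfolding mult.commute[of B] by linarith
          qed
          then show ?thesis using True by (simp add: bump_nonneg)
        qed
      qed simp
    qed
    also have "\<dots> = ?d / 2 * I + B * \<theta> ^ M"
      unfolding I_def Bochner_Integration.integral_add[OF integrable_mult_right[OF iU] iC]
      by (simp add: measure_def emeasure_ucube)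
    finally have 1: "\<bar>I\<bar> * ?d \<le> ?d / 2 * I + B * \<theta> ^ M" .
    have 2: "\<theta>' ^ M * b \<le> I"
    proof -
      have "\<theta>' ^ M * b = (\<integral>t. indicator (ball h e) t * \<theta>' ^ M \<partial>lborel)"
        by (simp add: b_def)
      also have "\<dots> \<le> I" unfolding I_def
      proof (rule integral_mono[OF _ iU])
        show "integrable lborel (\<lambda>t. indicator (ball h e) t * \<theta>' ^ M)"
          using emeasure_lborel_ball_finite[of h e] by (intro integrable_mult_left integrable_real_indicator) simp_all
        fix t :: 'a
        show "indicator (ball h e) t * \<theta>' ^ M \<le> indicator ucube t * bump t ^ M"
        proof (cases "t \<in> ball h e")
          case True
          then have "t \<in> box 0 One" "\<theta>' < bump t" using e(2) by auto
          then show ?thesis using True box_ucube \<theta>'(3) by (auto simp: indicator_def intro!: power_mono)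
        qed (simp add: bump_nonneg)
      qed
      finally show ?thesis .
    qed
    have "0 \<le> I" using 2 b \<theta>'(3) by (smt (verit) mult_nonneg_nonneg zero_le_power)
    then have "I * ?d \<le> ?d / 2 * I + B * \<theta> ^ M" using 1 by simp
    then have "I \<le> (2 * B / ?d) * \<theta> ^ M" using d by (simp add: field_simps)
    then have "\<theta>' ^ M * b \<le> (2 * B / ?d) * \<theta> ^ M" using 2 by simp
    then have "b \<le> ((2 * B / ?d) * \<theta> ^ M) / \<theta>' ^ M"
      using \<theta>'(3) by (subst pos_le_divide_eq) (auto simp only: mult.commute[of b] zero_less_power)
    then show ?thesis by (simp only: power_divide times_divide_eq_right)
  qed
  have "(\<lambda>M. (2 * B / ?d) * (\<theta> / \<theta>') ^ M) \<longlonglongrightarrow> (2 * B / ?d) * 0"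
    using \<theta> \<theta>' by (intro tendsto_mult tendsto_const LIMSEQ_realpow_zero) (auto simp: field_simps)
  then have "b \<le> (2 * B / ?d) * 0" using key by (intro LIMSEQ_le_const) auto
  then show False using b by simp
qed

text \<open>The integrals are the Fourier coefficients of the periodization of \<open>W\<close>
  (\<open>l\<close> runs through a set closed under negation, so the sign is immaterial); the decay
  makes all integrals and lattice sums absolutely convergent.\<close>

definition nullspec :: "('a::euclidean_space \<Rightarrow> complex) \<Rightarrow> bool" where
  "nullspec W \<longleftrightarrow> continuous_on UNIV W \<and> (\<exists>C. \<forall>t. norm (W t) \<le> C / wt t ^ (2 * DIM('a))) \<and>
     (\<forall>l\<in>ivecs. (\<integral>t. W t * cis (2 * pi * (l \<bullet> t)) \<partial>lborel) = 0)"

lemma sin_square_cis: "complex_of_real ((sin x)\<^sup>2) = 1/2 - cis (2 * x) / 4 - cis (- (2 * x)) / 4"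
  using cos_double_sin[of x] by (intro complex_eqI) (simp_all add: field_simps)

lemma decay_mult_bounded:
  fixes f :: "'a::real_normed_vector \<Rightarrow> complex"
  assumes "\<And>t. norm (f t) \<le> C / wt t ^ N" "\<And>t. norm (g t) \<le> 1"
  shows "norm (f t * g t) \<le> C / wt t ^ N"
  using mult_mono[OF assms(1)[of t] assms(2)[of t]] assms(1)[of t] norm_ge_zero[of "f t"]
  by (simp add: norm_mult)

text \<open>By \<open>sin_square_cis\<close> the factor is a combination of the frequencies 0,
  \<open>i\<close> and \<open>- i\<close>, and these shifts map the lattice to itself.\<close>

lemma nullspec_sin:
  fixes W :: "'a::euclidean_space \<Rightarrow> complex"
  assumes W: "nullspec W" and i: "i \<in> Basis"
  shows "nullspec (\<lambda>t. of_real ((sin (pi * (t \<bullet> i)))\<^sup>2) * W t)"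
proof -
  obtain C where c: "continuous_on UNIV W" and C: "\<And>t. norm (W t) \<le> C / wt t ^ (2 * DIM('a))"
    and z: "\<And>l. l \<in> ivecs \<Longrightarrow> (\<integral>t. W t * cis (2 * pi * (l \<bullet> t)) \<partial>lborel) = 0"
    using W by (auto simp: nullspec_def)
  have "norm (W t * of_real ((sin (pi * (t \<bullet> i)))\<^sup>2)) \<le> C / wt t ^ (2 * DIM('a))" for t
    by (rule decay_mult_bounded[OF C]) (simp add: norm_power abs_square_le_1 sin_square_le_1)
  moreover have "(\<integral>t. of_real ((sin (pi * (t \<bullet> i)))\<^sup>2) * W t * cis (2 * pi * (l \<bullet> t)) \<partial>lborel) = 0"
    if l: "l \<in> ivecs" for l
  proof -
    let ?e = "\<lambda>l t. W t * cis (2 * pi * (l \<bullet> t))"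
    have int: "integrable lborel (?e l)" for l
      by (intro integrable_decay[where C=C] decay_mult_bounded C continuous_intros c) auto
    have "(\<lambda>t. of_real ((sin (pi * (t \<bullet> i)))\<^sup>2) * W t * cis (2 * pi * (l \<bullet> t))) =
      (\<lambda>t. ?e l t * (1/2) - ?e (l + i) t * (1/4) - ?e (l - i) t * (1/4))"
      unfolding sin_square_cis
      by (auto simp: fun_eq_iff algebra_simps inner_add_left inner_diff_left cis_mult inner_commute)
    moreover have "(\<integral>t. ?e l t * (1/2) - ?e (l + i) t * (1/4) - ?e (l - i) t * (1/4) \<partial>lborel) = 0"
      using l i by (simp add: int z ivecs_add ivecs_diff Basis_ivecs)
    ultimately show ?thesis by simp
  qed
  ultimately show ?thesis unfolding nullspec_def
    by (intro conjI continuous_intros c) (auto simp: mult.commute intro!: exI[of _ C])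
qed

lemma nullspec_bump:
  assumes "nullspec W" shows "nullspec (\<lambda>t. of_real (bump t) * W t)"
proof -
  have "nullspec (\<lambda>t. of_real (\<Prod>i\<in>S. (sin (pi * (t \<bullet> i)))\<^sup>2) * W t)" if "finite S" "S \<subseteq> Basis" for S
    using that
  proof (induction S rule: finite_induct)
    case empty
    then show ?case using assms by simp
  next
    case (insert i S)
    then have "nullspec (\<lambda>t. of_real (\<Prod>i\<in>S. (sin (pi * (t \<bullet> i)))\<^sup>2) * W t)" by simp
    from nullspec_sin[OF this, of i] insert show ?case by (simp add: mult.assoc)
  qed
  from this[OF finite_Basis subset_refl] show ?thesis by (simp add: bump_def)
qed

lemma nullspec_bump_power: "nullspec W \<Longrightarrow> nullspec (\<lambda>t. of_real (bump t ^ M) * W t)"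
proof (induction M)
  case (Suc M)
  from nullspec_bump[OF Suc.IH[OF Suc.prems]] show ?case by (simp add: mult.assoc)
qed simp

text \<open>Multiplying \<open>W\<close> by a power of the periodic bump keeps
  \<open>nullspec\<close>. Its frequency 0, unfolded over the tiles, says that the periodization is
  orthogonal to that power, so it vanishes at the centre.\<close>

lemma nullspec_periodization:
  fixes W :: "'a::euclidean_space \<Rightarrow> complex"
  assumes W: "nullspec W"
  shows "(\<Sum>k. W (ivec k + (1/2) *\<^sub>R One)) = 0"
proof -
  obtain C where c: "continuous_on UNIV W" and C: "\<And>t. norm (W t) \<le> C / wt t ^ (2 * DIM('a))"
    using W by (auto simp: nullspec_def)
  define F where "F t = (\<Sum>k. W (ivec k + t))" for t
  have "F ((1/2) *\<^sub>R One) = 0"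
  proof (rule zero_at_centre_if_orthogonal)
    show "continuous_on UNIV F" unfolding F_def by (rule continuous_on_periodization[OF c C])
    fix M
    let ?W = "\<lambda>t. complex_of_real (bump t ^ M) * W t"
    obtain C' where cM: "continuous_on UNIV ?W" and CM: "\<And>t. norm (?W t) \<le> C' / wt t ^ (2 * DIM('a))"
      and z: "(\<integral>t. ?W t * cis (2 * pi * (0 \<bullet> t)) \<partial>lborel) = 0"
      using nullspec_bump_power[OF W, of M] zero_ivecs unfolding nullspec_def by blast
    have "(\<integral>t. (indicator ucube t * bump t ^ M) *\<^sub>R F t \<partial>lborel) =
      (\<integral>t. (\<Sum>k. indicator ucube t *\<^sub>R ?W (ivec k + t)) \<partial>lborel)"
    proof (rule Bochner_Integration.integral_cong[OF refl])
      fix t :: 'a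
      have s: "summable (\<lambda>k. W (ivec k + t))"
        using summable_norm_cancel[OF summable_decay[of W, OF C, of t]] by (simp add: add.commute)
      have "(\<Sum>k. indicator ucube t *\<^sub>R ?W (ivec k + t)) = (\<Sum>k. (indicator ucube t * bump t ^ M) *\<^sub>R W (ivec k + t))"
        by (intro suminf_cong) (simp add: bump_periodic scaleR_conv_of_real mult.assoc)
      also have "\<dots> = (indicator ucube t * bump t ^ M) *\<^sub>R F t"
        unfolding F_def by (rule suminf_scaleR_right[OF s, symmetric])
      finally show "(indicator ucube t * bump t ^ M) *\<^sub>R F t = (\<Sum>k. indicator ucube t *\<^sub>R ?W (ivec k + t))" ..
    qed
    also have "\<dots> = 0" using integral_unfold[OF cM CM] z by simp
    finally show "(\<integral>t. (indicator ucube t * bump t ^ M) *\<^sub>R F t \<partial>lborel) = 0" .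
  qed
  then show ?thesis by (simp add: F_def)
qed

text \<open>The difference of two translates of \<open>W\<close> has zero coefficient at frequency 0
  as well, since translation only multiplies the coefficients by phases. It is therefore
  \<open>nullspec\<close>. The additional shift by \<open>- h\<close> places the two points to be
  compared at the centre of the cube, where the vanishing is known.\<close>

theorem poisson_shift:
  fixes W :: "'a::euclidean_space \<Rightarrow> complex"
  assumes c: "continuous_on UNIV W" and C: "\<And>t. norm (W t) \<le> C / wt t ^ (2 * DIM('a))"
    and z: "\<And>l. l \<in> ivecs \<Longrightarrow> l \<noteq> 0 \<Longrightarrow> (\<integral>t. W t * cis (2 * pi * (l \<bullet> t)) \<partial>lborel) = 0"
  shows "(\<Sum>k. W (s + ivec k)) = (\<Sum>k. W (ivec k))"
proof -
  have [measurable]: "W \<in> borel_measurable borel" using c by (rule borel_measurable_continuous_onI)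
  define h :: 'a where "h = (1/2) *\<^sub>R One"
  have Cs: "norm (W (a + t)) \<le> (C * wt a ^ (2 * DIM('a))) / wt t ^ (2 * DIM('a))" for a t
    by (rule decay_shift[of W, OF C])
  have cs: "continuous_on UNIV (\<lambda>t. W (a + t))" for a
    by (intro continuous_on_compose2[OF c] continuous_intros) auto
  have shift: "(\<integral>t. W (a + t) * cis (2 * pi * (l \<bullet> t)) \<partial>lborel) =
      cis (- (2 * pi * (l \<bullet> a))) * (\<integral>t. W t * cis (2 * pi * (l \<bullet> t)) \<partial>lborel)" for a l
  proof -
    have "(\<integral>t. W (a + t) * cis (2 * pi * (l \<bullet> t)) \<partial>lborel) =
       (\<integral>t. W (a + t) * cis (2 * pi * (l \<bullet> ((a + t) - a))) \<partial>lborel)" by simp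
    also have "\<dots> = (\<integral>t. W t * cis (2 * pi * (l \<bullet> (t - a))) \<partial>lborel)"
      by (rule integral_shift[of "\<lambda>t. W t * cis (2 * pi * (l \<bullet> (t - a)))"]) 
         (intro borel_measurable_continuous_onI continuous_intros c)
    also have "\<dots> = (\<integral>t. cis (- (2 * pi * (l \<bullet> a))) * (W t * cis (2 * pi * (l \<bullet> t))) \<partial>lborel)"
      by (intro Bochner_Integration.integral_cong) (auto simp: inner_diff_right algebra_simps cis_mult)
    finally show ?thesis by simp
  qed
  let ?W = "\<lambda>t. W (s - h + t) - W (- h + t)"
  have "nullspec ?W" unfolding nullspec_def
  proof (intro conjI ballI)
    show "continuous_on UNIV ?W" by (intro continuous_intros cs)
    let ?C = "C * wt (s - h) ^ (2 * DIM('a)) + C * wt (- h) ^ (2 * DIM('a))"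
    show "\<exists>C. \<forall>t. norm (?W t) \<le> C / wt t ^ (2 * DIM('a))"
    proof (intro exI[of _ ?C] allI)
      fix t
      show "norm (?W t) \<le> ?C / wt t ^ (2 * DIM('a))"
        using norm_triangle_ineq4[of "W (s - h + t)" "W (- h + t)"] Cs[of "s - h" t] Cs[of "- h" t]
        unfolding add_divide_distrib by linarith
    qed
    fix l :: 'a assume l: "l \<in> ivecs"
    have int: "integrable lborel (\<lambda>t. W (a + t) * cis (2 * pi * (l \<bullet> t)))" for a
      by (rule integrable_decay, (intro continuous_intros cs)[1], rule decay_mult_bounded, rule Cs, simp)
    have "(\<integral>t. ?W t * cis (2 * pi * (l \<bullet> t)) \<partial>lborel) =
      (cis (- (2 * pi * (l \<bullet> (s - h)))) - cis (- (2 * pi * (l \<bullet> (- h))))) * (\<integral>t. W t * cis (2 * pi * (l \<bullet> t)) \<partial>lborel)"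
      by (simp only: left_diff_distrib Bochner_Integration.integral_diff[OF int int] shift)
    also have "\<dots> = 0" using z[OF l] by (cases "l = 0") auto
    finally show "(\<integral>t. ?W t * cis (2 * pi * (l \<bullet> t)) \<partial>lborel) = 0" .
  qed
  then have "(\<Sum>k. ?W (ivec k + h)) = 0" unfolding h_def by (rule nullspec_periodization)
  then have "(\<Sum>k. W (s + ivec k) - W (ivec k)) = 0" by (simp add: algebra_simps)
  moreover have sm: "summable (\<lambda>k. W (a + ivec k))" for a
    by (rule summable_norm_cancel[OF summable_decay[of W, OF C]])
  ultimately show ?thesis using suminf_diff[OF sm[of s] sm[of 0]] by simp
qed

section \<open>Cardinal sines and band-limited functions\<close>

definition snc :: "real \<Rightarrow> real" where
  "snc x = (if x = 0 then 1 else sin x / x)"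

lemma abs_snc_le_1: "\<bar>snc x\<bar> \<le> 1"
  using abs_sin_x_le_abs_x[of x] by (simp add: snc_def divide_le_eq)

lemma abs_mult_snc_le_1: "\<bar>x\<bar> * \<bar>snc x\<bar> \<le> 1"
  by (simp add: snc_def)

lemma snc_scaled_bound: "0 < A \<Longrightarrow> \<bar>snc (u / A)\<bar> \<le> (1 + A) / (1 + \<bar>u\<bar>)"
proof -
  assume A: "0 < A"
  have "A * (\<bar>u / A\<bar> * \<bar>snc (u / A)\<bar>) \<le> A * 1"
    by (rule mult_left_mono[OF abs_mult_snc_le_1]) (use A in simp)
  then have "\<bar>snc (u / A)\<bar> * (1 + \<bar>u\<bar>) \<le> 1 + A"
    using abs_snc_le_1[of "u / A"] A by (simp add: algebra_simps)
  then show ?thesis by (simp add: pos_le_divide_eq)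
qed

lemma continuous_on_snc_UNIV: "continuous_on UNIV snc"
proof -
  have "isCont snc x" for x
  proof (cases "x = 0")
    case True
    have "((\<lambda>h. sin h / h) \<longlongrightarrow> (1::real)) (at 0)"
      using DERIV_sin[of "0::real"] by (simp add: DERIV_def)
    then have "(snc \<longlongrightarrow> 1) (at 0)"
      by (rule Lim_transform_eventually) (auto simp: eventually_at_filter snc_def)
    then show ?thesis using True by (simp add: isCont_def snc_def)
  next
    case False
    have "isCont (\<lambda>x. sin x / x) x" using False by (intro continuous_intros) auto
    moreover have "\<forall>\<^sub>F y in nhds x. snc y = sin y / y"
      using False t1_space_nhds[of x 0] by (auto simp: snc_def elim: eventually_mono)
    ultimately show ?thesis by (simp add: isCont_cong)
  qed
  then show ?thesis by (simp add: continuous_on_eq_continuous_at)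
qed

lemma continuous_on_snc[continuous_intros]:
  "continuous_on A f \<Longrightarrow> continuous_on A (\<lambda>x. snc (f x))"
  by (rule continuous_on_compose2[OF continuous_on_snc_UNIV]) auto

lemma snc_integral: "snc x = (\<integral>\<sigma>. indicator {0..1} \<sigma> * cos (\<sigma> * x) \<partial>lborel)"
proof (cases "x = 0")
  case True
  then show ?thesis by (simp add: snc_def)
next
  case False
  have "(\<integral>\<sigma>. indicator {0..1} \<sigma> *\<^sub>R cos (\<sigma> * x) \<partial>lborel) = sin (1 * x) / x - sin (0 * x) / x"
  proof (rule integral_FTC_Icc)
    show "((\<lambda>\<sigma>. sin (\<sigma> * x) / x) has_vector_derivative cos (\<sigma> * x)) (at \<sigma> within {0..1})" for \<sigma>
      using False by (auto intro!: derivative_eq_intros simp: has_real_derivative_iff_has_vector_derivative[symmetric])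
  qed (auto intro!: continuous_intros)
  then show ?thesis using False by (simp add: snc_def)
qed

text \<open>The spectrum lies in the box with half-widths \<open>\<beta> i\<close>. A box is more
  convenient than a ball because a factor depending on one coordinate widens only the corresponding
  side.\<close>

definition bandlimited :: "('a::euclidean_space \<Rightarrow> real) \<Rightarrow> ('a \<Rightarrow> complex) \<Rightarrow> bool" where
  "bandlimited \<beta> W \<longleftrightarrow> continuous_on UNIV W \<and> (\<exists>C. \<forall>t. norm (W t) \<le> C / wt t ^ (2 * DIM('a))) \<and>
     (\<forall>\<xi>. (\<exists>i\<in>Basis. \<beta> i < \<bar>\<xi> \<bullet> i\<bar>) \<longrightarrow> (\<integral>t. W t * cis (- (t \<bullet> \<xi>)) \<partial>lborel) = 0)"

lemma measurable_cis[measurable]: "cis \<in> borel_measurable borel"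
  by (intro borel_measurable_continuous_onI continuous_intros)

text \<open>Since the cardinal sine is an average of cosines, multiplication by it
  smears the spectrum over a bounded interval.\<close>

lemma bandlimited_snc:
  fixes W :: "'a::euclidean_space \<Rightarrow> complex"
  assumes W: "bandlimited \<beta> W" and i: "i \<in> Basis"
  shows "bandlimited (\<beta>(i := \<beta> i + \<bar>b\<bar>)) (\<lambda>t. of_real (snc (b * (t \<bullet> i))) * W t)"
proof -
  obtain C where c: "continuous_on UNIV W" and C: "\<And>t. norm (W t) \<le> C / wt t ^ (2 * DIM('a))"
    and z: "\<And>\<xi> j. j \<in> Basis \<Longrightarrow> \<beta> j < \<bar>\<xi> \<bullet> j\<bar> \<Longrightarrow> (\<integral>t. W t * cis (- (t \<bullet> \<xi>)) \<partial>lborel) = 0"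
    using W unfolding bandlimited_def by blast
  have [measurable]: "W \<in> borel_measurable borel" using c by (rule borel_measurable_continuous_onI)
  have iW: "integrable lborel W" by (rule integrable_decay[OF c C])
  have "norm (W t * of_real (snc (b * (t \<bullet> i)))) \<le> C / wt t ^ (2 * DIM('a))" for t
    by (rule decay_mult_bounded[OF C]) (simp add: abs_snc_le_1)
  moreover have "(\<integral>t. of_real (snc (b * (t \<bullet> i))) * W t * cis (- (t \<bullet> \<xi>)) \<partial>lborel) = 0"
    if j: "j \<in> Basis" "(\<beta>(i := \<beta> i + \<bar>b\<bar>)) j < \<bar>\<xi> \<bullet> j\<bar>" for \<xi> j
  proof -
    have eint: "integrable lborel (\<lambda>t. W t * cis (- (t \<bullet> \<eta>)))" for \<eta>
      by (rule integrable_decay[where C=C], (intro continuous_intros c)[1], rule decay_mult_bounded, rule C, simp)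
    \<comment> \<open>The averaged frequencies differ from \<open>\<xi>\<close> only along
      \<open>i\<close>, by at most \<open>|b|\<close>; the enlarged half-width in that coordinate
      keeps all of them outside the old box.\<close>
    have out: "\<beta> j < \<bar>(\<xi> + a *\<^sub>R i) \<bullet> j\<bar>" if "\<bar>a\<bar> \<le> \<bar>b\<bar>" for a
      using j i that by (auto simp: inner_add_left inner_Basis split: if_splits)
    let ?f = "\<lambda>t \<sigma>. (indicator {0..1} \<sigma> * cos (\<sigma> * (b * (t \<bullet> i)))) *\<^sub>R (W t * cis (- (t \<bullet> \<xi>)))"
    have int: "integrable (lborel \<Otimes>\<^sub>M lborel) (case_prod ?f)"
    proof (rule lborel_pair.Fubini_integrable)
      show "case_prod ?f \<in> borel_measurable (lborel \<Otimes>\<^sub>M lborel)" by measurable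
      have nb: "norm (?f t \<sigma>) \<le> indicator {0..1} \<sigma> * norm (W t)" for t \<sigma>
        by (auto simp: norm_mult indicator_def intro!: mult_left_le_one_le)
      have ii: "integrable lborel (\<lambda>\<sigma>::real. indicator {0..1} \<sigma> * norm (W t))" for t
        by (intro integrable_mult_left integrable_real_indicator) auto
      have i2: "integrable lborel (?f t)" for t
        by (rule Bochner_Integration.integrable_bound[OF ii[of t]])
           (measurable, rule AE_I2, rule order_trans[OF nb], unfold real_norm_def, rule abs_ge_self)
      then show "AE t in lborel. integrable lborel (\<lambda>\<sigma>. case_prod ?f (t, \<sigma>))" by simp
      have "integrable lborel (\<lambda>t. \<integral>\<sigma>. norm (?f t \<sigma>) \<partial>lborel)"
      proof (rule Bochner_Integration.integrable_bound[OF integrable_norm[OF iW]])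
        show "(\<lambda>t. \<integral>\<sigma>. norm (?f t \<sigma>) \<partial>lborel) \<in> borel_measurable lborel" by measurable
        have "(\<integral>\<sigma>. norm (?f t \<sigma>) \<partial>lborel) \<le> norm (W t)" for t
          using integral_mono[OF integrable_norm[OF i2[of t]] ii[of t] nb] by simp
        then show "AE t in lborel. norm (\<integral>\<sigma>. norm (?f t \<sigma>) \<partial>lborel) \<le> norm (norm (W t))" by simp
      qed
      then show "integrable lborel (\<lambda>t. \<integral>\<sigma>. norm (case_prod ?f (t, \<sigma>)) \<partial>lborel)" by simp
    qed
    have "(\<integral>t. of_real (snc (b * (t \<bullet> i))) * W t * cis (- (t \<bullet> \<xi>)) \<partial>lborel) = (\<integral>t. (\<integral>\<sigma>. ?f t \<sigma> \<partial>lborel) \<partial>lborel)"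
    proof (rule Bochner_Integration.integral_cong[OF refl])
      fix t
      have "integrable lborel (\<lambda>\<sigma>. indicator {0..1} \<sigma> * cos (\<sigma> * (b * (t \<bullet> i))))"
        by (rule Bochner_Integration.integrable_bound[of _ "indicator {0..1::real} :: real \<Rightarrow> real"])
           (auto simp: indicator_def)
      then have "(\<integral>\<sigma>. ?f t \<sigma> \<partial>lborel) = snc (b * (t \<bullet> i)) *\<^sub>R (W t * cis (- (t \<bullet> \<xi>)))"
        unfolding snc_integral by (intro Bochner_Integration.integral_scaleR_left)
      then show "of_real (snc (b * (t \<bullet> i))) * W t * cis (- (t \<bullet> \<xi>)) = (\<integral>\<sigma>. ?f t \<sigma> \<partial>lborel)"
        by (simp add: scaleR_conv_of_real mult.assoc)
    qed
    also have "\<dots> = (\<integral>\<sigma>. (\<integral>t. ?f t \<sigma> \<partial>lborel) \<partial>lborel)"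
      by (rule lborel_pair.Fubini_integral[OF int, symmetric])
    also have "\<dots> = (\<integral>\<sigma>. 0 \<partial>(lborel :: real measure))"
    proof (rule Bochner_Integration.integral_cong[OF refl])
      fix \<sigma> :: real
      show "(\<integral>t. ?f t \<sigma> \<partial>lborel) = 0"
      proof (cases "\<sigma> \<in> {0..1}")
        case True
        then have a: "\<bar>\<sigma> * b\<bar> \<le> \<bar>b\<bar>" by (auto simp: abs_mult intro!: mult_left_le_one_le)
        have "?f t \<sigma> = (1/2) * (W t * cis (- (t \<bullet> (\<xi> + (\<sigma> * b) *\<^sub>R i)))) + (1/2) * (W t * cis (- (t \<bullet> (\<xi> + (- (\<sigma> * b)) *\<^sub>R i))))" for t
        proof -
          have e: "complex_of_real (cos y) * cis u = (1/2) * cis (u - y) + (1/2) * cis (u + y)" for y u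
            by (rule complex_eqI) (simp_all add: cos_add cos_diff sin_add sin_diff field_simps)
          have "?f t \<sigma> = W t * (complex_of_real (cos (\<sigma> * b * (t \<bullet> i))) * cis (- (t \<bullet> \<xi>)))"
            using True by (simp add: scaleR_conv_of_real mult_ac)
          also have "\<dots> = (1/2) * (W t * cis (- (t \<bullet> (\<xi> + (\<sigma> * b) *\<^sub>R i)))) + (1/2) * (W t * cis (- (t \<bullet> (\<xi> + (- (\<sigma> * b)) *\<^sub>R i))))"
            unfolding e by (simp add: inner_add_right inner_diff_right algebra_simps)
          finally show ?thesis .
        qed
        then show ?thesis
          using z[OF j(1) out[OF a]] z[OF j(1) out[of "- (\<sigma> * b)"]] a by (simp add: eint)
      qed simp
    qed
    finally show ?thesis by simp
  qed
  ultimately show ?thesis unfolding bandlimited_def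
    by (intro conjI continuous_intros c allI impI) (auto simp: mult.commute intro!: exI[of _ C])
qed

lemma bandlimited_snc_power:
  assumes W: "bandlimited \<beta> W" and i: "i \<in> Basis"
  shows "bandlimited (\<beta>(i := \<beta> i + real J * \<bar>b\<bar>)) (\<lambda>t. of_real (snc (b * (t \<bullet> i)) ^ J) * W t)"
proof (induction J)
  case 0
  then show ?case using W by simp
next
  case (Suc J)
  have eq: "\<beta> i + real J * \<bar>b\<bar> + \<bar>b\<bar> = \<beta> i + real (Suc J) * \<bar>b\<bar>"
    by (simp add: algebra_simps)
  from bandlimited_snc[OF Suc i, of b] show ?case
    unfolding fun_upd_upd fun_upd_same eq by (simp only: power_Suc of_real_mult mult.assoc)
qed

section \<open>The sampling kernel and the sampling formula\<close>

text \<open>The factor with \<open>pi\<close> produces the zeros at the nonzero lattice points. A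
  power \<open>J\<close> of a cardinal sine dilated by \<open>2 * J\<close> gives decay of order
  \<open>J\<close> while widening the band by only \<open>1/2\<close>, whatever \<open>J\<close> is.
  With the two powers the half-width in every coordinate is \<open>pi + 1\<close>.\<close>

definition kern :: "nat \<Rightarrow> nat \<Rightarrow> 'a::euclidean_space \<Rightarrow> real" where
  "kern J L t = (\<Prod>i\<in>Basis. snc (pi * (t \<bullet> i)) * snc (t \<bullet> i / (2 * real J)) ^ J * snc (t \<bullet> i / (2 * real L)) ^ L)"

lemma kern_commute: "kern J L t = kern L J t"
  unfolding kern_def by (simp add: mult_ac)

lemma continuous_on_kern: "J > 0 \<Longrightarrow> L > 0 \<Longrightarrow> continuous_on A (kern J L)"
  unfolding kern_def by (intro continuous_intros) auto

lemma bandlimited_factor: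
  assumes W: "bandlimited \<beta> W" and i: "i \<in> Basis" and J: "J > 0" "L > 0"
  shows "bandlimited (\<beta>(i := \<beta> i + (pi + 1)))
    (\<lambda>t. of_real (snc (pi * (t \<bullet> i)) * snc (t \<bullet> i / (2 * real J)) ^ J * snc (t \<bullet> i / (2 * real L)) ^ L) * W t)"
proof -
  have 1: "real J * \<bar>1 / (2 * real J)\<bar> = 1/2" "real L * \<bar>1 / (2 * real L)\<bar> = 1/2" using J by auto
  from bandlimited_snc_power[OF W i, of L "1 / (2 * real L)"]
  have a: "bandlimited (\<beta>(i := \<beta> i + 1/2)) (\<lambda>t. of_real (snc (t \<bullet> i / (2 * real L)) ^ L) * W t)"
    unfolding 1 by simp
  from bandlimited_snc_power[OF a i, of J "1 / (2 * real J)"]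
  have b: "bandlimited (\<beta>(i := \<beta> i + 1)) (\<lambda>t. of_real (snc (t \<bullet> i / (2 * real J)) ^ J) * (of_real (snc (t \<bullet> i / (2 * real L)) ^ L) * W t))"
    unfolding 1 by (simp add: add.assoc)
  from bandlimited_snc[OF b i, of pi] show ?thesis
    by (simp add: mult.assoc add.commute add.left_commute)
qed

lemma bandlimited_kern:
  fixes W :: "'a::euclidean_space \<Rightarrow> complex"
  assumes W: "bandlimited \<beta> W" and J: "J > 0" "L > 0"
  shows "bandlimited (\<lambda>i. \<beta> i + (pi + 1)) (\<lambda>t. of_real (kern J L t) * W t)"
proof -
  let ?g = "\<lambda>t i. snc (pi * (t \<bullet> i)) * snc (t \<bullet> i / (2 * real J)) ^ J * snc (t \<bullet> i / (2 * real L)) ^ L"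
  have "bandlimited (\<lambda>j. if j \<in> S then \<beta> j + (pi + 1) else \<beta> j) (\<lambda>t. of_real (\<Prod>i\<in>S. ?g t i) * W t)"
    if "finite S" "S \<subseteq> Basis" for S
    using that
  proof (induction S rule: finite_induct)
    case empty
    then show ?case using W by simp
  next
    case (insert i S)
    then have IH: "bandlimited (\<lambda>j. if j \<in> S then \<beta> j + (pi + 1) else \<beta> j) (\<lambda>t. of_real (\<Prod>i\<in>S. ?g t i) * W t)"
      and i: "i \<in> Basis" by auto
    have "(\<lambda>j. if j \<in> S then \<beta> j + (pi + 1) else \<beta> j)(i := (if i \<in> S then \<beta> i + (pi + 1) else \<beta> i) + (pi + 1))
       = (\<lambda>j. if j \<in> insert i S then \<beta> j + (pi + 1) else \<beta> j)"
      using insert by (auto simp: fun_eq_iff)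
    with bandlimited_factor[OF IH i J] show ?case
      using insert by (simp add: mult.assoc)
  qed
  from this[OF finite_Basis subset_refl] show ?thesis
    by (simp add: kern_def bandlimited_def)
qed

lemma kern_ivecs:
  fixes z :: "'a::euclidean_space"
  assumes "z \<in> ivecs" "z \<noteq> 0" shows "kern J L z = 0"
proof -
  obtain i where i: "i \<in> Basis" "z \<bullet> i \<noteq> 0" using assms(2) by (auto simp: euclidean_eq_iff[where 'a='a])
  moreover have "sin (pi * (z \<bullet> i)) = 0"
    using assms(1) i by (auto simp: ivecs_def Ints_def mult.commute)
  ultimately show ?thesis unfolding kern_def by (intro prod_zero) (auto simp: snc_def)
qed

lemma kern_0: "kern J L 0 = 1"
  by (simp add: kern_def snc_def)

lemma large_coordinate:
  fixes t :: "'a::euclidean_space"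
  obtains i where "i \<in> Basis" "norm t \<le> DIM('a) * \<bar>t \<bullet> i\<bar>"
proof (rule ccontr)
  assume "\<not> thesis"
  then have "\<And>i. i \<in> Basis \<Longrightarrow> \<bar>t \<bullet> i\<bar> < norm t / DIM('a)"
    using that by (force simp: field_simps not_le)
  then have "(\<Sum>i\<in>Basis. \<bar>t \<bullet> i\<bar>) < (\<Sum>i\<in>(Basis :: 'a set). norm t / DIM('a))"
    by (intro sum_strict_mono) auto
  then show False using norm_le_l1[of t] by simp
qed

text \<open>The decay is taken from the \<open>J\<close>-th power at a coordinate comparable with
  the norm; every other factor is at most 1, so the bound is uniform in \<open>L\<close>.\<close>

lemma kern_bound:
  fixes t :: "'a::euclidean_space"
  assumes J: "J > 0"
  shows "\<bar>kern J L t\<bar> \<le> (DIM('a) * (1 + 2 * real J)) ^ J / wt t ^ J"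
proof -
  obtain i :: 'a where i: "i \<in> Basis" "norm t \<le> DIM('a) * \<bar>t \<bullet> i\<bar>" by (rule large_coordinate)
  have n1: "1 \<le> real DIM('a)" using DIM_positive[where 'a='a] by linarith
  let ?g = "\<lambda>i. \<bar>snc (pi * (t \<bullet> i)) * snc (t \<bullet> i / (2 * real J)) ^ J * snc (t \<bullet> i / (2 * real L)) ^ L\<bar>"
  have g1: "?g j \<le> \<bar>snc (t \<bullet> j / (2 * real J))\<bar> ^ J" for j
  proof -
    have "\<bar>snc (pi * (t \<bullet> j))\<bar> * (\<bar>snc (t \<bullet> j / (2 * real J))\<bar> ^ J * \<bar>snc (t \<bullet> j / (2 * real L))\<bar> ^ L)
        \<le> 1 * (\<bar>snc (t \<bullet> j / (2 * real J))\<bar> ^ J * 1)"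
      by (intro mult_mono abs_snc_le_1 order_refl power_le_one) (auto simp: abs_snc_le_1)
    then show ?thesis by (simp add: abs_mult power_abs mult.assoc)
  qed
  have "\<bar>kern J L t\<bar> = ?g i * (\<Prod>j\<in>Basis-{i}. ?g j)"
    unfolding kern_def abs_prod using i by (simp add: prod.remove)
  also have "\<dots> \<le> \<bar>snc (t \<bullet> i / (2 * real J))\<bar> ^ J * 1"
    by (intro mult_mono g1 prod_le_1)
       (auto intro!: prod_nonneg order_trans[OF g1] power_le_one abs_snc_le_1)
  also have "\<dots> \<le> ((DIM('a) * (1 + 2 * real J)) / wt t) ^ J * 1"
  proof (intro mult_right_mono power_mono)
    have "\<bar>snc (t \<bullet> i / (2 * real J))\<bar> \<le> (1 + 2 * real J) / (1 + \<bar>t \<bullet> i\<bar>)"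
      using J by (intro snc_scaled_bound) simp
    also have "\<dots> \<le> (1 + 2 * real J) * (DIM('a) / wt t)"
    proof -
      have "wt t \<le> DIM('a) * (1 + \<bar>t \<bullet> i\<bar>)" using i(2) n1 unfolding wt_def distrib_left by linarith
      then have "1 / (1 + \<bar>t \<bullet> i\<bar>) \<le> DIM('a) / wt t" using wt_pos[of t] by (simp add: field_simps)
      then have "(1 + 2 * real J) * (1 / (1 + \<bar>t \<bullet> i\<bar>)) \<le> (1 + 2 * real J) * (DIM('a) / wt t)"
        by (rule mult_left_mono) simp
      then show ?thesis by simp
    qed
    finally show "\<bar>snc (t \<bullet> i / (2 * real J))\<bar> \<le> (DIM('a) * (1 + 2 * real J)) / wt t" by (simp add: mult.commute)
  qed auto
  finally show ?thesis by (simp add: power_divide)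
qed

lemma integral_affine:
  fixes f :: "'a::euclidean_space \<Rightarrow> 'b::{banach, second_countable_topology}"
  assumes [measurable]: "f \<in> borel_measurable borel" and "c \<noteq> 0"
  shows "(\<integral>x. f x \<partial>lborel) = (\<bar>c\<bar> ^ DIM('a)) *\<^sub>R (\<integral>x. f (t + c *\<^sub>R x) \<partial>lborel)"
  using assms by (subst lborel_affine[of c t]) (auto simp: integral_density integral_distr)

lemma bandlimited_reflect:
  fixes W :: "'a::euclidean_space \<Rightarrow> complex"
  assumes W: "bandlimited \<beta> W"
  shows "bandlimited \<beta> (\<lambda>t. W (x - t))"
proof -
  obtain C where c: "continuous_on UNIV W" and C: "\<And>t. norm (W t) \<le> C / wt t ^ (2 * DIM('a))"
    and z: "\<And>\<xi> j. j \<in> Basis \<Longrightarrow> \<beta> j < \<bar>\<xi> \<bullet> j\<bar> \<Longrightarrow> (\<integral>t. W t * cis (- (t \<bullet> \<xi>)) \<partial>lborel) = 0"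
    using W unfolding bandlimited_def by blast
  have [measurable]: "W \<in> borel_measurable borel" using c by (rule borel_measurable_continuous_onI)
  have "(\<integral>t. W (x - t) * cis (- (t \<bullet> \<xi>)) \<partial>lborel) = 0" if j: "j \<in> Basis" "\<beta> j < \<bar>\<xi> \<bullet> j\<bar>" for \<xi> j
  proof -
    have "0 = (\<integral>t. W t * cis (- (t \<bullet> - \<xi>)) \<partial>lborel)" using z[of j "- \<xi>"] j by simp
    also have "\<dots> = (\<integral>t. W (x + -1 *\<^sub>R t) * cis (- ((x + -1 *\<^sub>R t) \<bullet> - \<xi>)) \<partial>lborel)"
      by (subst integral_affine[of _ "-1" x]) auto
    also have "\<dots> = (\<integral>t. cis (x \<bullet> \<xi>) * (W (x - t) * cis (- (t \<bullet> \<xi>))) \<partial>lborel)"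
      by (intro Bochner_Integration.integral_cong) (auto simp: inner_diff_left cis_mult algebra_simps)
    finally show ?thesis by simp
  qed
  moreover have "norm (W (x - t)) \<le> (C * wt x ^ (2 * DIM('a))) / wt t ^ (2 * DIM('a))" for t
    using decay_shift[of W, OF C, of x "- t"] by simp
  moreover have "continuous_on UNIV (\<lambda>t. W (x - t))"
    by (intro continuous_on_compose2[OF c] continuous_intros) auto
  ultimately show ?thesis unfolding bandlimited_def by blast
qed

text \<open>The product of the kernel with the reflected function has half-width
  \<open>pi + 3\<close>, which is below \<open>2 * pi\<close> because \<open>pi > 3\<close>. It thus
  has no spectrum at the nonzero points of the dual lattice, and its lattice sum does not depend on
  the shift \<open>s\<close>. For \<open>s = 0\<close> only the term at the origin survives.\<close>

theorem sampling_sums: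
  fixes \<psi> :: "'a::euclidean_space \<Rightarrow> complex"
  assumes \<psi>: "bandlimited (\<lambda>_. 2) \<psi>" and J: "J > 0" "L > 0"
  shows "(\<lambda>k. of_real (kern J L (s + ivec k)) * \<psi> (x - (s + ivec k))) sums \<psi> x"
proof -
  define W where "W t = of_real (kern J L t) * \<psi> (x - t)" for t
  have "bandlimited (\<lambda>_. 2 + (pi + 1)) W"
    unfolding W_def by (rule bandlimited_kern[OF bandlimited_reflect[OF \<psi>] J])
  then obtain C where c: "continuous_on UNIV W" and C: "\<And>t. norm (W t) \<le> C / wt t ^ (2 * DIM('a))"
    and z: "\<And>\<xi> j. j \<in> Basis \<Longrightarrow> 2 + (pi + 1) < \<bar>\<xi> \<bullet> j\<bar> \<Longrightarrow> (\<integral>t. W t * cis (- (t \<bullet> \<xi>)) \<partial>lborel) = 0"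
    unfolding bandlimited_def by blast
  have "(\<Sum>k. W (s + ivec k)) = (\<Sum>k. W (ivec k))"
  proof (rule poisson_shift[OF c C])
    fix l :: 'a assume l: "l \<in> ivecs" "l \<noteq> 0"
    then obtain i where i: "i \<in> Basis" "l \<bullet> i \<noteq> 0" by (auto simp: euclidean_eq_iff[where 'a='a])
    then have "1 \<le> \<bar>l \<bullet> i\<bar>" using l(1) by (auto simp: ivecs_def Ints_def)
    then have "2 * pi * 1 \<le> 2 * pi * \<bar>l \<bullet> i\<bar>" by (intro mult_left_mono) auto
    then have "2 + (pi + 1) < 2 * pi * \<bar>l \<bullet> i\<bar>" using pi_gt3 by linarith
    then have "2 + (pi + 1) < \<bar>(- 2 * pi) *\<^sub>R l \<bullet> i\<bar>" by (simp add: abs_mult)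
    from z[OF i(1) this] show "(\<integral>t. W t * cis (2 * pi * (l \<bullet> t)) \<partial>lborel) = 0"
      by (simp add: inner_commute mult.commute)
  qed
  also have "\<dots> = \<psi> x"
  proof -
    obtain k0 where k0: "ivec k0 = (0::'a)" using ivec_surj[OF zero_ivecs] by blast
    have "(\<Sum>k. W (ivec k)) = (\<Sum>k\<in>{k0}. W (ivec k))"
    proof (rule suminf_finite)
      fix k assume "k \<notin> {k0}"
      then have "ivec k \<noteq> (0::'a)" using k0 inj_ivec[of k k0, where 'a='a] by auto
      then show "W (ivec k) = 0" by (simp add: W_def kern_ivecs)
    qed simp
    then show ?thesis by (simp add: W_def k0 kern_0)
  qed
  finally have "(\<Sum>k. W (s + ivec k)) = \<psi> x" .
  moreover have "summable (\<lambda>k. W (s + ivec k))"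
    by (rule summable_norm_cancel[OF summable_decay[of W, OF C]])
  ultimately have "(\<lambda>k. W (s + ivec k)) sums \<psi> x" by (simp add: sums_iff)
  then show ?thesis by (simp add: W_def)
qed

section \<open>Schwartz functions and tempered distributions\<close>

lemma schwartz_differentiable: "schwartz g \<Longrightarrow> set es \<subseteq> Basis \<Longrightarrow> pd es g differentiable (at x)"
  by (auto simp: schwartz_def)

lemma schwartz_has_derivative:
  "schwartz g \<Longrightarrow> set es \<subseteq> Basis \<Longrightarrow> (pd es g has_derivative frechet_derivative (pd es g) (at x)) (at x)"
  using schwartz_differentiable frechet_derivative_works by blast

lemma schwartz_continuous: "schwartz g \<Longrightarrow> set es \<subseteq> Basis \<Longrightarrow> continuous_on A (pd es g)"
  using schwartz_differentiable
  by (intro continuous_at_imp_continuous_on ballI differentiable_imp_continuous_within) blast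

lemma schwartz_decay:
  assumes "schwartz g" "set es \<subseteq> Basis"
  shows "\<exists>C. \<forall>t. norm (pd es g t) \<le> C / wt t ^ N"
proof -
  have "bounded (range (\<lambda>x. (1 + norm x) ^ N * norm (pd es g x)))"
    using assms by (auto simp: schwartz_def)
  then obtain C where C: "\<And>x. norm ((1 + norm x) ^ N * norm (pd es g x)) \<le> C"
    unfolding bounded_iff by auto
  have "norm (pd es g t) \<le> C / wt t ^ N" for t
  proof -
    have "wt t ^ N * norm (pd es g t) \<le> C"
      using order_trans[OF abs_ge_self, of "wt t ^ N * norm (pd es g t)" C] C[of t]
      by (simp add: wt_def)
    then show ?thesis by (simp add: wt_pos pos_le_divide_eq mult.commute)
  qed
  then show ?thesis by blast
qed

lemma schwartzI:
  assumes "\<And>es x. set es \<subseteq> Basis \<Longrightarrow> pd es g differentiable (at x)"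
    and "\<And>es N. set es \<subseteq> Basis \<Longrightarrow> \<exists>C. \<forall>t. norm (pd es g t) \<le> C / wt t ^ N"
  shows "schwartz g"
  unfolding schwartz_def
proof (intro allI impI conjI assms(1))
  fix es :: "'a list" and N assume "set es \<subseteq> Basis"
  then obtain C where C: "\<And>t. norm (pd es g t) \<le> C / wt t ^ N" using assms(2) by blast
  have "norm ((1 + norm x) ^ N * norm (pd es g x)) \<le> C" for x
    using C[of x] wt_pos[of x] by (simp add: wt_def pos_le_divide_eq mult.commute norm_mult)
  then show "bounded (range (\<lambda>x. (1 + norm x) ^ N * norm (pd es g x)))"
    unfolding bounded_iff by blast
qed

lemma has_derivative_affine:
  fixes g :: "'a::real_normed_vector \<Rightarrow> complex"
  assumes "(g has_derivative D) (at (a + b *\<^sub>R x))"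
  shows "((\<lambda>y. c * g (a + b *\<^sub>R y)) has_derivative (\<lambda>h. c * of_real b * D h)) (at x)"
proof -
  interpret bounded_linear D using assms by (rule has_derivative_bounded_linear)
  have "((\<lambda>y. a + b *\<^sub>R y) has_derivative (\<lambda>h. b *\<^sub>R h)) (at x)"
    by (auto intro!: derivative_eq_intros)
  from diff_chain_at[OF this assms] have "((\<lambda>y. g (a + b *\<^sub>R y)) has_derivative (\<lambda>h. D (b *\<^sub>R h))) (at x)"
    by (simp add: o_def)
  then have "((\<lambda>y. c * g (a + b *\<^sub>R y)) has_derivative (\<lambda>h. c * D (b *\<^sub>R h))) (at x)"
    by (rule has_derivative_mult_right)
  then show ?thesis by (simp add: scaleR scaleR_conv_of_real mult.assoc)
qed

lemma pd_affine:
  fixes g :: "'a::euclidean_space \<Rightarrow> complex"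
  assumes g: "schwartz g" and "set es \<subseteq> Basis"
  shows "pd es (\<lambda>y. c * g (a + b *\<^sub>R y)) = (\<lambda>y. c * of_real b ^ length es * pd es g (a + b *\<^sub>R y))"
  using assms(2)
proof (induction es)
  case (Cons e es)
  have "frechet_derivative (\<lambda>y. c * of_real b ^ length es * pd es g (a + b *\<^sub>R y)) (at x)
      = (\<lambda>h. c * of_real b ^ length es * of_real b * frechet_derivative (pd es g) (at (a + b *\<^sub>R x)) h)" for x
    by (rule frechet_derivative_at[symmetric], rule has_derivative_affine, rule schwartz_has_derivative[OF g])
       (use Cons in auto)
  then show ?case using Cons by (simp add: mult_ac)
qed simp

lemma schwartz_affine:
  fixes g :: "'a::euclidean_space \<Rightarrow> complex"
  assumes g: "schwartz g" and b: "b \<noteq> 0"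
  shows "schwartz (\<lambda>y. c * g (a + b *\<^sub>R y))"
proof (rule schwartzI)
  fix es :: "'a list" and x assume es: "set es \<subseteq> Basis"
  show "pd es (\<lambda>y. c * g (a + b *\<^sub>R y)) differentiable (at x)"
    unfolding pd_affine[OF g es] differentiable_def
    using has_derivative_affine[OF schwartz_has_derivative[OF g es]] by blast
next
  fix es :: "'a list" and N assume es: "set es \<subseteq> Basis"
  obtain C where C: "\<And>t. norm (pd es g t) \<le> C / wt t ^ N" using schwartz_decay[OF g es] by blast
  have C0: "0 \<le> C" using C by (rule decay_const_nonneg)
  define K where "K = 1 + (1 + norm a) / \<bar>b\<bar>"
  let ?c = "norm (c * of_real b ^ length es)"
  have "norm (pd es (\<lambda>y. c * g (a + b *\<^sub>R y)) t) \<le> (?c * C * K ^ N) / wt t ^ N" for t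
  proof -
    have "norm t = norm ((a + b *\<^sub>R t) - a) / \<bar>b\<bar>" using b by simp
    also have "\<dots> \<le> (norm (a + b *\<^sub>R t) + norm a) / \<bar>b\<bar>"
      by (intro divide_right_mono norm_triangle_ineq4) simp
    finally have "wt t \<le> 1 + (norm (a + b *\<^sub>R t) + norm a) / \<bar>b\<bar>" by (simp add: wt_def)
    also have "\<dots> \<le> K * wt (a + b *\<^sub>R t)"
    proof -
      have X: "(norm (a + b *\<^sub>R t) + norm a) / \<bar>b\<bar> \<le> (1 + norm a) / \<bar>b\<bar> * (1 + norm (a + b *\<^sub>R t))"
        using b by (simp add: field_simps)
      have "1 + (norm (a + b *\<^sub>R t) + norm a) / \<bar>b\<bar> \<le>
          1 * (1 + norm (a + b *\<^sub>R t)) + (1 + norm a) / \<bar>b\<bar> * (1 + norm (a + b *\<^sub>R t))"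
        by (rule add_mono[OF _ X]) simp
      then show ?thesis unfolding K_def wt_def distrib_right[symmetric] .
    qed
    finally have "wt t ^ N \<le> K ^ N * wt (a + b *\<^sub>R t) ^ N"
      using power_mono[of "wt t" "K * wt (a + b *\<^sub>R t)" N] by (simp add: wt_nonneg power_mult_distrib)
    then have "1 / wt (a + b *\<^sub>R t) ^ N \<le> K ^ N * (1 / wt t ^ N)"
      using wt_pos[of t] wt_pos[of "a + b *\<^sub>R t"] by (simp add: field_simps)
    then have "C * (1 / wt (a + b *\<^sub>R t) ^ N) \<le> C * (K ^ N * (1 / wt t ^ N))"
      using C0 by (rule mult_left_mono)
    then have "norm (pd es g (a + b *\<^sub>R t)) \<le> C * K ^ N / wt t ^ N"
      using C[of "a + b *\<^sub>R t"] by simp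
    then have "?c * norm (pd es g (a + b *\<^sub>R t)) \<le> ?c * (C * K ^ N / wt t ^ N)"
      by (rule mult_left_mono) simp
    then show ?thesis unfolding pd_affine[OF g es] by (simp add: norm_mult mult.assoc)
  qed
  then show "\<exists>C. \<forall>t. norm (pd es (\<lambda>y. c * g (a + b *\<^sub>R y)) t) \<le> C / wt t ^ N" by blast
qed

lemma pd_add:
  fixes g h :: "'a::euclidean_space \<Rightarrow> complex"
  assumes g: "schwartz g" and h: "schwartz h" and "set es \<subseteq> Basis"
  shows "pd es (\<lambda>y. a * g y + b * h y) = (\<lambda>y. a * pd es g y + b * pd es h y)"
  using assms(3)
proof (induction es)
  case (Cons e es)
  have "frechet_derivative (\<lambda>y. a * pd es g y + b * pd es h y) (at x)
      = (\<lambda>u. a * frechet_derivative (pd es g) (at x) u + b * frechet_derivative (pd es h) (at x) u)" for x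
    by (rule frechet_derivative_at[symmetric])
       (intro has_derivative_add has_derivative_mult_right schwartz_has_derivative g h; use Cons in auto)
  then show ?case using Cons by simp
qed simp

lemma schwartz_add:
  fixes g h :: "'a::euclidean_space \<Rightarrow> complex"
  assumes g: "schwartz g" and h: "schwartz h"
  shows "schwartz (\<lambda>y. a * g y + b * h y)"
proof (rule schwartzI)
  fix es :: "'a list" and x assume es: "set es \<subseteq> Basis"
  show "pd es (\<lambda>y. a * g y + b * h y) differentiable (at x)"
    unfolding pd_add[OF g h es]
    by (intro differentiable_add differentiable_mult differentiable_const schwartz_differentiable g h es)
next
  fix es :: "'a list" and N assume es: "set es \<subseteq> Basis"
  obtain C D where C: "\<And>t. norm (pd es g t) \<le> C / wt t ^ N" and D: "\<And>t. norm (pd es h t) \<le> D / wt t ^ N"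
    using schwartz_decay[OF g es] schwartz_decay[OF h es] by blast
  have "norm (pd es (\<lambda>y. a * g y + b * h y) t) \<le> (norm a * C + norm b * D) / wt t ^ N" for t
  proof -
    have "norm (a * pd es g t + b * pd es h t) \<le> norm a * norm (pd es g t) + norm b * norm (pd es h t)"
      by (rule order_trans[OF norm_triangle_ineq]) (simp add: norm_mult)
    also have "\<dots> \<le> norm a * (C / wt t ^ N) + norm b * (D / wt t ^ N)"
      by (intro add_mono mult_left_mono C D) auto
    finally show ?thesis unfolding pd_add[OF g h es] by (simp add: add_divide_distrib)
  qed
  then show "\<exists>C. \<forall>t. norm (pd es (\<lambda>y. a * g y + b * h y) t) \<le> C / wt t ^ N" by blast
qed

text \<open>A difference quotient combines two translates of \<open>g\<close>, whose transforms
  vanish wherever that of \<open>g\<close> does. The mean value inequality gives an integrable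
  majorant, and dominated convergence passes to the derivative.\<close>

lemma bandlimited_derivative:
  fixes g :: "'a::euclidean_space \<Rightarrow> complex"
  assumes g: "bandlimited \<beta> g" and e: "e \<in> Basis"
    and d: "\<And>x. (g has_derivative D x) (at x)"
    and c: "continuous_on UNIV (\<lambda>x. D x e)" and C: "\<And>t. norm (D t e) \<le> C / wt t ^ (2 * DIM('a))"
  shows "bandlimited \<beta> (\<lambda>x. D x e)"
proof -
  let ?N = "2 * DIM('a)"
  obtain B where cg: "continuous_on UNIV g" and B: "\<And>t. norm (g t) \<le> B / wt t ^ ?N"
    and z: "\<And>\<xi> j. j \<in> Basis \<Longrightarrow> \<beta> j < \<bar>\<xi> \<bullet> j\<bar> \<Longrightarrow> (\<integral>t. g t * cis (- (t \<bullet> \<xi>)) \<partial>lborel) = 0"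
    using g unfolding bandlimited_def by blast
  have [measurable]: "g \<in> borel_measurable borel" "(\<lambda>x. D x e) \<in> borel_measurable borel"
    using cg c by (auto intro: borel_measurable_continuous_onI)
  have C0: "0 \<le> C" using C by (rule decay_const_nonneg)
  \<comment> \<open>Steps of length at most 1 along a unit vector have weight at most 2; this is the
    factor \<open>2 ^ ?N\<close> in the majorant.\<close>
  define hn :: "nat \<Rightarrow> real" where "hn n = inverse (real (Suc n))" for n
  have hn: "0 < hn n" "hn n \<le> 1" for n by (auto simp: hn_def inverse_eq_divide)
  have hn0: "filterlim hn (at 0) sequentially"
  proof (rule filterlim_atI)
    show "hn \<longlonglongrightarrow> 0" unfolding hn_def by (rule LIMSEQ_inverse_real_of_nat)
    show "\<forall>\<^sub>F n in sequentially. hn n \<noteq> 0"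
      using hn(1) by (intro always_eventually) (metis order_less_irrefl)
  qed
  define q where "q n t = (1 / hn n) *\<^sub>R (g (t + hn n *\<^sub>R e) - g t)" for n t
  have dv: "((\<lambda>s. g (t + s *\<^sub>R e)) has_vector_derivative D (t + s *\<^sub>R e) e) (at s)" for s t
  proof -
    interpret bounded_linear "D (t + s *\<^sub>R e)" using d by (rule has_derivative_bounded_linear)
    have "((\<lambda>s. t + s *\<^sub>R e) has_derivative (\<lambda>h. h *\<^sub>R e)) (at s)"
      by (auto intro!: derivative_eq_intros)
    from diff_chain_at[OF this d] show ?thesis
      by (simp add: o_def has_vector_derivative_def scaleR)
  qed
  have qlim: "(\<lambda>n. q n t) \<longlonglongrightarrow> D t e" for t
  proof -
    have "((\<lambda>h. norm (g (t + h *\<^sub>R e) - g t - h *\<^sub>R D t e) / norm h) \<longlongrightarrow> 0) (at 0)"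
      using dv[of t 0] unfolding has_vector_derivative_def has_derivative_at by simp
    then have "((\<lambda>n. norm (g (t + hn n *\<^sub>R e) - g t - hn n *\<^sub>R D t e) / norm (hn n)) \<longlongrightarrow> 0) sequentially"
      using hn0 by (rule filterlim_compose)
    moreover have "norm (g (t + hn n *\<^sub>R e) - g t - hn n *\<^sub>R D t e) / norm (hn n) = norm (q n t - D t e)" for n
    proof -
      have "q n t - D t e = (1 / hn n) *\<^sub>R (g (t + hn n *\<^sub>R e) - g t - hn n *\<^sub>R D t e)"
        using hn(1)[of n] by (simp add: q_def scaleR_diff_right)
      then show ?thesis using hn(1)[of n] by simp
    qed
    ultimately have "(\<lambda>n. norm (q n t - D t e)) \<longlonglongrightarrow> 0" by simp
    then show ?thesis using LIM_zero_cancel tendsto_norm_zero_iff by blast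
  qed
  have qbd: "norm (q n t) \<le> (C * 2 ^ ?N) / wt t ^ ?N" for n t
  proof -
    have "norm (g (t + hn n *\<^sub>R e) - g (t + 0 *\<^sub>R e)) \<le> ((C * 2 ^ ?N) / wt t ^ ?N) * norm (hn n - 0)"
    proof (rule differentiable_bound[of "{0..1::real}"])
      show "((\<lambda>s. g (t + s *\<^sub>R e)) has_derivative (\<lambda>h. h *\<^sub>R D (t + s *\<^sub>R e) e)) (at s within {0..1})" for s
        using dv[of t s] unfolding has_vector_derivative_def by (rule has_derivative_at_withinI)
      fix s :: real assume s: "s \<in> {0..1}"
      have "norm (D (s *\<^sub>R e + t) e) \<le> (C * wt (s *\<^sub>R e) ^ ?N) / wt t ^ ?N"
        by (rule decay_shift[of "\<lambda>x. D x e", OF C])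
      also have "\<dots> \<le> (C * 2 ^ ?N) / wt t ^ ?N"
        using s e C0 by (intro divide_right_mono mult_left_mono power_mono) (auto simp: wt_def)
      finally have Dle: "norm (D (t + s *\<^sub>R e) e) \<le> (C * 2 ^ ?N) / wt t ^ ?N" by (simp add: add.commute)
      show "onorm (\<lambda>h. h *\<^sub>R D (t + s *\<^sub>R e) e) \<le> (C * 2 ^ ?N) / wt t ^ ?N"
      proof (rule onorm_le)
        fix h :: real
        show "norm (h *\<^sub>R D (t + s *\<^sub>R e) e) \<le> (C * 2 ^ ?N) / wt t ^ ?N * norm h"
          using mult_right_mono[OF Dle norm_ge_zero[of h]] by (simp only: norm_scaleR real_norm_def mult.commute)
      qed
    qed (use hn[of n] in auto)
    then have "norm (g (t + hn n *\<^sub>R e) - g t) / hn n \<le> (C * 2 ^ ?N) / wt t ^ ?N"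
      using hn(1)[of n] by (simp add: pos_divide_le_eq)
    then show ?thesis unfolding q_def using hn(1)[of n] by simp
  qed
  have "(\<integral>t. D t e * cis (- (t \<bullet> \<xi>)) \<partial>lborel) = 0" if j: "j \<in> Basis" "\<beta> j < \<bar>\<xi> \<bullet> j\<bar>" for \<xi> j
  proof -
    have "(\<lambda>n. \<integral>t. q n t * cis (- (t \<bullet> \<xi>)) \<partial>lborel) \<longlonglongrightarrow> (\<integral>t. D t e * cis (- (t \<bullet> \<xi>)) \<partial>lborel)"
    proof (rule integral_dominated_convergence)
      show "integrable lborel (\<lambda>t::'a. (C * 2 ^ ?N) * (1 / wt t ^ ?N))"
        by (intro integrable_mult_right integrable_wt)
      show "AE t in lborel. (\<lambda>n. q n t * cis (- (t \<bullet> \<xi>))) \<longlonglongrightarrow> D t e * cis (- (t \<bullet> \<xi>))"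
        by (intro AE_I2 tendsto_mult qlim tendsto_const)
      show "AE t in lborel. norm (q n t * cis (- (t \<bullet> \<xi>))) \<le> (C * 2 ^ ?N) * (1 / wt t ^ ?N)" for n
        using qbd[of n] by (simp add: norm_mult)
    qed (auto simp: q_def)
    moreover have "(\<integral>t. q n t * cis (- (t \<bullet> \<xi>)) \<partial>lborel) = 0" for n
    proof -
      have i0: "integrable lborel (\<lambda>t. g t * cis (- (t \<bullet> \<xi>)))"
        by (rule integrable_decay[where C=B], (intro continuous_intros cg)[1], rule decay_mult_bounded, rule B, simp)
      have cs: "continuous_on UNIV (\<lambda>t. g (hn n *\<^sub>R e + t))"
        by (intro continuous_on_compose2[OF cg] continuous_intros) auto
      have i1: "integrable lborel (\<lambda>t. g (hn n *\<^sub>R e + t) * cis (- (t \<bullet> \<xi>)))"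
        by (rule integrable_decay, (intro continuous_intros cs)[1], rule decay_mult_bounded, rule decay_shift[of g, OF B], simp)
      have "(\<integral>t. g (hn n *\<^sub>R e + t) * cis (- (t \<bullet> \<xi>)) \<partial>lborel) = (\<integral>t. g (hn n *\<^sub>R e + t) * cis (- (((hn n *\<^sub>R e + t) - hn n *\<^sub>R e) \<bullet> \<xi>)) \<partial>lborel)"
        by simp
      also have "\<dots> = (\<integral>t. g t * cis (- ((t - hn n *\<^sub>R e) \<bullet> \<xi>)) \<partial>lborel)"
        by (rule integral_shift[of "\<lambda>t. g t * cis (- ((t - hn n *\<^sub>R e) \<bullet> \<xi>))"]) measurable
      also have "\<dots> = (\<integral>t. cis ((hn n *\<^sub>R e) \<bullet> \<xi>) * (g t * cis (- (t \<bullet> \<xi>))) \<partial>lborel)"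
        by (intro Bochner_Integration.integral_cong) (auto simp: inner_diff_left cis_mult algebra_simps)
      also have "\<dots> = 0" using z[OF j] by simp
      finally have s0: "(\<integral>t. g (hn n *\<^sub>R e + t) * cis (- (t \<bullet> \<xi>)) \<partial>lborel) = 0" .
      have "(\<integral>t. q n t * cis (- (t \<bullet> \<xi>)) \<partial>lborel) =
         (\<integral>t. (1 / hn n) *\<^sub>R (g (hn n *\<^sub>R e + t) * cis (- (t \<bullet> \<xi>)) - g t * cis (- (t \<bullet> \<xi>))) \<partial>lborel)"
        by (intro Bochner_Integration.integral_cong) (auto simp: q_def left_diff_distrib add.commute)
      also have "\<dots> = 0"
        by (simp only: Bochner_Integration.integral_scaleR_right Bochner_Integration.integral_diff[OF i1 i0] s0 z[OF j]) simp
      finally show ?thesis .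
    qed
    ultimately show ?thesis using LIMSEQ_unique[OF _ tendsto_const] by simp
  qed
  then show ?thesis unfolding bandlimited_def using c C by blast
qed

text \<open>The sampling formula is needed for all derivatives, because its series has to converge
  in the seminorms that bound a distribution.\<close>

lemma bandlimited_pd:
  fixes g :: "'a::euclidean_space \<Rightarrow> complex"
  assumes g: "schwartz g" and supp: "closure {\<xi>. fourier g \<xi> \<noteq> 0} \<subseteq> cball 0 2"
    and "set es \<subseteq> Basis"
  shows "bandlimited (\<lambda>_. 2) (pd es g)"
  using assms(3)
proof (induction es)
  case Nil
  have "(\<integral>t. g t * cis (- (t \<bullet> \<xi>)) \<partial>lborel) = 0" if "i \<in> Basis" "2 < \<bar>\<xi> \<bullet> i\<bar>" for \<xi> i :: 'a
  proof -
    have "2 < norm \<xi>" using that Basis_le_norm[of i \<xi>] by simp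
    then have "\<xi> \<notin> closure {\<xi>. fourier g \<xi> \<noteq> 0}" using subsetD[OF supp, of \<xi>] by auto
    then have "\<xi> \<notin> {\<xi>. fourier g \<xi> \<noteq> 0}" using subsetD[OF closure_subset] by metis
    then show ?thesis by (simp add: fourier_def)
  qed
  then show ?case unfolding bandlimited_def
    using schwartz_decay[OF g, of "[]"] schwartz_continuous[OF g, of "[]"] by auto
next
  case (Cons e es)
  then have e: "e \<in> Basis" and es: "set es \<subseteq> Basis" by auto
  obtain C where C: "\<And>t. norm (pd (e # es) g t) \<le> C / wt t ^ (2 * DIM('a))"
    using schwartz_decay[OF g Cons.prems] by blast
  show ?case unfolding pd.simps
    by (rule bandlimited_derivative[OF Cons.IH[OF es] e schwartz_has_derivative[OF g es]])
       (use schwartz_continuous[OF g Cons.prems] C in auto)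
qed

text \<open>Continuity restated with one common bound \<open>B\<close> for all weighted derivatives,
  so that suprema need not be handled later; \<open>A\<close> uses the absolute value of
  \<open>C\<close>, whose sign is not prescribed.\<close>

lemma tempered_bound:
  fixes T :: "('a::euclidean_space \<Rightarrow> complex) \<Rightarrow> complex"
  assumes "tempered T"
  shows "\<exists>A\<ge>0. \<exists>K N. \<forall>R B. schwartz R \<longrightarrow>
    (\<forall>es y. set es \<subseteq> Basis \<longrightarrow> length es \<le> K \<longrightarrow> wt y ^ N * norm (pd es R y) \<le> B) \<longrightarrow> norm (T R) \<le> A * B"
proof -
  obtain C N K where C: "\<And>g. schwartz g \<Longrightarrow> norm (T g) \<le> C * (\<Sum>es\<in>{es. set es \<subseteq> Basis \<and> length es \<le> K}.
                               SUP x. (1 + norm x) ^ N * norm (pd es g x))"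
    using assms unfolding tempered_def by blast
  let ?E = "{es :: 'a list. set es \<subseteq> Basis \<and> length es \<le> K}"
  have fin: "finite ?E" by (rule finite_lists_length_le) simp
  show ?thesis
  proof (rule exI[of _ "\<bar>C\<bar> * card ?E"], rule conjI, simp, rule exI[of _ K], rule exI[of _ N], intro allI impI)
    fix R :: "'a \<Rightarrow> complex" and B assume R: "schwartz R"
      and B: "\<forall>es y. set es \<subseteq> Basis \<longrightarrow> length es \<le> K \<longrightarrow> wt y ^ N * norm (pd es R y) \<le> B"
    have le: "(SUP x. (1 + norm x) ^ N * norm (pd es R x)) \<le> B" and
      ge: "0 \<le> (SUP x. (1 + norm x) ^ N * norm (pd es R x))" if "es \<in> ?E" for es
    proof -
      have b: "(1 + norm y) ^ N * norm (pd es R y) \<le> B" for y using B that by (simp add: wt_def)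
      then show "(SUP x. (1 + norm x) ^ N * norm (pd es R x)) \<le> B" by (intro cSUP_least) auto
      have "bdd_above (range (\<lambda>x. (1 + norm x) ^ N * norm (pd es R x)))" using b by (intro bdd_aboveI2)
      then show "0 \<le> (SUP x. (1 + norm x) ^ N * norm (pd es R x))"
        by (rule cSUP_upper2[of _ _ _ 0]) auto
    qed
    have "norm (T R) \<le> C * (\<Sum>es\<in>?E. SUP x. (1 + norm x) ^ N * norm (pd es R x))" by (rule C[OF R])
    also have "\<dots> \<le> \<bar>C\<bar> * (\<Sum>es\<in>?E. SUP x. (1 + norm x) ^ N * norm (pd es R x))"
      by (intro mult_right_mono sum_nonneg ge) auto
    also have "\<dots> \<le> \<bar>C\<bar> * (\<Sum>es\<in>?E. B)"
      by (intro mult_left_mono sum_mono le) auto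
    finally show "norm (T R) \<le> \<bar>C\<bar> * card ?E * B" by simp
  qed
qed

text \<open>The three facts share one induction because linearity of \<open>T\<close> and of
  \<open>pd\<close> is available only on Schwartz functions.\<close>

lemma tempered_partial_sum:
  fixes g :: "'a::euclidean_space \<Rightarrow> complex" and n :: nat
  assumes T: "tempered T" and g: "schwartz g" and h: "\<And>k. schwartz (h k)"
  shows "schwartz (\<lambda>y. g y - (\<Sum>k<n. c k * h k y)) \<and>
    T (\<lambda>y. g y - (\<Sum>k<n. c k * h k y)) = T g - (\<Sum>k<n. c k * T (h k)) \<and>
    (\<forall>es. set es \<subseteq> Basis \<longrightarrow> pd es (\<lambda>y. g y - (\<Sum>k<n. c k * h k y)) = (\<lambda>y. pd es g y - (\<Sum>k<n. c k * pd es (h k) y)))"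
proof (induction n)
  case (Suc n)
  let ?R = "\<lambda>y. g y - (\<Sum>k<n. c k * h k y)"
  have R: "schwartz ?R" using Suc.IH by blast
  have e: "(\<lambda>y. g y - (\<Sum>k<Suc n. c k * h k y)) = (\<lambda>y. 1 * ?R y + (- c n) * h n y)" by (auto simp: algebra_simps)
  have lin: "T (\<lambda>y. 1 * ?R y + (- c n) * h n y) = 1 * T ?R + (- c n) * T (h n)"
    using T R h unfolding tempered_def by blast
  show ?case unfolding e lin
    using schwartz_add[OF R h[of n], of 1 "- c n"] pd_add[OF R h[of n], of _ 1 "- c n"] Suc.IH
    by (auto simp: algebra_simps)
qed (simp add: g)

section \<open>Sampling of convolutions with tempered distributions\<close>

text \<open>The existential \<open>L\<close> hides the order of the distribution, which varies with
  it; constants derived from this property can therefore depend on \<open>J\<close> only. The sample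
  spacing \<open>1 / b\<close> matches a spectrum of radius \<open>2 * b\<close>.\<close>

definition sampled :: "real \<Rightarrow> ('a::euclidean_space \<Rightarrow> complex) \<Rightarrow> bool" where
  "sampled b g \<longleftrightarrow> (\<forall>J>0. \<exists>L>0. \<forall>s x.
     (\<lambda>k. of_real (kern J L (s + ivec k)) * g (x - (1 / b) *\<^sub>R (s + ivec k))) sums g x)"

text \<open>The second order of decay of the kernel absorbs the order of the distribution, while
  the bounds drawn from the sampling formula only involve the first.\<close>

theorem tempered_sampled:
  fixes \<psi> :: "'a::euclidean_space \<Rightarrow> complex"
  assumes T: "tempered T" and \<psi>: "schwartz \<psi>" and supp: "closure {\<xi>. fourier \<psi> \<xi> \<noteq> 0} \<subseteq> cball 0 2"
    and b: "b > 0"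
  shows "sampled b (\<lambda>x. T (\<lambda>y. c * \<psi> (b *\<^sub>R (x - y))))"
proof -
  obtain A K N where A: "0 \<le> A" and TA: "\<forall>R B. schwartz R \<longrightarrow>
      (\<forall>es y. set es \<subseteq> Basis \<longrightarrow> length es \<le> K \<longrightarrow> wt y ^ N * norm (pd es R y) \<le> B) \<longrightarrow> norm (T R) \<le> A * B"
    using tempered_bound[OF T] by auto
  let ?E = "{es :: 'a list. set es \<subseteq> Basis \<and> length es \<le> K}"
  have fin: "finite ?E" by (rule finite_lists_length_le) simp
  have "\<forall>es\<in>?E. \<exists>C. \<forall>t. norm (pd es \<psi> t) \<le> C / wt t ^ N" using schwartz_decay[OF \<psi>] by blast
  then obtain Ce where Ce: "\<And>es t. es \<in> ?E \<Longrightarrow> norm (pd es \<psi> t) \<le> Ce es / wt t ^ N" by metis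
  have Ce0: "0 \<le> Ce es" if "es \<in> ?E" for es using Ce[OF that] by (rule decay_const_nonneg)
  define D where "D = (\<Sum>es\<in>?E. norm c * b ^ length es * Ce es)"
  have D: "norm c * b ^ length es * Ce es \<le> D" if "es \<in> ?E" for es
    unfolding D_def using that fin b Ce0 by (intro member_le_sum) auto
  \<comment> \<open>\<open>N\<close> orders of decay pay for the polynomial weight in the seminorms,
    and the remaining \<open>2 * DIM('a)\<close> make the series over the lattice converge.\<close>
  define L where "L = N + 2 * DIM('a)"
  have L: "L > 0" by (simp add: L_def)
  have "(\<lambda>k. of_real (kern J L (s + ivec k)) * T (\<lambda>y. c * \<psi> (b *\<^sub>R (x - (1 / b) *\<^sub>R (s + ivec k) - y)))) sums T (\<lambda>y. c * \<psi> (b *\<^sub>R (x - y)))"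
    if J: "J > 0" for J s x
  proof -
    define u where "u k = s + ivec k" for k
    define h where "h a = (\<lambda>y. c * \<psi> ((b *\<^sub>R x - a) + (- b) *\<^sub>R y))" for a
    have h: "schwartz (h a)" for a unfolding h_def using b by (intro schwartz_affine \<psi>) auto
    have hu: "schwartz (h (u k))" for k by (rule h)
    have h1: "h (u k) = (\<lambda>y. c * \<psi> (b *\<^sub>R (x - (1 / b) *\<^sub>R (s + ivec k) - y)))" for k
      using b by (auto simp: h_def u_def scaleR_diff_right)
    have h0: "h 0 = (\<lambda>y. c * \<psi> (b *\<^sub>R (x - y)))" by (auto simp: h_def scaleR_diff_right)
    define \<kappa> where "\<kappa> k = kern J L (u k)" for k
    define CL where "CL = (DIM('a) * (1 + 2 * real L)) ^ L"
    define r where "r k = CL / wt (u k) ^ (2 * DIM('a))" for k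
    have CL0: "0 \<le> CL" by (simp add: CL_def)
    have r0: "0 \<le> r k" for k using CL0 by (simp add: r_def wt_nonneg)
    have sr: "summable r"
    proof (rule summable_comparison_test[OF _ summable_mult[OF summable_wt[where 'a='a], of "CL * wt s ^ (2 * DIM('a))"]], intro exI allI impI)
      fix k
      have "CL * (1 / wt (u k) ^ (2 * DIM('a))) \<le> CL * (wt s ^ (2 * DIM('a)) * (1 / wt (ivec k :: 'a) ^ (2 * DIM('a))))"
        unfolding u_def by (intro mult_left_mono inverse_wt_shift CL0)
      then show "norm (r k) \<le> CL * wt s ^ (2 * DIM('a)) * (1 / wt (ivec k :: 'a) ^ (2 * DIM('a)))"
        using r0[of k] by (simp add: r_def)
    qed
    have kr: "\<bar>\<kappa> k\<bar> * wt (u k) ^ N \<le> r k" for k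
    proof -
      have "\<bar>\<kappa> k\<bar> \<le> CL / wt (u k) ^ L"
        unfolding \<kappa>_def CL_def kern_commute[of J] by (rule kern_bound[OF L])
      then have "\<bar>\<kappa> k\<bar> * wt (u k) ^ N \<le> CL / wt (u k) ^ L * wt (u k) ^ N"
        by (rule mult_right_mono) (simp add: wt_nonneg)
      also have "\<dots> = r k" using wt_pos[of "u k"] by (simp add: r_def L_def power_add)
      finally show ?thesis .
    qed
    define \<tau> where "\<tau> n = (\<Sum>k. r (k + n))" for n
    have \<tau>0: "\<tau> \<longlonglongrightarrow> 0"
    proof -
      have "(\<lambda>n. suminf r - (\<Sum>k<n. r k)) \<longlonglongrightarrow> suminf r - suminf r"
        by (intro tendsto_diff tendsto_const summable_LIMSEQ sr)
      then show ?thesis unfolding \<tau>_def using suminf_minus_initial_segment[OF sr] by simp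
    qed
    \<comment> \<open>From \<open>y = x - (1 / b) *R v\<close>, which bounds \<open>wt y\<close> by
      a multiple of \<open>wt v\<close>; the point \<open>x\<close> is fixed here, so the dependence
      on it is harmless.\<close>
    define M where "M = (wt x * (1 + 1 / b)) ^ N"
    have M0: "0 \<le> M" using b by (simp add: M_def wt_nonneg)
    let ?R = "\<lambda>n y. h 0 y - (\<Sum>k<n. of_real (\<kappa> k) * h (u k) y)"
    \<comment> \<open>The remainders of the sampling series tend to 0 in every seminorm involved,
      uniformly in \<open>y\<close>; this allows \<open>T\<close> to be applied term by
      term.\<close>
    have tail: "wt y ^ N * norm (pd es (?R n) y) \<le> D * M * \<tau> n" if es: "es \<in> ?E" for es n y
    proof -
      have esB: "set es \<subseteq> Basis" using es by simp
      define v where "v = b *\<^sub>R x - b *\<^sub>R y"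
      let ?a = "\<lambda>k. of_real (\<kappa> k) * pd es \<psi> (v - u k)"
      have sums: "?a sums pd es \<psi> v"
        unfolding \<kappa>_def u_def by (rule sampling_sums[OF bandlimited_pd[OF \<psi> supp esB] J L])
      have na: "norm (?a k) \<le> (Ce es / wt v ^ N) * r k" for k
      proof -
        have "wt v \<le> wt (v - u k) * wt (u k)" using wt_add_le[of "v - u k" "u k"] by simp
        then have "wt v ^ N \<le> wt (v - u k) ^ N * wt (u k) ^ N"
          using power_mono[of "wt v" "wt (v - u k) * wt (u k)" N] by (simp add: wt_nonneg power_mult_distrib)
        then have i: "1 / wt (v - u k) ^ N \<le> wt (u k) ^ N / wt v ^ N"
          using wt_pos[of v] wt_pos[of "v - u k"] by (simp add: field_simps)
        have "norm (?a k) \<le> \<bar>\<kappa> k\<bar> * (Ce es * (1 / wt (v - u k) ^ N))"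
          using mult_left_mono[OF Ce[OF es, of "v - u k"] abs_ge_zero[of "\<kappa> k"]] by (simp add: norm_mult)
        also have "\<dots> \<le> \<bar>\<kappa> k\<bar> * (Ce es * (wt (u k) ^ N / wt v ^ N))"
          by (intro mult_left_mono i Ce0 es) auto
        also have "\<dots> = (Ce es / wt v ^ N) * (\<bar>\<kappa> k\<bar> * wt (u k) ^ N)" by simp
        also have "\<dots> \<le> (Ce es / wt v ^ N) * r k"
          using Ce0[OF es] by (intro mult_left_mono kr) (auto simp: wt_nonneg)
        finally show ?thesis .
      qed
      have srn: "summable (\<lambda>k. r (k + n))" using sr by (rule summable_ignore_initial_segment)
      have sn: "summable (\<lambda>k. norm (?a (k + n)))"
        by (rule summable_comparison_test[OF _ summable_mult[OF srn, of "Ce es / wt v ^ N"]]) (use na in auto)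
      have "pd es \<psi> v - (\<Sum>k<n. ?a k) = (\<Sum>k. ?a (k + n))"
        using suminf_minus_initial_segment[OF sums_summable[OF sums], of n] sums_unique[OF sums] by simp
      then have "norm (pd es \<psi> v - (\<Sum>k<n. ?a k)) \<le> (\<Sum>k. norm (?a (k + n)))"
        using summable_norm[OF sn] by simp
      also have "\<dots> \<le> (\<Sum>k. (Ce es / wt v ^ N) * r (k + n))"
        by (intro suminf_le na sn summable_mult srn)
      also have "\<dots> = (Ce es / wt v ^ N) * \<tau> n" unfolding \<tau>_def by (rule suminf_mult[OF srn])
      finally have t1: "norm (pd es \<psi> v - (\<Sum>k<n. ?a k)) \<le> (Ce es / wt v ^ N) * \<tau> n" .
      have \<tau>n: "0 \<le> \<tau> n" unfolding \<tau>_def by (intro suminf_nonneg srn r0)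
      have pdh: "pd es (h a) y = c * of_real (- b) ^ length es * pd es \<psi> (v - a)" for a
        unfolding h_def pd_affine[OF \<psi> esB] by (simp add: v_def algebra_simps)
      have "pd es (?R n) y = pd es (h 0) y - (\<Sum>k<n. of_real (\<kappa> k) * pd es (h (u k)) y)"
        using tempered_partial_sum[where h="\<lambda>k. h (u k)" and n=n and c="\<lambda>k. of_real (\<kappa> k)", OF T h[of 0] hu] esB by simp
      also have "\<dots> = c * of_real (- b) ^ length es * (pd es \<psi> v - (\<Sum>k<n. ?a k))"
        unfolding pdh by (simp add: right_diff_distrib sum_distrib_left mult_ac)
      finally have "norm (pd es (?R n) y) = norm c * b ^ length es * norm (pd es \<psi> v - (\<Sum>k<n. ?a k))"
        using b by (simp add: norm_mult norm_power)
      also have "\<dots> \<le> norm c * b ^ length es * ((Ce es / wt v ^ N) * \<tau> n)"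
        using b by (intro mult_left_mono t1) auto
      also have "\<dots> = (norm c * b ^ length es * Ce es) * (\<tau> n / wt v ^ N)" by simp
      also have "\<dots> \<le> D * (\<tau> n / wt v ^ N)"
        using \<tau>n by (intro mult_right_mono D es) (auto simp: wt_nonneg)
      finally have t2: "norm (pd es (?R n) y) \<le> D * (\<tau> n / wt v ^ N)" .
      have "wt y ^ N \<le> M * wt v ^ N"
      proof -
        have "y = x - (1 / b) *\<^sub>R v" using b by (simp add: v_def scaleR_diff_right)
        then have "wt y \<le> wt x * wt ((1 / b) *\<^sub>R v)" using wt_diff_le by simp
        also have "\<dots> \<le> wt x * ((1 + 1 / b) * wt v)"
        proof (intro mult_left_mono wt_nonneg)
          show "wt ((1 / b) *\<^sub>R v) \<le> (1 + 1 / b) * wt v" using b by (simp add: wt_def field_simps)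
        qed
        finally have "wt y \<le> (wt x * (1 + 1 / b)) * wt v" by (simp add: mult.assoc)
        then show ?thesis unfolding M_def power_mult_distrib[symmetric]
          by (rule power_mono) (rule wt_nonneg)
      qed
      then have "wt y ^ N * norm (pd es (?R n) y) \<le> (M * wt v ^ N) * (D * (\<tau> n / wt v ^ N))"
        using t2 M0 by (intro mult_mono) (auto simp: wt_nonneg)
      also have "\<dots> = D * M * \<tau> n" using wt_pos[of v] by simp
      finally show ?thesis .
    qed
    have bd: "norm (T (h 0) - (\<Sum>k<n. of_real (\<kappa> k) * T (h (u k)))) \<le> A * (D * M * \<tau> n)" for n
    proof -
      note ps = tempered_partial_sum[where h="\<lambda>k. h (u k)" and n=n and c="\<lambda>k. of_real (\<kappa> k)", OF T h[of 0] hu]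
      have "norm (T (?R n)) \<le> A * (D * M * \<tau> n)"
      proof (rule TA[rule_format])
        show "schwartz (?R n)" using ps by blast
        fix es :: "'a list" and y assume "set es \<subseteq> Basis" "length es \<le> K"
        then show "wt y ^ N * norm (pd es (?R n) y) \<le> D * M * \<tau> n" by (intro tail) simp
      qed
      then show ?thesis using ps by simp
    qed
    have lim: "(\<lambda>n. A * (D * M * \<tau> n)) \<longlonglongrightarrow> 0"
      using tendsto_mult[OF tendsto_const[of A] tendsto_mult[OF tendsto_const[of "D * M"] \<tau>0]] by simp
    have "(\<lambda>n. T (h 0) - (\<Sum>k<n. of_real (\<kappa> k) * T (h (u k)))) \<longlonglongrightarrow> 0"
      by (rule Lim_null_comparison[OF always_eventually lim]) (rule allI, rule bd)
    then have "(\<lambda>n. T (h 0) - (T (h 0) - (\<Sum>k<n. of_real (\<kappa> k) * T (h (u k))))) \<longlonglongrightarrow> T (h 0) - 0"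
      by (intro tendsto_diff tendsto_const)
    then have "(\<lambda>k. of_real (\<kappa> k) * T (h (u k))) sums T (h 0)" unfolding sums_def by simp
    then show ?thesis unfolding h1 h0 by (simp only: \<kappa>_def u_def)
  qed
  then show ?thesis unfolding sampled_def using L by blast
qed

section \<open>From sampling to weighted means of a small power\<close>

lemma powr_add_le:
  fixes a b r :: real
  assumes "0 \<le> a" "0 \<le> b" "0 < r" "r \<le> 1"
  shows "(a + b) powr r \<le> a powr r + b powr r"
proof (cases "a + b = 0")
  case False
  then have s: "0 < a + b" using assms by simp
  have t: "x \<le> x powr r" if "0 \<le> x" "x \<le> 1" for x :: real
  proof (cases "x = 0")
    case False
    then show ?thesis using powr_mono'[of r 1 x] that assms by simp
  qed simp
  have "1 = a / (a + b) + b / (a + b)" using s by (simp add: add_divide_distrib[symmetric])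
  also have "\<dots> \<le> (a / (a + b)) powr r + (b / (a + b)) powr r"
    using s assms by (intro add_mono t) (auto simp: field_simps)
  also have "\<dots> = (a powr r + b powr r) / (a + b) powr r"
    using s assms by (simp add: powr_divide add_divide_distrib)
  finally show ?thesis using s by (simp add: field_simps)
qed (use assms in auto)

text \<open>Subadditivity of the power for \<open>r \<le> 1\<close>, passed to the limit; in the
  extended nonnegative reals the right-hand side always makes sense.\<close>

lemma sums_powr_le:
  fixes f :: "nat \<Rightarrow> 'b::real_normed_vector"
  assumes f: "f sums s" and r: "0 < r" "r \<le> 1"
  shows "ennreal (norm s powr r) \<le> (\<Sum>k. ennreal (norm (f k) powr r))"
proof (rule LIMSEQ_le_const2)
  show "(\<lambda>n. ennreal (norm (\<Sum>k<n. f k) powr r)) \<longlonglongrightarrow> ennreal (norm s powr r)"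
    using f unfolding sums_def
    by (intro tendsto_ennrealI tendsto_powr2 tendsto_norm tendsto_const) (auto simp: r)
  have "norm (\<Sum>k<n. f k) powr r \<le> (\<Sum>k<n. norm (f k) powr r)" for n
  proof (induction n)
    case (Suc n)
    have "norm (\<Sum>k<Suc n. f k) powr r \<le> (norm (\<Sum>k<n. f k) + norm (f n)) powr r"
      using r by (intro powr_mono2) (auto simp: norm_triangle_ineq)
    also have "\<dots> \<le> norm (\<Sum>k<n. f k) powr r + norm (f n) powr r"
      by (intro powr_add_le r) auto
    finally show ?case using Suc by simp
  qed simp
  note part = this
  have "ennreal (norm (\<Sum>k<n. f k) powr r) \<le> (\<Sum>k. ennreal (norm (f k) powr r))" for n
  proof -
    have "ennreal (norm (\<Sum>k<n. f k) powr r) \<le> ennreal (\<Sum>k<n. norm (f k) powr r)"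
      by (rule ennreal_leI[OF part])
    also have "\<dots> = (\<Sum>k<n. ennreal (norm (f k) powr r))" by (rule sum_ennreal[symmetric]) simp
    also have "\<dots> \<le> (\<Sum>k. ennreal (norm (f k) powr r))" by (rule sum_le_suminf) auto
    finally show ?thesis .
  qed
  then show "\<exists>N. \<forall>n\<ge>N. ennreal (norm (\<Sum>k<n. f k) powr r) \<le> (\<Sum>k. ennreal (norm (f k) powr r))" by blast
qed

text \<open>The shift \<open>s = b *R x\<close>, which varies with \<open>x\<close>, makes the
  sample points independent of \<open>x\<close>; so \<open>g\<close> is a pointwise limit of finite
  combinations of continuous kernels.\<close>

lemma sampled_measurable:
  fixes g :: "'a::euclidean_space \<Rightarrow> complex"
  assumes g: "sampled b g" and b: "b > 0"
  shows "g \<in> borel_measurable borel"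
proof -
  obtain L where L: "L > 0" and "\<forall>s x. (\<lambda>k. of_real (kern 1 L (s + ivec k)) * g (x - (1 / b) *\<^sub>R (s + ivec k))) sums g x"
    using g[unfolded sampled_def, rule_format, of 1] by auto
  then have S: "(\<lambda>k. of_real (kern 1 L (b *\<^sub>R x + ivec k)) * g (x - (1 / b) *\<^sub>R (b *\<^sub>R x + ivec k))) sums g x" for x
    by blast
  have e: "x - (1 / b) *\<^sub>R (b *\<^sub>R x + ivec k) = - ((1 / b) *\<^sub>R ivec k)" for x :: 'a and k
    using b by (simp add: scaleR_add_right)
  show ?thesis
  proof (rule borel_measurable_LIMSEQ_metric)
    show "(\<lambda>x. \<Sum>k<n. of_real (kern 1 L (b *\<^sub>R x + ivec k)) * g (- ((1 / b) *\<^sub>R ivec k))) \<in> borel_measurable borel" for n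
      by (intro borel_measurable_continuous_onI continuous_intros continuous_on_compose2[OF continuous_on_kern[of 1 L UNIV]])
         (use L in auto)
    show "(\<lambda>n. \<Sum>k<n. of_real (kern 1 L (b *\<^sub>R x + ivec k)) * g (- ((1 / b) *\<^sub>R ivec k))) \<longlonglongrightarrow> g x" for x
      using S[of x] unfolding e sums_def .
  qed
qed

definition kern_const :: "'a::euclidean_space itself \<Rightarrow> nat \<Rightarrow> real" where
  "kern_const _ J = (DIM('a) * (1 + 2 * real J)) ^ J"

lemma kern_const_pos: "0 < kern_const TYPE('a::euclidean_space) J"
  unfolding kern_const_def using DIM_positive[where 'a='a] by (intro zero_less_power mult_pos_pos) auto

text \<open>Averaging the sampling formula over all shifts of the lattice turns the sum into an integral.\<close>

lemma sampled_powr_le: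
  fixes g :: "'a::euclidean_space \<Rightarrow> complex"
  assumes g: "sampled b g" and b: "b > 0" and r: "0 < r" "r \<le> 1" and J: "J > 0"
  shows "ennreal (norm (g x) powr r) \<le>
    (\<integral>\<^sup>+t. ennreal ((kern_const TYPE('a) J / wt t ^ J) powr r * norm (g (x - (1 / b) *\<^sub>R t)) powr r) \<partial>lborel)"
proof -
  obtain L where L: "L > 0" and S: "\<And>s x. (\<lambda>k. of_real (kern J L (s + ivec k)) * g (x - (1 / b) *\<^sub>R (s + ivec k))) sums g x"
    using g[unfolded sampled_def, rule_format, OF J] by auto
  have [measurable]: "g \<in> borel_measurable borel" by (rule sampled_measurable[OF g b])
  let ?f = "\<lambda>t. ennreal ((kern_const TYPE('a) J / wt t ^ J) powr r * norm (g (x - (1 / b) *\<^sub>R t)) powr r)"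
  have f[measurable]: "?f \<in> borel_measurable borel" by measurable
  have le: "ennreal (norm (g x) powr r) \<le> (\<Sum>k. ?f (ivec k + s))" for s
  proof (rule order_trans[OF sums_powr_le[OF S[of s x] r]], rule suminf_le)
    fix k
    have "norm (of_real (kern J L (s + ivec k)) * g (x - (1 / b) *\<^sub>R (s + ivec k))) powr r
       = \<bar>kern J L (ivec k + s)\<bar> powr r * norm (g (x - (1 / b) *\<^sub>R (ivec k + s))) powr r"
      by (simp add: norm_mult powr_mult add.commute)
    also have "\<dots> \<le> (kern_const TYPE('a) J / wt (ivec k + s) ^ J) powr r * norm (g (x - (1 / b) *\<^sub>R (ivec k + s))) powr r"
      unfolding kern_const_def using r by (intro mult_right_mono powr_mono2 kern_bound J) auto
    finally show "ennreal (norm (of_real (kern J L (s + ivec k)) * g (x - (1 / b) *\<^sub>R (s + ivec k))) powr r) \<le> ?f (ivec k + s)"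
      by (rule ennreal_leI)
  qed auto
  have "ennreal (norm (g x) powr r) = (\<integral>\<^sup>+s. ennreal (norm (g x) powr r) * indicator (ucube :: 'a set) s \<partial>lborel)"
    by (simp add: nn_integral_cmult_indicator emeasure_ucube)
  also have "\<dots> \<le> (\<integral>\<^sup>+s. (\<Sum>k. ?f (ivec k + s) * indicator ucube s) \<partial>lborel)"
  proof (rule nn_integral_mono)
    fix s :: 'a
    show "ennreal (norm (g x) powr r) * indicator ucube s \<le> (\<Sum>k. ?f (ivec k + s) * indicator ucube s)"
    proof (cases "s \<in> ucube")
      case True
      then show ?thesis using le[of s] by (simp only: indicator_simps mult_1_right)
    next
      case False
      then have "indicator ucube s = (0 :: ennreal)" by (simp only: indicator_eq_0_iff not_False_eq_True)
      then show ?thesis by (simp only: mult_zero_right zero_le)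
    qed
  qed
  also have "\<dots> = (\<Sum>k. \<integral>\<^sup>+s. ?f (ivec k + s) * indicator ucube s \<partial>lborel)"
    by (rule nn_integral_suminf) measurable
  also have "\<dots> = (\<integral>\<^sup>+t. ?f t \<partial>lborel)" by (rule nn_integral_unfold[OF f, symmetric])
  finally show ?thesis .
qed

text \<open>\<open>a\<close> is a quantity frozen at \<open>x\<close>, and
  \<open>wt t powr M\<close> is the loss from freezing it. Since \<open>E powr r\<close> is at most
  \<open>1 + E powr p\<close> (distinguish whether \<open>E\<close> exceeds 1), a weighted integral
  of the \<open>p\<close>-modular suffices. The condition on \<open>J\<close> leaves an integrable
  weight after the loss and the power \<open>r\<close> are accounted for.\<close>

lemma averaged_bound:
  fixes g :: "'a::euclidean_space \<Rightarrow> complex"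
  assumes g: "sampled b g" and b: "b > 0" and r: "0 < r" "r \<le> 1" and J: "J > 0"
    and JM: "2 * real DIM('a) \<le> (real J - M) * r"
    and a: "0 \<le> a" and K: "0 \<le> K" and B: "0 \<le> B"
    and [measurable]: "E \<in> borel_measurable borel" "p \<in> borel_measurable borel"
    and E0: "\<And>y. 0 \<le> E y" and rp: "\<And>y. r \<le> p y"
    and le: "\<And>t. norm (g (x - (1 / b) *\<^sub>R t)) \<le> K * wt t powr M * a * E (x - (1 / b) *\<^sub>R t)"
    and int: "(\<integral>\<^sup>+t. ennreal (1 / wt t ^ (2 * DIM('a)) * E (x - (1 / b) *\<^sub>R t) powr p (x - (1 / b) *\<^sub>R t)) \<partial>lborel) \<le> ennreal B"
    and I: "(\<integral>\<^sup>+t. ennreal (1 / wt t ^ (2 * DIM('a))) \<partial>(lborel :: 'a measure)) \<le> ennreal I" "0 \<le> I"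
  shows "norm (g x) \<le> (kern_const TYPE('a) J * K * (I + B) powr (1 / r)) * a"
proof -
  let ?C = "kern_const TYPE('a) J" and ?N = "2 * DIM('a)"
  have C: "0 < ?C" by (rule kern_const_pos)
  have pw: "(?C / wt t ^ J) powr r * norm (g (x - (1 / b) *\<^sub>R t)) powr r
      \<le> (?C * K * a) powr r * (1 / wt t ^ ?N * (1 + E (x - (1 / b) *\<^sub>R t) powr p (x - (1 / b) *\<^sub>R t)))" for t
  proof -
    let ?y = "x - (1 / b) *\<^sub>R t"
    have w: "0 < wt t" "1 \<le> wt t" by (simp_all add: wt_pos wt_ge_1)
    have "(?C / wt t ^ J) powr r * norm (g ?y) powr r \<le> (?C / wt t ^ J) powr r * (K * wt t powr M * a * E ?y) powr r"
      using r le[of t] by (intro mult_left_mono powr_mono2) auto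
    also have "\<dots> = (?C * K * a) powr r * ((wt t powr M / wt t ^ J) powr r * E ?y powr r)"
      using C K a E0[of ?y] w by (simp add: powr_mult powr_divide)
    also have "(wt t powr M / wt t ^ J) powr r = wt t powr (- ((real J - M) * r))"
    proof -
      have "wt t powr M / wt t ^ J = wt t powr (M - real J)"
        using w by (simp add: powr_diff powr_realpow)
      then show ?thesis by (simp add: powr_powr algebra_simps)
    qed
    also have "(?C * K * a) powr r * (wt t powr (- ((real J - M) * r)) * E ?y powr r) \<le>
      (?C * K * a) powr r * (1 / wt t ^ ?N * (1 + E ?y powr p ?y))"
    proof (intro mult_left_mono mult_mono)
      have "wt t powr (- ((real J - M) * r)) \<le> wt t powr (- real ?N)"
        using JM w by (intro powr_mono) auto
      then show "wt t powr (- ((real J - M) * r)) \<le> 1 / wt t ^ ?N"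
        using w by (simp only: powr_minus_divide powr_realpow)
      show "E ?y powr r \<le> 1 + E ?y powr p ?y"
      proof (cases "E ?y \<le> 1")
        case True
        then have "E ?y powr r \<le> 1" using E0[of ?y] r by (simp add: powr_le1)
        then show ?thesis by (simp add: add_increasing2)
      next
        case False
        then have "E ?y powr r \<le> E ?y powr p ?y" using rp by (intro powr_mono) auto
        then show ?thesis by simp
      qed
    qed (auto simp: wt_nonneg)
    finally show ?thesis .
  qed
  have "ennreal (norm (g x) powr r) \<le>
    (\<integral>\<^sup>+t. ennreal ((?C * K * a) powr r) * (ennreal (1 / wt t ^ ?N) + ennreal (1 / wt t ^ ?N * E (x - (1 / b) *\<^sub>R t) powr p (x - (1 / b) *\<^sub>R t))) \<partial>lborel)"
  proof (rule order_trans[OF sampled_powr_le[OF g b r J]], rule nn_integral_mono)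
    fix t :: 'a
    have "ennreal ((?C / wt t ^ J) powr r * norm (g (x - (1 / b) *\<^sub>R t)) powr r) \<le>
       ennreal ((?C * K * a) powr r * (1 / wt t ^ ?N * (1 + E (x - (1 / b) *\<^sub>R t) powr p (x - (1 / b) *\<^sub>R t))))"
      by (rule ennreal_leI[OF pw])
    also have "\<dots> = ennreal ((?C * K * a) powr r * (1 / wt t ^ ?N + 1 / wt t ^ ?N * E (x - (1 / b) *\<^sub>R t) powr p (x - (1 / b) *\<^sub>R t)))"
      by (simp only: distrib_left mult_1_right)
    also have "\<dots> = ennreal ((?C * K * a) powr r) * (ennreal (1 / wt t ^ ?N) + ennreal (1 / wt t ^ ?N * E (x - (1 / b) *\<^sub>R t) powr p (x - (1 / b) *\<^sub>R t)))"
      by (subst ennreal_mult) (auto simp del: ennreal_plus simp add: wt_nonneg ennreal_plus[symmetric])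
    finally show "ennreal ((?C / wt t ^ J) powr r * norm (g (x - (1 / b) *\<^sub>R t)) powr r) \<le> \<dots>" .
  qed
  also have "\<dots> = ennreal ((?C * K * a) powr r) * ((\<integral>\<^sup>+t. ennreal (1 / wt t ^ ?N) \<partial>(lborel :: 'a measure)) +
      (\<integral>\<^sup>+t. ennreal (1 / wt t ^ ?N * E (x - (1 / b) *\<^sub>R t) powr p (x - (1 / b) *\<^sub>R t)) \<partial>lborel))"
    by (subst nn_integral_cmult, measurable, subst nn_integral_add) auto
  also have "\<dots> \<le> ennreal ((?C * K * a) powr r) * (ennreal I + ennreal B)"
    by (intro mult_left_mono add_mono I int) auto
  also have "\<dots> = ennreal ((?C * K * a) powr r * (I + B))"
    using I B by (simp add: ennreal_mult ennreal_plus)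
  finally have "norm (g x) powr r \<le> (?C * K * a) powr r * (I + B)"
    using I B by (subst (asm) ennreal_le_iff) auto
  then have "(norm (g x) powr r) powr (1 / r) \<le> ((?C * K * a) powr r * (I + B)) powr (1 / r)"
    using r by (intro powr_mono2) auto
  then show ?thesis using r C K a I B by (simp add: powr_mult powr_powr mult_ac)
qed

section \<open>Log-Hoelder continuity across scales and sums over cubes\<close>

text \<open>If \<open>norm t\<close> is at most \<open>2 powr (w/2)\<close>, the two points are
  within \<open>2 powr (- w/2)\<close> and the modulus is of order \<open>1 / w\<close>; otherwise
  \<open>w\<close> itself is bounded by a multiple of \<open>ln (wt t)\<close>. After
  exponentiation, \<open>2 powr (w * h)\<close> changes between the two points by at most a constant
  times a power of \<open>wt t\<close>.\<close>

lemma log_holder: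
  fixes h :: "'a::euclidean_space \<Rightarrow> real"
  assumes "C_log_loc h"
  shows "\<exists>M\<ge>0. \<forall>w\<ge>0. \<forall>x t. (w * ln 2) * \<bar>h x - h (x - (1 / 2 powr w) *\<^sub>R t)\<bar> \<le> M * (1 + ln (wt t))"
proof -
  obtain c where c: "\<And>x y. \<bar>h x - h y\<bar> \<le> c / ln (exp 1 + 1 / norm (x - y))"
    using assms by (auto simp: C_log_loc_def)
  have "(w * ln 2) * \<bar>h x - h (x - (1 / 2 powr w) *\<^sub>R t)\<bar> \<le> (2 * \<bar>c\<bar>) * (1 + ln (wt t))" if w: "0 \<le> w" for w x t
  proof (cases "t = 0")
    case True
    then show ?thesis by (simp add: wt_def)
  next
    case False
    define d where "d = norm t / 2 powr w"
    have d: "0 < d" using False by (simp add: d_def)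
    define l where "l = ln (exp 1 + 1 / d)"
    have "ln (exp 1) \<le> l" unfolding l_def using d by (subst ln_le_cancel_iff) (auto simp: add_pos_pos)
    then have l1: "1 \<le> l" by simp
    have "norm (x - (x - (1 / 2 powr w) *\<^sub>R t)) = d" by (simp add: d_def)
    then have "\<bar>h x - h (x - (1 / 2 powr w) *\<^sub>R t)\<bar> \<le> c / l"
      using c[of x "x - (1 / 2 powr w) *\<^sub>R t"] by (simp add: l_def)
    also have "\<dots> \<le> \<bar>c\<bar> / l" using l1 by (intro divide_right_mono) auto
    finally have h: "\<bar>h x - h (x - (1 / 2 powr w) *\<^sub>R t)\<bar> \<le> \<bar>c\<bar> / l" .
    have lw: "0 \<le> ln (wt t)" by (simp add: wt_ge_1)
    have "w * ln 2 \<le> 2 * l * (1 + ln (wt t))"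
    proof (cases "norm t \<le> 2 powr (w / 2)")
      case True
      have "2 powr (w / 2) \<le> 1 / d"
      proof -
        have "2 powr (w / 2) * norm t \<le> 2 powr (w / 2) * 2 powr (w / 2)" using True by (intro mult_left_mono) auto
        then have "2 powr (w / 2) * norm t \<le> 2 powr w" by (simp add: powr_add[symmetric])
        then show ?thesis using False by (simp add: d_def field_simps)
      qed
      then have "2 powr (w / 2) \<le> exp 1 + 1 / d" by (rule order_trans) simp
      then have "ln (2 powr (w / 2)) \<le> l" unfolding l_def by (subst ln_le_cancel_iff) (use d in \<open>auto simp: add_pos_pos\<close>)
      then have "w * ln 2 \<le> 2 * l" by (simp add: ln_powr)
      also have "\<dots> \<le> 2 * l * (1 + ln (wt t))" using l1 lw by simp
      finally show ?thesis .
    next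
      case False
      then have "2 powr (w / 2) \<le> wt t" by (simp add: wt_def)
      then have "ln (2 powr (w / 2)) \<le> ln (wt t)" by (subst ln_le_cancel_iff) (auto simp: wt_pos)
      then have "w * ln 2 \<le> 2 * 1 * (1 + ln (wt t))" by (simp add: ln_powr)
      also have "\<dots> \<le> 2 * l * (1 + ln (wt t))" using l1 lw by (intro mult_right_mono) auto
      finally show ?thesis .
    qed
    then have "(w * ln 2) * \<bar>h x - h (x - (1 / 2 powr w) *\<^sub>R t)\<bar> \<le> (2 * l * (1 + ln (wt t))) * (\<bar>c\<bar> / l)"
      by (rule mult_mono[OF _ h]) (use l1 lw in auto)
    also have "\<dots> = (2 * \<bar>c\<bar>) * (1 + ln (wt t))" using l1 by simp
    finally show ?thesis .
  qed
  then show ?thesis by (intro exI[of _ "2 * \<bar>c\<bar>"]) auto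
qed

text \<open>The counting measure on the lattice removes the enumeration, so that the translation
  becomes a mere bijection.\<close>

lemma suminf_ivec_shift:
  fixes f :: "'a::euclidean_space \<Rightarrow> ennreal"
  assumes z: "z \<in> ivecs"
  shows "(\<Sum>k. f (ivec k - z)) = (\<Sum>k. f (ivec k))"
proof -
  have e: "(\<Sum>k. h (ivec k)) = (\<integral>\<^sup>+y. h y \<partial>count_space (ivecs :: 'a set))" for h :: "'a \<Rightarrow> ennreal"
    unfolding nn_integral_count_space_nat[symmetric] by (rule nn_integral_bij_count_space[OF bij_ivec])
  have "bij_betw (\<lambda>y. y - z) ivecs ivecs"
    by (rule bij_betwI[where g="\<lambda>y. y + z"]) (use z in \<open>auto simp: ivecs_add ivecs_diff\<close>)
  then show ?thesis
    unfolding e[of "\<lambda>y. f (y - z)"] e[of f] by (rule nn_integral_bij_count_space)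
qed

definition cube :: "real \<Rightarrow> 'a::euclidean_space \<Rightarrow> 'a set" where
  "cube a z = {x. vfloor (a *\<^sub>R x) = z}"

lemma vfloor_measurable[measurable]: "(vfloor :: 'a::euclidean_space \<Rightarrow> 'a) \<in> borel_measurable borel"
  unfolding vfloor_def by measurable

lemma cube_measurable[measurable]: "cube a z \<in> sets borel"
proof -
  have "cube a z = (\<lambda>x. vfloor (a *\<^sub>R x)) -` {z} \<inter> space borel" by (auto simp: cube_def)
  also have "\<dots> \<in> sets borel" by (rule measurable_sets[where A=borel]) measurable
  finally show ?thesis .
qed

lemma norm_vfloor_diff: "norm (vfloor x - vfloor (y :: 'a::euclidean_space)) \<le> norm (x - y) + 2 * DIM('a)"
proof -
  have "norm ((x - y) - (x - vfloor x) + (y - vfloor y)) \<le> norm (x - y) + norm (x - vfloor x) + norm (y - vfloor y)"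
    using norm_triangle_ineq[of "(x - y) - (x - vfloor x)" "y - vfloor y"] norm_triangle_ineq4[of "x - y" "x - vfloor x"]
    by linarith
  then show ?thesis using norm_ucube[OF diff_vfloor_in[of x]] norm_ucube[OF diff_vfloor_in[of y]] by simp
qed

lemma suminf_cube:
  fixes f :: "'a::euclidean_space \<Rightarrow> ennreal"
  shows "(\<Sum>k. f (ivec k) * indicator (cube a (ivec k)) y) = f (vfloor (a *\<^sub>R y))"
proof -
  obtain k0 where k0: "ivec k0 = vfloor (a *\<^sub>R y)" using ivec_surj[OF vfloor_in] by blast
  have "(\<Sum>k. f (ivec k) * indicator (cube a (ivec k)) y) = (\<Sum>k\<in>{k0}. f (ivec k) * indicator (cube a (ivec k)) y)"
  proof (rule suminf_finite)
    fix k assume "k \<notin> {k0}"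
    then have "(ivec k :: 'a) \<noteq> vfloor (a *\<^sub>R y)" using inj_ivec[of k k0, where 'a='a] k0 by auto
    then show "f (ivec k) * indicator (cube a (ivec k)) y = 0" by (auto simp: cube_def indicator_def)
  qed simp
  then show ?thesis using k0 by (simp add: cube_def)
qed

text \<open>Read off from \<open>log_holder\<close>: for nearby points \<open>wt t\<close> stays
  below 2 while \<open>w\<close> is as large as desired.\<close>

lemma C_log_loc_continuous:
  fixes h :: "'a::euclidean_space \<Rightarrow> real"
  assumes "C_log_loc h" shows "continuous_on UNIV h"
proof -
  obtain M where M: "M \<ge> 0" and le: "\<And>w x t. 0 \<le> w \<Longrightarrow> (w * ln 2) * \<bar>h x - h (x - (1 / 2 powr w) *\<^sub>R t)\<bar> \<le> M * (1 + ln (wt t))"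
    using log_holder[OF assms] by auto
  show ?thesis unfolding continuous_on_iff
  proof (intro ballI allI impI)
    fix x :: 'a and e :: real assume e: "0 < e"
    define w where "w = (M * (1 + ln 2) + 1) / (e * ln 2)"
    have w: "0 < w" unfolding w_def using M e by (intro divide_pos_pos mult_pos_pos add_nonneg_pos mult_nonneg_nonneg) auto
    have "dist (h y) (h x) < e" if y: "dist y x < 1 / 2 powr w" for y
    proof -
      define t where "t = (2 powr w) *\<^sub>R (x - y)"
      have t: "x - (1 / 2 powr w) *\<^sub>R t = y" by (simp add: t_def)
      have "norm t = 2 powr w * dist y x" by (simp add: t_def dist_norm norm_minus_commute)
      also have "\<dots> \<le> 2 powr w * (1 / 2 powr w)" using y by (intro mult_left_mono) auto
      finally have "wt t \<le> 2" by (simp add: wt_def)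
      then have l2: "ln (wt t) \<le> ln 2" by (subst ln_le_cancel_iff) (auto simp: wt_pos)
      have "(w * ln 2) * \<bar>h x - h y\<bar> \<le> M * (1 + ln (wt t))"
        using le[of w x t] w unfolding t by simp
      also have "\<dots> \<le> M * (1 + ln 2)" using l2 M by (intro mult_left_mono) auto
      also have "\<dots> < w * ln 2 * e" using e by (simp add: w_def)
      finally have "\<bar>h x - h y\<bar> < e" using w by simp
      then show ?thesis by (simp add: dist_real_def abs_minus_commute)
    qed
    then show "\<exists>d>0. \<forall>x'\<in>UNIV. dist x' x < d \<longrightarrow> dist (h x') (h x) < e"
      by (intro exI[of _ "1 / 2 powr w"]) auto
  qed
qed

lemma measurable_vfloor_compose:
  fixes lam :: "'a::euclidean_space \<Rightarrow> real"
  assumes "\<And>z. z \<in> ivecs \<Longrightarrow> 0 \<le> lam z"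
  shows "(\<lambda>y. lam (vfloor (a *\<^sub>R y))) \<in> borel_measurable borel"
proof -
  have "(\<lambda>y. lam (vfloor (a *\<^sub>R y))) = (\<lambda>y. enn2real (\<Sum>k. ennreal (lam (ivec k)) * indicator (cube a (ivec k)) y))"
    unfolding suminf_cube[of "\<lambda>z. ennreal (lam z)"]
    by (rule ext, rule enn2real_ennreal[symmetric], rule assms, rule vfloor_in)
  also have "\<dots> \<in> borel_measurable borel" by measurable
  finally show ?thesis .
qed

lemma wt_cube_diff:
  fixes x y :: "'a::euclidean_space"
  assumes "v \<le> w"
  shows "wt (vfloor (2 powr v *\<^sub>R y) - vfloor (2 powr v *\<^sub>R x)) \<le> (1 + 2 * real DIM('a)) * wt (2 powr w *\<^sub>R (x - y))"
proof -
  have "norm (2 powr v *\<^sub>R y - 2 powr v *\<^sub>R x) = 2 powr v * norm (x - y)"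
    unfolding scaleR_diff_right[symmetric] by (simp add: norm_minus_commute)
  also have "\<dots> \<le> 2 powr w * norm (x - y)" using assms by (intro mult_right_mono) auto
  also have "\<dots> = norm (2 powr w *\<^sub>R (x - y))" by simp
  finally have "norm (vfloor (2 powr v *\<^sub>R y) - vfloor (2 powr v *\<^sub>R x)) \<le> norm (2 powr w *\<^sub>R (x - y)) + 2 * DIM('a)"
    using norm_vfloor_diff[of "2 powr v *\<^sub>R y" "2 powr v *\<^sub>R x"] by linarith
  moreover have "0 \<le> 2 * real DIM('a) * norm (2 powr w *\<^sub>R (x - y))" by simp
  ultimately show ?thesis unfolding wt_def distrib_left distrib_right by linarith
qed

lemma sum_inverse_wt:
  fixes z0 :: "'a::euclidean_space"
  assumes "z0 \<in> ivecs"
  shows "(\<Sum>k. ennreal (1 / wt (ivec k - z0) ^ (2 * DIM('a)))) = ennreal (\<Sum>k. 1 / wt (ivec k :: 'a) ^ (2 * DIM('a)))"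
proof -
  have "(\<Sum>k. ennreal (1 / wt (ivec k - z0) ^ (2 * DIM('a)))) = (\<Sum>k. ennreal (1 / wt (ivec k :: 'a) ^ (2 * DIM('a))))"
    by (rule suminf_ivec_shift[OF assms, of "\<lambda>z. ennreal (1 / wt z ^ (2 * DIM('a)))"])
  also have "\<dots> = ennreal (\<Sum>k. 1 / wt (ivec k :: 'a) ^ (2 * DIM('a)))"
    by (rule suminf_ennreal2) (auto simp: wt_nonneg summable_wt)
  finally show ?thesis .
qed

text \<open>After the substitution \<open>y = x - t / 2^w\<close> the integral is split over the
  cubes of side \<open>2^(-v)\<close>. As \<open>v \<le> w\<close>, the weight at \<open>y\<close>
  dominates, up to a constant, the distance between the indices of the cubes of \<open>y\<close> and
  \<open>x\<close>; each cube contributes at most 1, and the inverse weights of the index distances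
  are summable.\<close>

lemma weighted_cube_integral:
  fixes f :: "'a::euclidean_space \<Rightarrow> ennreal"
  assumes [measurable]: "f \<in> borel_measurable borel" and v: "v \<le> w"
    and f: "\<And>z. z \<in> ivecs \<Longrightarrow> (\<integral>\<^sup>+y. f y * indicator (cube (2 powr v) z) y \<partial>lborel) \<le> 1"
  shows "(\<integral>\<^sup>+t. ennreal (1 / wt t ^ (2 * DIM('a)) * (1 / 2 powr w) ^ DIM('a)) * f (x - (1 / 2 powr w) *\<^sub>R t) \<partial>lborel)
    \<le> ennreal ((1 + 2 * real DIM('a)) ^ (2 * DIM('a)) * (\<Sum>k. 1 / wt (ivec k :: 'a) ^ (2 * DIM('a))))"
proof -
  let ?N = "2 * DIM('a)" and ?K = "1 + 2 * real DIM('a)"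
  define z0 where "z0 = vfloor (2 powr v *\<^sub>R x)"
  have z0: "z0 \<in> ivecs" unfolding z0_def by (rule vfloor_in)
  define \<Phi> where "\<Phi> y = ennreal (1 / wt (2 powr w *\<^sub>R (x - y)) ^ ?N) * f y" for y
  have inv: "1 / b \<le> c * (1 / a)" if "a \<le> c * b" "0 < a" "0 < b" for a b c :: real
    using that by (simp add: field_simps)
  have [measurable]: "\<Phi> \<in> borel_measurable borel" unfolding \<Phi>_def by measurable
  have "(\<integral>\<^sup>+y. \<Phi> y \<partial>lborel) = ennreal (\<bar>- (1 / 2 powr w)\<bar> ^ DIM('a)) * (\<integral>\<^sup>+t. \<Phi> (x + (- (1 / 2 powr w)) *\<^sub>R t) \<partial>lborel)"
    by (rule nn_integral_affine) auto
  also have "\<dots> = (\<integral>\<^sup>+t. ennreal (1 / wt t ^ ?N * (1 / 2 powr w) ^ DIM('a)) * f (x - (1 / 2 powr w) *\<^sub>R t) \<partial>lborel)"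
  proof (subst nn_integral_cmult[symmetric], measurable, rule nn_integral_cong)
    fix t :: 'a
    define c where "c = 1 / 2 powr w"
    have c: "0 \<le> c" "\<bar>- c\<bar> = c" "2 powr w *\<^sub>R (c *\<^sub>R t) = t" by (simp_all add: c_def)
    have x: "x + (- c) *\<^sub>R t = x - c *\<^sub>R t" "x - (x - c *\<^sub>R t) = c *\<^sub>R t" by simp_all
    have "ennreal (c ^ DIM('a)) * (ennreal (1 / wt t ^ ?N) * f (x - c *\<^sub>R t)) = ennreal (1 / wt t ^ ?N * c ^ DIM('a)) * f (x - c *\<^sub>R t)"
      by (subst ennreal_mult) (simp_all only: mult_ac zero_le_divide_1_iff zero_le_power wt_nonneg c)
    then show "ennreal (\<bar>- (1 / 2 powr w)\<bar> ^ DIM('a)) * \<Phi> (x + (- (1 / 2 powr w)) *\<^sub>R t) =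
        ennreal (1 / wt t ^ ?N * (1 / 2 powr w) ^ DIM('a)) * f (x - (1 / 2 powr w) *\<^sub>R t)"
      unfolding c_def[symmetric] \<Phi>_def x c .
  qed
  finally have e: "(\<integral>\<^sup>+t. ennreal (1 / wt t ^ ?N * (1 / 2 powr w) ^ DIM('a)) * f (x - (1 / 2 powr w) *\<^sub>R t) \<partial>lborel) = (\<integral>\<^sup>+y. \<Phi> y \<partial>lborel)" ..
  have "(\<integral>\<^sup>+y. \<Phi> y \<partial>lborel) = (\<integral>\<^sup>+y. (\<Sum>k. \<Phi> y * indicator (cube (2 powr v) (ivec k)) y) \<partial>lborel)"
    using suminf_cube[of "\<lambda>_. \<Phi> y" "2 powr v" y for y] by simp
  also have "\<dots> = (\<Sum>k. \<integral>\<^sup>+y. \<Phi> y * indicator (cube (2 powr v) (ivec k)) y \<partial>lborel)"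
    by (rule nn_integral_suminf) measurable
  also have "\<dots> \<le> (\<Sum>k. ennreal (?K ^ ?N) * ennreal (1 / wt (ivec k - z0) ^ ?N))"
  proof (rule suminf_le)
    fix k
    have "(\<integral>\<^sup>+y. \<Phi> y * indicator (cube (2 powr v) (ivec k)) y \<partial>lborel) \<le>
      (\<integral>\<^sup>+y. ennreal (?K ^ ?N * (1 / wt (ivec k - z0) ^ ?N)) * (f y * indicator (cube (2 powr v) (ivec k)) y) \<partial>lborel)"
    proof (rule nn_integral_mono)
      fix y :: 'a
      show "\<Phi> y * indicator (cube (2 powr v) (ivec k)) y \<le> ennreal (?K ^ ?N * (1 / wt (ivec k - z0) ^ ?N)) * (f y * indicator (cube (2 powr v) (ivec k)) y)"
      proof (cases "y \<in> cube (2 powr v) (ivec k)")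
        case True
        then have k: "ivec k = vfloor (2 powr v *\<^sub>R y)" by (simp add: cube_def)
        have "wt (ivec k - z0) ^ ?N \<le> (?K * wt (2 powr w *\<^sub>R (x - y))) ^ ?N"
          unfolding k z0_def by (intro power_mono wt_cube_diff v wt_nonneg)
        then have "wt (ivec k - z0) ^ ?N \<le> ?K ^ ?N * wt (2 powr w *\<^sub>R (x - y)) ^ ?N"
          by (simp only: power_mult_distrib)
        then have "1 / wt (2 powr w *\<^sub>R (x - y)) ^ ?N \<le> ?K ^ ?N * (1 / wt (ivec k - z0) ^ ?N)"
          by (rule inv) (simp_all only: zero_less_power wt_pos)
        then show ?thesis using True unfolding \<Phi>_def by (simp only: indicator_simps mult_1_right) (intro mult_right_mono ennreal_leI, auto)
      next
        case False
        then have "indicator (cube (2 powr v) (ivec k)) y = (0 :: ennreal)" by (simp only: indicator_eq_0_iff not_False_eq_True)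
        then show ?thesis by (simp only: mult_zero_right order_refl)
      qed
    qed
    also have "\<dots> = ennreal (?K ^ ?N * (1 / wt (ivec k - z0) ^ ?N)) * (\<integral>\<^sup>+y. f y * indicator (cube (2 powr v) (ivec k)) y \<partial>lborel)"
      by (rule nn_integral_cmult) measurable
    also have "\<dots> \<le> ennreal (?K ^ ?N * (1 / wt (ivec k - z0) ^ ?N)) * 1"
      by (intro mult_left_mono f) auto
    also have "\<dots> = ennreal (?K ^ ?N) * ennreal (1 / wt (ivec k - z0) ^ ?N)"
      unfolding mult_1_right by (rule ennreal_mult) (auto simp: wt_nonneg)
    finally show "(\<integral>\<^sup>+y. \<Phi> y * indicator (cube (2 powr v) (ivec k)) y \<partial>lborel) \<le> ennreal (?K ^ ?N) * ennreal (1 / wt (ivec k - z0) ^ ?N)" .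
  qed auto
  also have "\<dots> = ennreal (?K ^ ?N) * ennreal (\<Sum>k. 1 / wt (ivec k :: 'a) ^ ?N)"
    by (simp only: ennreal_suminf_cmult sum_inverse_wt[OF z0])
  also have "\<dots> = ennreal (?K ^ ?N * (\<Sum>k. 1 / wt (ivec k :: 'a) ^ ?N))"
    by (rule ennreal_mult[symmetric]) (auto intro!: suminf_nonneg summable_wt simp: wt_nonneg)
  finally show ?thesis unfolding e .
qed

section \<open>The pointwise bound\<close>

text \<open>The last factor is \<open>|P|^(-\<tau>)\<close> for a cube of side
  \<open>2^(-v)\<close>. The indicator of the cube is left out, since neighbouring cubes of the same
  size are compared.\<close>

definition height :: "real \<Rightarrow> real \<Rightarrow> ('a::euclidean_space \<Rightarrow> real) \<Rightarrow> ('a \<Rightarrow> real) \<Rightarrow> ('a \<Rightarrow> complex) \<Rightarrow> 'a \<Rightarrow> real" where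
  "height w v \<alpha> \<tau> g y = 2 powr (w * \<alpha> y) * norm (g y) * 2 powr (v * DIM('a) * \<tau> y)"

text \<open>The pointwise bound: a Nikolskii inequality on each dyadic cube, with the sequence-space
  weights of the neighbouring cubes collected in the number D.\<close>

theorem sup_bound:
  fixes \<alpha> ip iq \<tau> :: "'a::euclidean_space \<Rightarrow> real"
  assumes log: "C_log_loc \<alpha>" "C_log_loc \<tau>" "C_log_loc ip" "C_log_loc iq"
    and ip: "\<And>y. 0 < ip y" "\<And>y. ip y \<le> Bp" and iq: "\<And>y. 0 < iq y" "\<And>y. iq y \<le> Bq"
    and S: "1 \<le> S"
  obtains C where "1 \<le> C"
    "\<And>w v g lam \<mu> x D. \<bar>v\<bar> \<le> w \<Longrightarrow> sampled (2 powr w) g \<Longrightarrow> 0 < \<mu> \<Longrightarrow> (\<And>z. z \<in> ivecs \<Longrightarrow> 0 < lam z) \<Longrightarrow>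
      2 powr (- w) \<le> D \<Longrightarrow> D \<le> S \<Longrightarrow>
      (\<And>z. z \<in> ivecs \<Longrightarrow> lam z \<le> D * wt (z - vfloor (2 powr v *\<^sub>R x)) ^ (2 * DIM('a))) \<Longrightarrow>
      (\<And>z. z \<in> ivecs \<Longrightarrow> (\<integral>\<^sup>+y. ennreal ((height w v \<alpha> \<tau> g y / (\<mu> * lam z powr iq y)) powr (1 / ip y)) * indicator (cube (2 powr v) z) y \<partial>lborel) \<le> 1) \<Longrightarrow>
      height w v \<alpha> \<tau> g x \<le> C * \<mu> * 2 powr (w * DIM('a) * ip x) * D powr iq x"
proof -
  let ?n = "real DIM('a)" and ?N = "2 * DIM('a)"
  note cont = log[THEN C_log_loc_continuous]
  have [measurable]: "\<alpha> \<in> borel_measurable borel" "\<tau> \<in> borel_measurable borel"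
      "ip \<in> borel_measurable borel" "iq \<in> borel_measurable borel"
    using cont by (auto intro: borel_measurable_continuous_onI)
  define \<Delta> where "\<Delta> w h x t = (w * ln 2) * \<bar>h x - h (x - (1 / 2 powr w) *\<^sub>R t)\<bar>" for w and h :: "'a \<Rightarrow> real" and x t
  obtain Ma where Ma: "\<And>w x t. 0 \<le> w \<Longrightarrow> \<Delta> w \<alpha> x t \<le> Ma * (1 + ln (wt t))" "0 \<le> Ma"
    using log_holder[OF log(1)] unfolding \<Delta>_def by auto
  obtain Mt where Mt: "\<And>w x t. 0 \<le> w \<Longrightarrow> \<Delta> w \<tau> x t \<le> Mt * (1 + ln (wt t))" "0 \<le> Mt"
    using log_holder[OF log(2)] unfolding \<Delta>_def by auto
  obtain Mp where Mp: "\<And>w x t. 0 \<le> w \<Longrightarrow> \<Delta> w ip x t \<le> Mp * (1 + ln (wt t))" "0 \<le> Mp"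
    using log_holder[OF log(3)] unfolding \<Delta>_def by auto
  obtain Mq where Mq: "\<And>w x t. 0 \<le> w \<Longrightarrow> \<Delta> w iq x t \<le> Mq * (1 + ln (wt t))" "0 \<le> Mq"
    using log_holder[OF log(4)] unfolding \<Delta>_def by auto
  have Bq0: "0 < Bq" and Bp0: "0 < Bp" by (rule order_less_le_trans[OF iq(1) iq(2)], rule order_less_le_trans[OF ip(1) ip(2)])
  \<comment> \<open>Total oscillation of the exponents in \<open>A\<close> below: the term with
    \<open>ln S\<close> covers the bounded part of \<open>|ln D|\<close>, the others come from
    \<open>log_holder\<close>.\<close>
  define M0 where "M0 = Bq * ln S + Mq + Ma + ?n * Mt + ?n * Mp"
  have lnS: "0 \<le> ln S" using S by simp
  define Kc where "Kc = 1 + 2 * ?n"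
  have Kc1: "1 \<le> Kc" by (simp add: Kc_def)
  \<comment> \<open>The first factor is the price of bounding \<open>lam\<close> on other cubes
    through \<open>D\<close>, the second that of moving the exponents to \<open>x\<close>;
    \<open>M\<close> counts the corresponding powers of \<open>wt t\<close>.\<close>
  define K where "K = Kc powr (?N * Bq) * exp M0"
  define M where "M = M0 + ?N * Bq"
  define r where "r = min 1 (1 / Bp)"
  have r: "0 < r" "r \<le> 1" using Bp0 by (auto simp: r_def)
  have rp: "r \<le> 1 / ip y" for y
    using frac_le[of 1 1 "ip y" Bp] ip[of y] by (simp add: r_def min.coboundedI2)
  \<comment> \<open>Large enough to beat the loss \<open>wt t powr M\<close> and still keep
    \<open>2 * DIM('a)\<close> orders of decay after raising to the power \<open>r\<close>.\<close>
  define J where "J = nat \<lceil>M + ?N / r\<rceil> + 1"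
  have J: "J > 0" by (simp add: J_def)
  have JM: "2 * ?n \<le> (real J - M) * r"
  proof -
    have "M + ?N / r \<le> real J" unfolding J_def by linarith
    then have "?N / r * r \<le> (real J - M) * r" using r by (intro mult_right_mono) auto
    then show ?thesis using r by simp
  qed
  obtain I where I: "(\<integral>\<^sup>+t. ennreal (1 / wt t ^ ?N) \<partial>(lborel :: 'a measure)) \<le> ennreal I" "0 \<le> I"
    using nn_integral_wt_finite[where 'a='a]
    by (cases "\<integral>\<^sup>+t. ennreal (1 / wt t ^ ?N) \<partial>(lborel :: 'a measure)") auto
  define B where "B = Kc ^ ?N * (\<Sum>k. 1 / wt (ivec k :: 'a) ^ ?N)"
  have B: "0 \<le> B" unfolding B_def using Kc1
    by (intro mult_nonneg_nonneg suminf_nonneg summable_wt) (auto simp: wt_nonneg)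
  define C0 where "C0 = kern_const TYPE('a) J * K * (I + B) powr (1 / r)"
  have K0: "0 \<le> K" by (simp add: K_def)
  show ?thesis
  proof (rule that[of "max 1 C0"])
    fix w v :: real and g lam \<mu> x D
    assume v: "\<bar>v\<bar> \<le> w" and g: "sampled (2 powr w) g" and \<mu>: "0 < \<mu>"
      and lam: "\<And>z::'a. z \<in> ivecs \<Longrightarrow> 0 < lam z"
      and D: "2 powr (- w) \<le> D" "D \<le> S"
      and lamD: "\<And>z. z \<in> ivecs \<Longrightarrow> lam z \<le> D * wt (z - vfloor (2 powr v *\<^sub>R x)) ^ ?N"
      and int: "\<And>z. z \<in> ivecs \<Longrightarrow> (\<integral>\<^sup>+y. ennreal ((height w v \<alpha> \<tau> g y / (\<mu> * lam z powr iq y)) powr (1 / ip y)) * indicator (cube (2 powr v) z) y \<partial>lborel) \<le> 1"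
    have w: "0 \<le> w" using v by simp
    have D0: "0 < D" using D(1) by (rule order_less_le_trans[rotated]) simp
    \<comment> \<open>The two-sided bounds on \<open>D\<close> are used here: \<open>|ln D|\<close>
      grows at most like \<open>w * ln 2\<close>, the rate at which \<open>log_holder\<close>
      controls the oscillation of \<open>iq\<close>.\<close>
    have lnD: "\<bar>ln D\<bar> \<le> ln S + w * ln 2"
    proof -
      have "ln (2 powr (- w)) \<le> ln D" using D D0 by (subst ln_le_cancel_iff) auto
      moreover have "ln D \<le> ln S" using D D0 by (subst ln_le_cancel_iff) auto
      moreover have "0 \<le> w * ln 2" using w by simp
      ultimately show ?thesis using lnS by (simp add: ln_powr)
    qed
    have [measurable]: "g \<in> borel_measurable borel" by (rule sampled_measurable[OF g]) simp
    \<comment> \<open>The right-hand side of the claim, up to constants, divided by the weights in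
      \<open>height\<close>; written as a single exponential so that \<open>A y\<close> and
      \<open>A x\<close> are compared through their exponents.\<close>
    define A where "A y = exp (iq y * ln D + ln 2 * (w * ?n * ip y - w * \<alpha> y - v * ?n * \<tau> y))" for y
    define H where "H y = height w v \<alpha> \<tau> g y" for y
    define lv where "lv y = lam (vfloor (2 powr v *\<^sub>R y))" for y
    have lv0: "0 < lv y" for y unfolding lv_def by (intro lam vfloor_in)
    have [measurable]: "lv \<in> borel_measurable borel"
      unfolding lv_def[abs_def] by (rule measurable_vfloor_compose) (use lam less_imp_le in blast)
    have [measurable]: "H \<in> borel_measurable borel" unfolding H_def[abs_def] height_def by measurable
    define E0 where "E0 y = H y / (\<mu> * lv y powr iq y)" for y
    \<comment> \<open>The divisor is chosen so that the power \<open>1 / ip y\<close> turns it into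
      the Jacobian \<open>2^(w n)\<close> of the substitution in
      \<open>weighted_cube_integral\<close>.\<close>
    define E where "E y = E0 y / 2 powr (w * ?n * ip y)" for y
    have H0: "0 \<le> H y" for y by (simp add: H_def height_def)
    have E00: "0 \<le> E0 y" for y unfolding E0_def using \<mu> H0 by simp
    have E0: "0 \<le> E y" for y unfolding E_def using E00 by simp
    have [measurable]: "E0 \<in> borel_measurable borel" unfolding E0_def[abs_def] by measurable
    have [measurable]: "E \<in> borel_measurable borel" unfolding E_def[abs_def] by measurable
    have Aeq: "A y * (2 powr (w * \<alpha> y) * 2 powr (v * ?n * \<tau> y)) = D powr iq y * 2 powr (w * ?n * ip y)" for y
      using D0 unfolding A_def powr_def by (simp add: exp_add[symmetric] algebra_simps)
    have gH: "H y = norm (g y) * (2 powr (w * \<alpha> y) * 2 powr (v * ?n * \<tau> y))" for y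
      by (simp add: H_def height_def)
    have main: "norm (g (x - (1 / 2 powr w) *\<^sub>R t)) \<le> K * wt t powr M * (\<mu> * A x) * E (x - (1 / 2 powr w) *\<^sub>R t)" for t
    proof -
      define y where "y = x - (1 / 2 powr w) *\<^sub>R t"
      have ty: "t = 2 powr w *\<^sub>R (x - y)" by (simp add: y_def)
      have lw: "0 \<le> ln (wt t)" by (simp add: wt_ge_1)
      have d0: "0 \<le> \<Delta> w h x t" for h unfolding \<Delta>_def using w by simp
      have Dy: "\<Delta> w h x t = (w * ln 2) * \<bar>h x - h y\<bar>" for h by (simp add: \<Delta>_def y_def)
      have A1: "A y \<le> A x * (exp M0 * wt t powr M0)"
      proof -
        have q: "(iq y - iq x) * ln D \<le> (Bq * ln S + Mq) * (1 + ln (wt t))"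
        proof -
          have "(iq y - iq x) * ln D \<le> \<bar>iq x - iq y\<bar> * \<bar>ln D\<bar>"
            using abs_ge_self[of "(iq y - iq x) * ln D"] by (simp add: abs_mult abs_minus_commute)
          also have "\<dots> \<le> \<bar>iq x - iq y\<bar> * (ln S + w * ln 2)" by (intro mult_left_mono lnD) auto
          also have "\<dots> = \<bar>iq x - iq y\<bar> * ln S + \<Delta> w iq x t" unfolding Dy by (simp add: algebra_simps)
          also have "\<dots> \<le> Bq * ln S + Mq * (1 + ln (wt t))"
          proof (intro add_mono mult_right_mono lnS Mq(1) w)
            show "\<bar>iq x - iq y\<bar> \<le> Bq" using iq[of x] iq[of y] by linarith
          qed
          also have "\<dots> \<le> (Bq * ln S) * (1 + ln (wt t)) + Mq * (1 + ln (wt t))"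
            using mult_left_mono[of 1 "1 + ln (wt t)" "Bq * ln S"] lw lnS Bq0 by simp
          finally show ?thesis by (simp add: distrib_right)
        qed
        have a: "(w * ln 2) * (\<alpha> x - \<alpha> y) \<le> Ma * (1 + ln (wt t))"
        proof -
          have "(w * ln 2) * (\<alpha> x - \<alpha> y) \<le> \<Delta> w \<alpha> x t" unfolding Dy using w by (intro mult_left_mono) auto
          then show ?thesis using Ma(1)[OF w, of x t] by linarith
        qed
        have p: "(w * ln 2) * (ip y - ip x) \<le> Mp * (1 + ln (wt t))"
        proof -
          have "(w * ln 2) * (ip y - ip x) \<le> \<Delta> w ip x t" unfolding Dy using w by (intro mult_left_mono) auto
          then show ?thesis using Mp(1)[OF w, of x t] by linarith
        qed
        \<comment> \<open>Here \<open>|v| \<le> w\<close> enters: the factor carrying the size of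
          the cube oscillates no faster than the scale \<open>w\<close> allows.\<close>
        have t: "(v * ln 2) * (\<tau> x - \<tau> y) \<le> Mt * (1 + ln (wt t))"
        proof -
          have "(v * ln 2) * (\<tau> x - \<tau> y) \<le> \<bar>v * ln 2\<bar> * \<bar>\<tau> x - \<tau> y\<bar>"
            by (rule order_trans[OF abs_ge_self]) (simp only: abs_mult order_refl)
          also have "\<dots> \<le> \<Delta> w \<tau> x t" unfolding Dy using v by (intro mult_right_mono) (auto simp: abs_mult)
          finally show ?thesis using Mt(1)[OF w, of x t] by linarith
        qed
        have "(iq y * ln D + ln 2 * (w * ?n * ip y - w * \<alpha> y - v * ?n * \<tau> y)) - (iq x * ln D + ln 2 * (w * ?n * ip x - w * \<alpha> x - v * ?n * \<tau> x))
          = (iq y - iq x) * ln D + (w * ln 2) * (\<alpha> x - \<alpha> y) + ?n * ((v * ln 2) * (\<tau> x - \<tau> y)) + ?n * ((w * ln 2) * (ip y - ip x))"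
          by (simp add: algebra_simps)
        also have "\<dots> \<le> (Bq * ln S + Mq) * (1 + ln (wt t)) + Ma * (1 + ln (wt t)) + ?n * (Mt * (1 + ln (wt t))) + ?n * (Mp * (1 + ln (wt t)))"
          by (intro add_mono mult_left_mono q a p t) auto
        also have "\<dots> = M0 + M0 * ln (wt t)" unfolding M0_def by (simp add: algebra_simps)
        finally have "iq y * ln D + ln 2 * (w * ?n * ip y - w * \<alpha> y - v * ?n * \<tau> y) \<le>
          (iq x * ln D + ln 2 * (w * ?n * ip x - w * \<alpha> x - v * ?n * \<tau> x)) + (M0 + M0 * ln (wt t))" by linarith
        then have "A y \<le> exp ((iq x * ln D + ln 2 * (w * ?n * ip x - w * \<alpha> x - v * ?n * \<tau> x)) + (M0 + M0 * ln (wt t)))"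
          unfolding A_def by (simp only: exp_le_cancel_iff)
        also have "\<dots> = A x * (exp M0 * wt t powr M0)"
          using wt_pos[of t] unfolding A_def exp_add powr_def by simp
        finally show ?thesis .
      qed
      have l1: "lv y powr iq y \<le> D powr iq y * (Kc powr (?N * Bq) * wt t powr (?N * Bq))"
      proof -
        let ?W = "wt (vfloor (2 powr v *\<^sub>R y) - vfloor (2 powr v *\<^sub>R x))"
        have W: "1 \<le> ?W" "0 < ?W" by (simp_all add: wt_ge_1 wt_pos)
        have "lv y powr iq y \<le> (D * ?W ^ ?N) powr iq y"
          unfolding lv_def using lamD[OF vfloor_in] lv0[of y] iq(1)[of y] by (intro powr_mono2) (auto simp: lv_def)
        also have "\<dots> = D powr iq y * ?W powr (?N * iq y)"
          using D0 W by (simp add: powr_mult powr_realpow[symmetric] powr_powr)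
        also have "\<dots> \<le> D powr iq y * (Kc * wt t) powr (?N * Bq)"
        proof (intro mult_left_mono)
          have "?W powr (?N * iq y) \<le> ?W powr (?N * Bq)" using W iq(2)[of y] by (intro powr_mono) auto
          also have "\<dots> \<le> (Kc * wt t) powr (?N * Bq)"
            using wt_cube_diff[of v w y x] v W Bq0 unfolding ty Kc_def by (intro powr_mono2) auto
          finally show "?W powr (?N * iq y) \<le> (Kc * wt t) powr (?N * Bq)" .
        qed simp
        also have "(Kc * wt t) powr (?N * Bq) = Kc powr (?N * Bq) * wt t powr (?N * Bq)"
          using Kc1 by (simp add: powr_mult wt_nonneg)
        finally show ?thesis .
      qed
      let ?P = "2 powr (w * \<alpha> y) * 2 powr (v * ?n * \<tau> y)" and ?G = "2 powr (w * ?n * ip y)"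
      have "norm (g y) * ?P = E y * \<mu> * ?G * lv y powr iq y"
        unfolding gH[symmetric] E_def E0_def using \<mu> lv0[of y] by simp
      also have "\<dots> \<le> E y * \<mu> * ?G * (D powr iq y * (Kc powr (?N * Bq) * wt t powr (?N * Bq)))"
        using E0[of y] \<mu> by (intro mult_left_mono l1) auto
      also have "\<dots> = (Kc powr (?N * Bq) * wt t powr (?N * Bq) * \<mu> * E y) * (D powr iq y * ?G)" by (simp only: mult_ac)
      also have "\<dots> = (Kc powr (?N * Bq) * wt t powr (?N * Bq) * \<mu> * E y) * A y * ?P" unfolding Aeq[symmetric] by (simp only: mult_ac)
      finally have "norm (g y) \<le> (Kc powr (?N * Bq) * wt t powr (?N * Bq) * \<mu> * E y) * A y"
        by (rule mult_right_le_imp_le) simp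
      also have "\<dots> \<le> (Kc powr (?N * Bq) * wt t powr (?N * Bq) * \<mu> * E y) * (A x * (exp M0 * wt t powr M0))"
        using \<mu> E0[of y] by (intro mult_left_mono A1) auto
      also have "\<dots> = K * (wt t powr M0 * wt t powr (?N * Bq)) * (\<mu> * A x) * E y" unfolding K_def by (simp only: mult_ac)
      also have "wt t powr M0 * wt t powr (?N * Bq) = wt t powr M" unfolding M_def by (rule powr_add[symmetric])
      finally show ?thesis unfolding y_def .
    qed
    have Ep: "E y powr (1 / ip y) = (1 / 2 powr w) ^ DIM('a) * E0 y powr (1 / ip y)" for y
    proof -
      have "(2 powr (w * ?n * ip y)) powr (1 / ip y) = 2 powr (w * ?n)" using ip(1)[of y] by (simp add: powr_powr)
      also have "\<dots> = (2 powr w) ^ DIM('a)" by (simp add: powr_powr[symmetric] powr_realpow)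
      finally show ?thesis unfolding E_def using E00[of y] by (simp add: powr_divide power_one_over)
    qed
    have "(\<integral>\<^sup>+t. ennreal (1 / wt t ^ ?N * (1 / 2 powr w) ^ DIM('a)) * ennreal (E0 (x - (1 / 2 powr w) *\<^sub>R t) powr (1 / ip (x - (1 / 2 powr w) *\<^sub>R t))) \<partial>lborel) \<le> ennreal B"
      unfolding B_def Kc_def
    proof (rule weighted_cube_integral[where f="\<lambda>y. ennreal (E0 y powr (1 / ip y))"])
      fix z :: 'a assume z: "z \<in> ivecs"
      have "ennreal (E0 y powr (1 / ip y)) * indicator (cube (2 powr v) z) y =
         ennreal ((height w v \<alpha> \<tau> g y / (\<mu> * lam z powr iq y)) powr (1 / ip y)) * indicator (cube (2 powr v) z) y" for y
        by (cases "y \<in> cube (2 powr v) z") (simp_all add: E0_def lv_def cube_def H_def)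
      then show "(\<integral>\<^sup>+y. ennreal (E0 y powr (1 / ip y)) * indicator (cube (2 powr v) z) y \<partial>lborel) \<le> 1"
        using int[OF z] by simp
    qed (use v in auto)
    then have intE: "(\<integral>\<^sup>+t. ennreal (1 / wt t ^ ?N * E (x - (1 / 2 powr w) *\<^sub>R t) powr (1 / ip (x - (1 / 2 powr w) *\<^sub>R t))) \<partial>lborel) \<le> ennreal B"
      unfolding Ep mult.assoc[symmetric] by (simp only: ennreal_mult'' powr_ge_zero)
    have "norm (g x) \<le> C0 * (\<mu> * A x)" unfolding C0_def
      by (rule averaged_bound[where p="\<lambda>y. 1 / ip y" and E=E and M=M])
         (fact g r J JM K0 B E0 rp main intE I | simp add: A_def \<mu> less_imp_le)+
    also have "\<dots> \<le> max 1 C0 * (\<mu> * A x)" using \<mu> by (intro mult_right_mono) (auto simp: A_def)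
    finally have "H x \<le> max 1 C0 * (\<mu> * A x) * (2 powr (w * \<alpha> x) * 2 powr (v * ?n * \<tau> x))"
      unfolding gH by (rule mult_right_mono) simp
    also have "\<dots> = max 1 C0 * \<mu> * 2 powr (w * ?n * ip x) * D powr iq x"
      using Aeq[of x] by (simp add: mult_ac)
    finally show "height w v \<alpha> \<tau> g x \<le> max 1 C0 * \<mu> * 2 powr (w * ?n * ip x) * D powr iq x" by (simp only: H_def)
  qed simp
qed

section \<open>Witnesses for the mixed norm and uniform bounds on the exponents\<close>

text \<open>The inner infima may be 0 or not attained, so the \<open>k\<close>-th one is exceeded by
  at most \<open>(1/2) ^ Suc k\<close>. This gives positive witnesses and raises the sum by at most
  1. Passing from the smaller outer value to \<open>\<mu>\<close> only decreases the
  modulars.\<close>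

lemma mixed_norm_lessD:
  fixes p q :: "'a::euclidean_space \<Rightarrow> real"
  assumes less: "mixed_norm p q F < ennreal \<mu>" and p: "\<And>x. 0 < p x"
  shows "\<exists>lam. (\<forall>k. 0 < lam k \<and>
     (\<integral>\<^sup>+x. ennreal ((norm (F k x) / (\<mu> * lam k powr (1 / q x))) powr p x) \<partial>lborel) \<le> 1) \<and>
     (\<Sum>k. ennreal (lam k)) \<le> 2"
proof -
  let ?A = "\<lambda>\<mu> k. {ennreal lam | lam. 0 < lam \<and>
      (\<integral>\<^sup>+x. ennreal ((norm (F k x) / (\<mu> * lam powr (1 / q x))) powr p x) \<partial>lborel) \<le> 1}"
  obtain \<mu>' where \<mu>': "0 < \<mu>'" "ennreal \<mu>' < ennreal \<mu>" and s1: "(\<Sum>k. Inf (?A \<mu>' k)) \<le> 1"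
    using less unfolding mixed_norm_def Inf_less_iff by auto
  have \<mu>\<mu>: "\<mu>' \<le> \<mu>" using \<mu>' by (simp add: ennreal_less_iff)
  have less: "a < a + ennreal ((1/2) ^ Suc k)" if "a \<le> 1" for a :: ennreal and k
    using that by (cases a) (auto simp: ennreal_plus[symmetric] ennreal_less_iff top_unique simp del: ennreal_plus)
  have "\<exists>l. 0 < l \<and> (\<integral>\<^sup>+x. ennreal ((norm (F k x) / (\<mu>' * l powr (1 / q x))) powr p x) \<partial>lborel) \<le> 1 \<and>
      ennreal l \<le> Inf (?A \<mu>' k) + ennreal ((1/2) ^ Suc k)" for k
  proof -
    have "Inf (?A \<mu>' k) \<le> (\<Sum>k. Inf (?A \<mu>' k))"
      using sum_le_suminf[OF summableI, of "{k}" "\<lambda>k. Inf (?A \<mu>' k)"] by simp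
    then have "Inf (?A \<mu>' k) \<le> 1" using s1 by (rule order_trans)
    then have "Inf (?A \<mu>' k) < Inf (?A \<mu>' k) + ennreal ((1/2) ^ Suc k)" by (rule less)
    then obtain a where "a \<in> ?A \<mu>' k" "a < Inf (?A \<mu>' k) + ennreal ((1/2) ^ Suc k)"
      unfolding Inf_less_iff by blast
    then show ?thesis by (auto intro: less_imp_le)
  qed
  then have "\<forall>k. \<exists>l. 0 < l \<and> (\<integral>\<^sup>+x. ennreal ((norm (F k x) / (\<mu>' * l powr (1 / q x))) powr p x) \<partial>lborel) \<le> 1 \<and>
      ennreal l \<le> Inf (?A \<mu>' k) + ennreal ((1/2) ^ Suc k)" by (rule allI)
  from choice[OF this] obtain lam where
    lam: "\<forall>k. 0 < lam k \<and> (\<integral>\<^sup>+x. ennreal ((norm (F k x) / (\<mu>' * lam k powr (1 / q x))) powr p x) \<partial>lborel) \<le> 1 \<and>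
      ennreal (lam k) \<le> Inf (?A \<mu>' k) + ennreal ((1/2) ^ Suc k)" ..
  note l = lam[rule_format]
  have l0: "0 < lam k" for k by (rule conjunct1[OF l])
  have li: "(\<integral>\<^sup>+x. ennreal ((norm (F k x) / (\<mu>' * lam k powr (1 / q x))) powr p x) \<partial>lborel) \<le> 1" for k
    by (rule conjunct1[OF conjunct2[OF l]])
  have ll: "ennreal (lam k) \<le> Inf (?A \<mu>' k) + ennreal ((1/2) ^ Suc k)" for k
    by (rule conjunct2[OF conjunct2[OF l]])
  have "(\<integral>\<^sup>+x. ennreal ((norm (F k x) / (\<mu> * lam k powr (1 / q x))) powr p x) \<partial>lborel) \<le> 1" for k
  proof (rule order_trans[OF nn_integral_mono li[of k]])
    fix x
    have "norm (F k x) / (\<mu> * lam k powr (1 / q x)) \<le> norm (F k x) / (\<mu>' * lam k powr (1 / q x))"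
      using \<mu>\<mu> \<mu>'(1) l0[of k] by (intro divide_left_mono mult_right_mono mult_pos_pos) auto
    then show "ennreal ((norm (F k x) / (\<mu> * lam k powr (1 / q x))) powr p x)
       \<le> ennreal ((norm (F k x) / (\<mu>' * lam k powr (1 / q x))) powr p x)"
      using p[of x] \<mu>\<mu> \<mu>'(1) by (intro ennreal_leI powr_mono2) auto
  qed
  moreover have "(\<Sum>k. ennreal (lam k)) \<le> 2"
  proof -
    have "(\<Sum>k. ennreal (lam k)) \<le> (\<Sum>k. Inf (?A \<mu>' k) + ennreal ((1/2) ^ Suc k))"
      by (intro suminf_le ll) auto
    also have "\<dots> = (\<Sum>k. Inf (?A \<mu>' k)) + (\<Sum>k. ennreal ((1/2) ^ Suc k))"
      by (rule suminf_add[symmetric]) auto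
    also have "(\<Sum>k. ennreal ((1/2) ^ Suc k)) = ennreal (\<Sum>k. (1/2) ^ Suc k)"
      by (rule suminf_ennreal2) (auto intro: sums_summable[OF power_half_series])
    also have "\<dots> = 1" using sums_unique[OF power_half_series] by simp
    also have "(\<Sum>k. Inf (?A \<mu>' k)) + 1 \<le> 1 + 1" by (rule add_right_mono[OF s1])
    also have "(1 :: ennreal) + 1 = 2" by (rule one_add_one)
    finally show ?thesis .
  qed
  ultimately show ?thesis using l0 by blast
qed

lemma mixed_norm_leI:
  assumes \<mu>: "0 < \<mu>" and l: "\<And>k. 0 < lam k" and s: "(\<Sum>k. ennreal (lam k)) \<le> 1"
    and i: "\<And>k. (\<integral>\<^sup>+x. ennreal ((norm (F k x) / (\<mu> * lam k powr (1 / q x))) powr p x) \<partial>lborel) \<le> 1"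
  shows "mixed_norm p q F \<le> ennreal \<mu>"
  unfolding mixed_norm_def
proof (rule Inf_lower, rule CollectI, rule exI[of _ \<mu>], intro conjI refl \<mu>)
  have "(\<Sum>k. Inf {ennreal lam | lam. 0 < lam \<and>
      (\<integral>\<^sup>+x. ennreal ((norm (F k x) / (\<mu> * lam powr (1 / q x))) powr p x) \<partial>lborel) \<le> 1}) \<le> (\<Sum>k. ennreal (lam k))"
    by (intro suminf_le Inf_lower) (use l i in auto)
  also note s
  finally show "(\<Sum>k. Inf {ennreal lam | lam. 0 < lam \<and>
      (\<integral>\<^sup>+x. ennreal ((norm (F k x) / (\<mu> * lam powr (1 / q x))) powr p x) \<partial>lborel) \<le> 1}) \<le> 1" .
qed

lemma P0_log_bounded:
  assumes "P0_log p" shows "\<exists>B. \<forall>x. 1 / p x \<le> B"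
proof -
  obtain c l where c: "\<And>x. \<bar>1 / p x - l\<bar> \<le> c / ln (exp 1 + norm x)"
    using assms unfolding P0_log_def C_log_def by blast
  have "1 / p x \<le> l + \<bar>c\<bar>" for x
  proof -
    have "ln (exp 1) \<le> ln (exp 1 + norm x)" by (subst ln_le_cancel_iff) (auto simp: add_pos_nonneg)
    then have L: "1 \<le> ln (exp 1 + norm x)" by simp
    have "c / ln (exp 1 + norm x) \<le> \<bar>c\<bar> / ln (exp 1 + norm x)" using L by (intro divide_right_mono) auto
    also have "\<dots> \<le> \<bar>c\<bar> / 1" using L by (intro divide_left_mono) auto
    finally show ?thesis using c[of x] by linarith
  qed
  then show ?thesis by blast
qed

text \<open>A point below the bound would have a whole ball of such points around it, and a ball is
  not a null set.\<close>

lemma continuous_ess_inf_pos: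
  fixes h :: "'a::euclidean_space \<Rightarrow> real"
  assumes c: "continuous_on UNIV h" and pos: "ess_inf h > 0"
  shows "\<exists>m>0. \<forall>x. m \<le> h x"
proof -
  obtain b where b: "0 < b" "AE x in lborel. b \<le> ereal (h x)"
    using pos unfolding ess_inf_def less_Sup_iff by auto
  obtain m where m: "0 < ereal m" "ereal m < b" using ereal_dense2[OF b(1)] by auto
  have ae: "AE x in lborel. m \<le> h x"
    using b(2)
  proof eventually_elim
    case (elim x)
    from order_trans[OF less_imp_le[OF m(2)] this] show ?case by simp
  qed
  have "m \<le> h x" for x
  proof (rule ccontr)
    assume "\<not> m \<le> h x"
    then have "x \<in> h -` {..<m}" by simp
    moreover have "open (h -` {..<m})" by (intro open_vimage c open_lessThan)
    ultimately obtain e where e: "e > 0" "ball x e \<subseteq> h -` {..<m}" by (meson openE)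
    have "AE y in lborel. y \<notin> ball x e" using ae by eventually_elim (use e(2) in force)
    then have "emeasure lborel (ball x e) = 0"
      by (subst (asm) AE_iff_measurable[where N="ball x e"]) auto
    then show False using content_ball_pos[OF e(1), of x] by (simp add: measure_def)
  qed
  then show ?thesis using m(1) by (intro exI[of _ m]) simp
qed

text \<open>\<open>D\<close> is the discrete convolution of the weights \<open>L\<close> with an
  inverse power of the lattice distance, plus \<open>e\<close>. Keeping the single term of the cube
  \<open>y\<close> gives the first claim; exchanging the two sums and using the bound 2 for each
  cube gives the last.\<close>

lemma cube_weights:
  fixes L :: "'a::euclidean_space \<Rightarrow> nat \<Rightarrow> real" and z :: 'a
  assumes L: "\<And>y k. y \<in> ivecs \<Longrightarrow> 0 < L y k" and sL: "\<And>y. y \<in> ivecs \<Longrightarrow> (\<Sum>k. ennreal (L y k)) \<le> 2"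
    and z: "z \<in> ivecs" and e: "\<And>k. 0 \<le> e k" and sm: "(\<Sum>k. ennreal (e k)) \<le> ennreal G" and G: "0 \<le> G"
  defines "D \<equiv> \<lambda>k. (\<Sum>j. L (ivec j) k * (1 / wt (ivec j - z) ^ (2 * DIM('a)))) + e k"
  shows "y \<in> ivecs \<Longrightarrow> L y k \<le> D k * wt (y - z) ^ (2 * DIM('a))" and "e k \<le> D k"
    and "(\<Sum>k. ennreal (D k)) \<le> ennreal (2 * (\<Sum>k. 1 / wt (ivec k :: 'a) ^ (2 * DIM('a))) + G)"
proof -
  let ?N = "2 * DIM('a)"
  have L2: "L y k \<le> 2" if "y \<in> ivecs" for y k
  proof -
    have "ennreal (L y k) \<le> (\<Sum>k. ennreal (L y k))"
      using sum_le_suminf[OF summableI, of "{k}" "\<lambda>k. ennreal (L y k)"] by simp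
    then have "ennreal (L y k) \<le> ennreal 2" using sL[OF that] by simp
    then show ?thesis by (subst (asm) ennreal_le_iff) auto
  qed
  have sz: "summable (\<lambda>j. 1 / wt (ivec j - z) ^ ?N)"
  proof (rule summable_comparison_test[OF _ summable_mult[OF summable_wt[where 'a='a], of "wt (- z) ^ ?N"]], intro exI allI impI)
    fix j
    show "norm (1 / wt (ivec j - z) ^ ?N) \<le> wt (- z) ^ ?N * (1 / wt (ivec j :: 'a) ^ ?N)"
      using inverse_wt_shift[of "- z" "ivec j" ?N] by (simp add: wt_nonneg)
  qed
  have t0: "0 \<le> L (ivec j) k * (1 / wt (ivec j - z) ^ ?N)" for j k
    using L[of "ivec j" k] by (simp add: wt_nonneg)
  have sk: "summable (\<lambda>j. L (ivec j) k * (1 / wt (ivec j - z) ^ ?N))" for k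
  proof (rule summable_comparison_test[OF _ summable_mult[OF sz, of 2]], intro exI allI impI)
    fix j
    have "L (ivec j) k * (1 / wt (ivec j - z) ^ ?N) \<le> 2 * (1 / wt (ivec j - z) ^ ?N)"
      by (rule mult_right_mono[OF L2]) (auto simp: wt_nonneg)
    then show "norm (L (ivec j) k * (1 / wt (ivec j - z) ^ ?N)) \<le> 2 * (1 / wt (ivec j - z) ^ ?N)"
      using t0[of j k] by (simp only: real_norm_def abs_of_nonneg)
  qed
  have s0: "0 \<le> (\<Sum>j. L (ivec j) k * (1 / wt (ivec j - z) ^ ?N))" for k by (rule suminf_nonneg[OF sk t0])
  show "e k \<le> D k" unfolding D_def using s0[of k] by simp
  show "L y k \<le> D k * wt (y - z) ^ ?N" if y: "y \<in> ivecs"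
  proof -
    obtain j where j: "ivec j = y" using ivec_surj[OF y] by blast
    have "(\<Sum>j\<in>{j}. L (ivec j) k * (1 / wt (ivec j - z) ^ ?N)) \<le> (\<Sum>j. L (ivec j) k * (1 / wt (ivec j - z) ^ ?N))"
      by (rule sum_le_suminf[OF sk]) (use t0 in auto)
    then have "L y k * (1 / wt (y - z) ^ ?N) \<le> D k" unfolding D_def using e[of k] j by simp
    then have "L y k / wt (y - z) ^ ?N \<le> D k" by simp
    then show ?thesis using wt_pos[of "y - z"] by (simp only: pos_divide_le_eq zero_less_power)
  qed
  have "(\<Sum>k. \<Sum>j. ennreal (L (ivec j) k * (1 / wt (ivec j - z) ^ ?N))) = (\<Sum>j. \<Sum>k. ennreal (L (ivec j) k * (1 / wt (ivec j - z) ^ ?N)))"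
    unfolding nn_integral_count_space_nat[symmetric, of "\<lambda>k. \<Sum>j. ennreal (L (ivec j) k * (1 / wt (ivec j - z) ^ ?N))"]
    by (subst nn_integral_suminf) (auto simp: nn_integral_count_space_nat)
  also have "\<dots> \<le> (\<Sum>j. 2 * ennreal (1 / wt (ivec j - z) ^ ?N))"
  proof (rule suminf_le)
    fix j
    have "(\<Sum>k. ennreal (L (ivec j) k * (1 / wt (ivec j - z) ^ ?N))) = (\<Sum>k. ennreal (L (ivec j) k) * ennreal (1 / wt (ivec j - z) ^ ?N))"
      using L[of "ivec j"] by (intro suminf_cong ennreal_mult) (auto simp: less_imp_le wt_nonneg)
    also have "\<dots> = (\<Sum>k. ennreal (L (ivec j) k)) * ennreal (1 / wt (ivec j - z) ^ ?N)" by simp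
    also have "\<dots> \<le> 2 * ennreal (1 / wt (ivec j - z) ^ ?N)" by (intro mult_right_mono sL) auto
    finally show "(\<Sum>k. ennreal (L (ivec j) k * (1 / wt (ivec j - z) ^ ?N))) \<le> 2 * ennreal (1 / wt (ivec j - z) ^ ?N)" .
  qed auto
  also have "\<dots> = ennreal 2 * ennreal (\<Sum>k. 1 / wt (ivec k :: 'a) ^ ?N)"
    by (simp only: ennreal_suminf_cmult sum_inverse_wt[OF z] ennreal_numeral)
  also have "\<dots> = ennreal (2 * (\<Sum>k. 1 / wt (ivec k :: 'a) ^ ?N))"
    by (rule ennreal_mult[symmetric]) (auto intro!: suminf_nonneg summable_wt simp: wt_nonneg)
  finally have double: "(\<Sum>k. \<Sum>j. ennreal (L (ivec j) k * (1 / wt (ivec j - z) ^ ?N))) \<le> ennreal (2 * (\<Sum>k. 1 / wt (ivec k :: 'a) ^ ?N))" .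
  have "(\<Sum>k. ennreal (D k)) = (\<Sum>k. (\<Sum>j. ennreal (L (ivec j) k * (1 / wt (ivec j - z) ^ ?N))) + ennreal (e k))"
    unfolding D_def by (intro suminf_cong) (subst suminf_ennreal2[OF t0 sk], rule ennreal_plus[OF s0 e])
  also have "\<dots> = (\<Sum>k. \<Sum>j. ennreal (L (ivec j) k * (1 / wt (ivec j - z) ^ ?N))) + (\<Sum>k. ennreal (e k))"
    by (rule suminf_add[symmetric]) auto
  also have "\<dots> \<le> ennreal (2 * (\<Sum>k. 1 / wt (ivec k :: 'a) ^ ?N)) + ennreal G"
    by (rule add_mono[OF double sm])
  also have "\<dots> = ennreal (2 * (\<Sum>k. 1 / wt (ivec k :: 'a) ^ ?N) + G)"
    by (rule ennreal_plus[symmetric]) (auto intro!: mult_nonneg_nonneg suminf_nonneg summable_wt simp: wt_nonneg G)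
  finally show "(\<Sum>k. ennreal (D k)) \<le> ennreal (2 * (\<Sum>k. 1 / wt (ivec k :: 'a) ^ ?N) + G)" .
qed

section \<open>Passing from the exponent \<open>p0\<close> to \<open>p1\<close>\<close>

text \<open>Split \<open>G powr (1 / i1)\<close> as \<open>G powr (1 / i0)\<close> times
  \<open>G powr d\<close> with \<open>d = 1 / i1 - 1 / i0\<close>. The bound on \<open>G\<close>
  applied to the second factor is cancelled exactly by the power of 2, because
  \<open>i0 * d + (i1 - i0) / i1 = 0\<close>.\<close>

lemma height_interpolation:
  fixes G W i0 i1 :: real
  assumes G: "0 \<le> G" "G \<le> 2 powr (W * i0)" and i: "0 < i1" "i1 < i0"
  shows "(G * 2 powr (W * (i1 - i0))) powr (1 / i1) \<le> G powr (1 / i0)"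
proof (cases "G = 0")
  case False
  then have G0: "0 < G" using G by simp
  define d where "d = 1 / i1 - 1 / i0"
  have d: "0 \<le> d" using i unfolding d_def by (simp add: frac_le)
  have "(G * 2 powr (W * (i1 - i0))) powr (1 / i1) = G powr (1 / i0) * (G powr d * 2 powr (W * (i1 - i0) * (1 / i1)))"
    using G0 by (simp add: powr_mult powr_powr powr_add[symmetric] d_def)
  also have "\<dots> \<le> G powr (1 / i0) * ((2 powr (W * i0)) powr d * 2 powr (W * (i1 - i0) * (1 / i1)))"
    using G d by (intro mult_left_mono mult_right_mono powr_mono2) auto
  also have "(2 powr (W * i0)) powr d * 2 powr (W * (i1 - i0) * (1 / i1)) = 2 powr (W * (i0 * d + (i1 - i0) / i1))"
    by (simp add: powr_powr powr_add[symmetric] distrib_left mult.assoc)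
  also have "i0 * d + (i1 - i0) / i1 = 0" unfolding d_def using i by (simp add: field_simps)
  finally show ?thesis by simp
qed simp

lemma dyadic_cube_eq_cube:
  "dyadic_cube v m = cube (2 powr v) (\<Sum>i\<in>Basis. of_int (m i) *\<^sub>R i :: 'a::euclidean_space)"
proof -
  have "x \<in> dyadic_cube v m \<longleftrightarrow> (\<forall>i\<in>Basis. \<lfloor>2 powr v * (x \<bullet> i)\<rfloor> = m i)" for x :: 'a
    unfolding dyadic_cube_def by (auto simp: floor_eq_iff)
  moreover have "x \<in> cube (2 powr v) (\<Sum>i\<in>Basis. of_int (m i) *\<^sub>R i) \<longleftrightarrow> (\<forall>i\<in>Basis. \<lfloor>2 powr v * (x \<bullet> i)\<rfloor> = m i)" for x :: 'a
    unfolding cube_def by (simp add: euclidean_eq_iff[where 'a='a] vfloor_inner)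
  ultimately show ?thesis by blast
qed

lemma dyadic_index_in: "(\<Sum>i\<in>Basis. of_int (m i) *\<^sub>R i :: 'a::euclidean_space) \<in> ivecs"
  by (simp add: ivecs_def)

lemma dyadic_index_floor: "z \<in> ivecs \<Longrightarrow> (\<Sum>i\<in>Basis. of_int \<lfloor>z \<bullet> i\<rfloor> *\<^sub>R i :: 'a::euclidean_space) = z"
  by (rule euclidean_eqI) (auto simp: ivecs_def Ints_def)

lemma sampled_conv:
  assumes adm: "admissible_pair Phi phi" and f: "tempered f"
  shows "sampled (2 powr real w) (conv (phi_seq Phi phi w) f)"
proof (cases "w = 0")
  case True
  have "sampled 1 (\<lambda>x. f (\<lambda>y. 1 * Phi (1 *\<^sub>R (x - y))))"
    by (rule tempered_sampled[OF f]) (use adm in \<open>auto simp: admissible_pair_def\<close>)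
  then show ?thesis using True by (simp add: conv_def[abs_def] phi_seq_def)
next
  case False
  have "closure {\<xi>. fourier phi \<xi> \<noteq> 0} \<subseteq> cball 0 2" "schwartz phi"
    using adm by (auto simp: admissible_pair_def)
  then have "sampled (2 ^ w) (\<lambda>x. f (\<lambda>y. of_real (2 ^ (w * DIM('a))) * phi (2 ^ w *\<^sub>R (x - y))))"
    by (intro tempered_sampled[OF f]) auto
  then show ?thesis using False by (simp add: conv_def[abs_def] phi_seq_def powr_realpow)
qed

text \<open>The relation between the smoothness and integrability exponents turns the change from
  \<open>\<alpha>0\<close> to \<open>\<alpha>1\<close> into the factor
  \<open>2 powr (w * DIM('a) * (i1 - i0))\<close>, the one needed for
  \<open>height_interpolation\<close> applied to the height divided by \<open>d\<close>.\<close>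

lemma weighted_pointwise:
  fixes x :: "'a::euclidean_space" and w v i0 i1 iq D L S Bq C \<mu> :: real
  assumes H: "height w v \<alpha>0 \<tau> g x \<le> C * \<mu> * 2 powr (w * DIM('a) * i0) * D powr iq"
    and pos: "0 < \<mu>" "1 \<le> C" "0 < L" "L \<le> D" "1 \<le> S"
    and iq: "0 < iq" "iq \<le> Bq" and i: "0 < i1" "i1 < i0"
    and eq: "\<alpha>0 x - DIM('a) * i0 = \<alpha>1 x - DIM('a) * i1"
  shows "(height w v \<alpha>1 \<tau> g x / ((C * S powr Bq * \<mu>) * (D / S) powr iq)) powr (1 / i1)
    \<le> (height w v \<alpha>0 \<tau> g x / (\<mu> * L powr iq)) powr (1 / i0)"
proof -
  let ?H = "height w v \<alpha>0 \<tau> g x"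
  define d where "d = C * \<mu> * D powr iq"
  have D: "0 < D" using pos by linarith
  have d0: "0 < d" unfolding d_def using pos D by simp
  have H0: "0 \<le> ?H" by (simp add: height_def)
  define G where "G = ?H / d"
  have G0: "0 \<le> G" unfolding G_def using H0 d0 by simp
  have "?H \<le> 2 powr ((w * DIM('a)) * i0) * d" using H unfolding d_def by (simp only: mult_ac)
  then have G1: "G \<le> 2 powr ((w * DIM('a)) * i0)" unfolding G_def using d0 by (simp only: pos_divide_le_eq)
  have "\<alpha>1 x = \<alpha>0 x + DIM('a) * (i1 - i0)" using eq unfolding right_diff_distrib by linarith
  then have "w * \<alpha>1 x = w * \<alpha>0 x + (w * DIM('a)) * (i1 - i0)"
    by (simp only: distrib_left mult.assoc)
  then have H1: "height w v \<alpha>1 \<tau> g x = ?H * 2 powr ((w * DIM('a)) * (i1 - i0))"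
    unfolding height_def by (simp only: powr_add mult_ac)
  \<comment> \<open>The factor \<open>S powr Bq\<close> compensates, for every value of
    \<open>iq\<close>, the division of \<open>D\<close> by \<open>S\<close> that normalises the sum
    of the weights.\<close>
  have le: "d \<le> (C * S powr Bq * \<mu>) * (D / S) powr iq"
  proof -
    have "S powr iq \<le> S powr Bq" using pos iq by (intro powr_mono) auto
    then have "1 \<le> S powr Bq / S powr iq" using pos by (simp add: pos_le_divide_eq)
    then have "d * 1 \<le> d * (S powr Bq / S powr iq)" using d0 by (intro mult_left_mono) auto
    also have "\<dots> = (C * S powr Bq * \<mu>) * (D / S) powr iq"
      unfolding d_def using D pos by (simp add: powr_divide)
    finally show ?thesis by simp
  qed
  have "height w v \<alpha>1 \<tau> g x / ((C * S powr Bq * \<mu>) * (D / S) powr iq) \<le> height w v \<alpha>1 \<tau> g x / d"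
    by (rule divide_left_mono[OF le _ mult_pos_pos[OF order_less_le_trans[OF d0 le] d0]]) (simp add: height_def)
  also have "\<dots> = G * 2 powr ((w * DIM('a)) * (i1 - i0))" unfolding H1 G_def by simp
  finally have "(height w v \<alpha>1 \<tau> g x / ((C * S powr Bq * \<mu>) * (D / S) powr iq)) powr (1 / i1)
      \<le> (G * 2 powr ((w * DIM('a)) * (i1 - i0))) powr (1 / i1)"
    using i order_trans[OF less_imp_le[OF d0] le] by (intro powr_mono2) (auto simp: height_def)
  also have "\<dots> \<le> G powr (1 / i0)" by (rule height_interpolation[OF G0 G1 i])
  also have "\<dots> \<le> (?H / (\<mu> * L powr iq)) powr (1 / i0)"
  proof (rule powr_mono2)
    have "\<mu> * L powr iq \<le> d"
    proof -
      have "L powr iq \<le> D powr iq" using pos iq by (intro powr_mono2) auto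
      then have "1 * (\<mu> * L powr iq) \<le> C * (\<mu> * D powr iq)" using pos by (intro mult_mono) auto
      then show ?thesis unfolding d_def by (simp only: mult_1 mult.assoc)
    qed
    then show "G \<le> ?H / (\<mu> * L powr iq)" unfolding G_def
      using pos d0 H0 by (intro divide_left_mono mult_pos_pos) auto
  qed (use i G0 in auto)
  finally show ?thesis .
qed

lemma suminf_powr_le:
  assumes e: "0 < (\<epsilon> :: real)"
  shows "(\<Sum>k. ennreal (2 powr (- \<epsilon> * real (a + k)))) \<le> ennreal (1 / (1 - 2 powr (- \<epsilon>)))"
proof -
  have r: "2 powr (- \<epsilon>) < 1" using e by (simp add: powr_less_one)
  have "(\<Sum>k. ennreal (2 powr (- \<epsilon> * real (a + k)))) \<le> (\<Sum>k. ennreal ((2 powr (- \<epsilon>)) ^ k))"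
  proof (intro suminf_le ennreal_leI)
    fix k
    have "2 powr (- \<epsilon> * real (a + k)) \<le> 2 powr (- \<epsilon> * real k)" using e by (intro powr_mono) auto
    also have "\<dots> = (2 powr (- \<epsilon>)) ^ k" by (simp add: powr_realpow[symmetric] powr_powr)
    finally show "2 powr (- \<epsilon> * real (a + k)) \<le> (2 powr (- \<epsilon>)) ^ k" .
  qed auto
  also have "\<dots> = ennreal (\<Sum>k. (2 powr (- \<epsilon>)) ^ k)"
    using r by (intro suminf_ennreal2 summable_geometric) auto
  also have "(\<Sum>k. (2 powr (- \<epsilon>)) ^ k) = 1 / (1 - 2 powr (- \<epsilon>))"
    using r by (intro suminf_geometric) auto
  finally show ?thesis .
qed

section \<open>The embedding\<close>

theorem theorem4p2:
  fixes \<alpha>0 \<alpha>1 \<tau> p0 p1 q :: "'a::euclidean_space \<Rightarrow> real"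
    and Phi phi :: "'a \<Rightarrow> complex"
  assumes adm: "admissible_pair Phi phi"
    and a0: "C_log_loc \<alpha>0" and a1: "C_log_loc \<alpha>1"
    and tau: "C_log_loc \<tau>" "\<forall>x. 0 \<le> \<tau> x" "ess_inf \<tau> > 0"
    and p0: "P0_log p0" and p1: "P0_log p1" and q: "P0_log q" "ess_sup q < \<infinity>"
    and gt: "\<forall>x. \<alpha>0 x > \<alpha>1 x"
    and eq: "\<forall>x. \<alpha>0 x - real DIM('a) / p0 x = \<alpha>1 x - real DIM('a) / p1 x"
    and ratio: "ess_inf (\<lambda>x. p0 x / p1 x) < 1"
  shows "\<exists>c>0. \<forall>f \<in> besov_space Phi phi \<alpha>0 \<tau> p0 q.
           f \<in> besov_space Phi phi \<alpha>1 \<tau> p1 q \<and>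
           besov_norm Phi phi \<alpha>1 \<tau> p1 q f \<le> ennreal c * besov_norm Phi phi \<alpha>0 \<tau> p0 q f"
proof -
  let ?n = "real DIM('a)" and ?N = "2 * DIM('a)"
  have pos: "0 < p0 x" "0 < p1 x" "0 < q x" for x
    using p0 p1 q(1) unfolding P0_log_def P0_def by blast+
  define i0 where "i0 x = 1 / p0 x" for x
  define i1 where "i1 x = 1 / p1 x" for x
  define iq where "iq x = 1 / q x" for x
  have ipos: "0 < i0 x" "0 < i1 x" "0 < iq x" for x
    unfolding i0_def i1_def iq_def using pos[of x] by auto
  have inv: "1 / i0 x = p0 x" "1 / i1 x = p1 x" "1 / q x = iq x" for x by (simp_all add: i0_def i1_def iq_def)
  have li: "C_log_loc i0" "C_log_loc iq"
    using p0 q(1) unfolding P0_log_def C_log_def i0_def[abs_def] iq_def[abs_def] by blast+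
  from P0_log_bounded[OF p0] obtain B0 where "\<forall>x. 1 / p0 x \<le> B0" ..
  then have B0: "i0 x \<le> B0" for x unfolding i0_def by (rule spec)
  from P0_log_bounded[OF q(1)] obtain Bq where "\<forall>x. 1 / q x \<le> Bq" ..
  then have Bq: "iq x \<le> Bq" for x unfolding iq_def by (rule spec)
  have Bq0: "0 < Bq" by (rule order_less_le_trans[OF ipos(3) Bq])
  have e: "\<alpha>0 x - ?n * i0 x = \<alpha>1 x - ?n * i1 x" for x
    using eq[rule_format, of x] by (simp add: i0_def i1_def)
  have i10: "i1 x < i0 x" for x
  proof -
    have "?n * i1 x < ?n * i0 x" using e[of x] gt[rule_format, of x] by linarith
    then show ?thesis by simp
  qed
  from continuous_ess_inf_pos[OF C_log_loc_continuous[OF tau(1)] tau(3)]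
  obtain m\<tau> where m\<tau>: "0 < m\<tau>" "\<And>x. m\<tau> \<le> \<tau> x" by auto
  \<comment> \<open>The bound 1 gives \<open>2^(-w) \<le> D\<close>, as \<open>sup_bound\<close>
    demands; the other makes \<open>|P|^(-\<tau>)\<close> at most
    \<open>2^(-\<epsilon> k iq)\<close> when \<open>P\<close> has side at least
    \<open>2^k\<close>.\<close>
  define \<epsilon> where "\<epsilon> = min 1 (?n * m\<tau> / Bq)"
  have \<epsilon>0: "0 < \<epsilon>" unfolding \<epsilon>_def using m\<tau>(1) Bq0 by simp
  have \<epsilon>1: "\<epsilon> \<le> 1" by (simp add: \<epsilon>_def)
  have \<epsilon>B: "\<epsilon> * Bq \<le> ?n * m\<tau>"
  proof -
    have "\<epsilon> * Bq \<le> (?n * m\<tau> / Bq) * Bq" unfolding \<epsilon>_def using Bq0 by (intro mult_right_mono) auto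
    then show ?thesis using Bq0 by simp
  qed
  define S0 where "S0 = (\<Sum>k. 1 / wt (ivec k :: 'a) ^ ?N)"
  define G where "G = 1 / (1 - 2 powr (- \<epsilon>))"
  have S0: "0 \<le> S0" unfolding S0_def by (intro suminf_nonneg summable_wt) (auto simp: wt_nonneg)
  have G0: "0 \<le> G" unfolding G_def using \<epsilon>0 by (simp add: powr_less_one less_imp_le)
  \<comment> \<open>The bound from \<open>cube_weights\<close> for the sum of the \<open>D\<close>,
    enlarged by 1 so that \<open>S\<close> is at least 1.\<close>
  define S where "S = 2 * S0 + G + 1"
  have S1: "1 \<le> S" using S0 G0 by (simp add: S_def)
  show ?thesis
  proof (rule sup_bound[OF a0 tau(1) li ipos(1) B0 ipos(3) Bq S1])
    fix C1
    assume C1: "1 \<le> C1"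
      and sup: "\<And>w v g lam \<mu> x D. \<bar>v\<bar> \<le> w \<Longrightarrow> sampled (2 powr w) g \<Longrightarrow> 0 < \<mu> \<Longrightarrow> (\<And>z. z \<in> ivecs \<Longrightarrow> 0 < lam z) \<Longrightarrow>
      2 powr (- w) \<le> D \<Longrightarrow> D \<le> S \<Longrightarrow>
      (\<And>z. z \<in> ivecs \<Longrightarrow> lam z \<le> D * wt (z - vfloor (2 powr v *\<^sub>R x)) ^ ?N) \<Longrightarrow>
      (\<And>z. z \<in> ivecs \<Longrightarrow> (\<integral>\<^sup>+y. ennreal ((height w v \<alpha>0 \<tau> g y / (\<mu> * lam z powr iq y)) powr (1 / i0 y)) * indicator (cube (2 powr v) z) y \<partial>lborel) \<le> 1) \<Longrightarrow>
      height w v \<alpha>0 \<tau> g x \<le> C1 * \<mu> * 2 powr (w * DIM('a) * i0 x) * D powr iq x"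
    \<comment> \<open>This \<open>S powr Bq\<close> serves the large cubes, where the
      \<open>D\<close> of a unit cube is only known to be at most \<open>S\<close>; the one in
      \<open>C\<close> below pays for normalising \<open>D\<close> to \<open>D / S\<close>.\<close>
    define C2 where "C2 = C1 * S powr Bq"
    have SB: "1 \<le> S powr Bq" using S1 Bq0 by (simp add: ge_one_powr_ge_zero)
    have C12: "C1 \<le> C2" unfolding C2_def using C1 SB mult_left_mono[of 1 "S powr Bq" C1] by simp
    define C where "C = C2 * S powr Bq"
    have C2: "1 \<le> C2" using C1 C12 by linarith
    have C0: "0 < C" unfolding C_def using C2 SB by (intro mult_pos_pos) linarith+
    have main: "besov_norm Phi phi \<alpha>1 \<tau> p1 q f \<le> ennreal (C * \<mu>)"
      if f: "tempered f" and \<mu>: "0 < \<mu>" and less: "besov_norm Phi phi \<alpha>0 \<tau> p0 q f < ennreal \<mu>" for f \<mu>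
    proof -
      define wn where "wn v k = nat (max v 0) + k" for v :: int and k
      define g where "g w = conv (phi_seq Phi phi w) f" for w
      have g: "sampled (2 powr real w) (g w)" for w unfolding g_def by (rule sampled_conv[OF adm f])
      define F where "F \<alpha> vm k x = of_real (2 powr (real (wn (fst vm) k) * \<alpha> x)) * g (wn (fst vm) k) x
             * of_real ((2 powr (- real_of_int (fst vm) * real DIM('a))) powr (- \<tau> x))
             * indicator (dyadic_cube (fst vm) (snd vm)) x" for \<alpha> and vm :: "int \<times> ('a \<Rightarrow> int)" and k and x :: 'a
      have bn: "besov_norm Phi phi \<alpha> \<tau> p q f = (SUP vm\<in>UNIV. mixed_norm p q (F \<alpha> vm))" for \<alpha> p
        unfolding besov_norm_def F_def[abs_def] g_def wn_def Let_def ..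
      have nF: "norm (F \<alpha> (v, m) k x) = height (real (wn v k)) (real_of_int v) \<alpha> \<tau> (g (wn v k)) x * indicator (dyadic_cube v m) x" for \<alpha> v m k x
        unfolding F_def height_def by (simp add: norm_mult powr_powr indicator_def)
      have "mixed_norm p0 q (F \<alpha>0 vm) < ennreal \<mu>" for vm
        using less unfolding bn by (rule le_less_trans[rotated]) (rule SUP_upper, simp)
      from mixed_norm_lessD[OF this pos(1)]
      have "\<forall>vm. \<exists>lam. (\<forall>k. 0 < lam k \<and>
         (\<integral>\<^sup>+x. ennreal ((norm (F \<alpha>0 vm k x) / (\<mu> * lam k powr (1 / q x))) powr p0 x) \<partial>lborel) \<le> 1) \<and>
         (\<Sum>k. ennreal (lam k)) \<le> 2" by (rule allI)
      from choice[OF this] obtain lamf where lamf: "\<forall>vm. (\<forall>k. 0 < lamf vm k \<and>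
         (\<integral>\<^sup>+x. ennreal ((norm (F \<alpha>0 vm k x) / (\<mu> * lamf vm k powr (1 / q x))) powr p0 x) \<partial>lborel) \<le> 1) \<and>
         (\<Sum>k. ennreal (lamf vm k)) \<le> 2" ..
      \<comment> \<open>The witnesses are indexed by integer-valued functions, the cubes by lattice
        vectors; the floors translate from the latter to the former.\<close>
      define L where "L v z k = lamf (v, \<lambda>i. \<lfloor>z \<bullet> i\<rfloor>) k" for v :: int and z :: 'a and k
      have L0: "0 < L v z k" for v z k unfolding L_def using lamf by blast
      have L2: "(\<Sum>k. ennreal (L v z k)) \<le> 2" for v z unfolding L_def using lamf by blast
      have Lint: "(\<integral>\<^sup>+y. ennreal ((height (real (wn v k)) (real_of_int v) \<alpha>0 \<tau> (g (wn v k)) y / (\<mu> * L v z k powr iq y)) powr (1 / i0 y)) * indicator (cube (2 powr real_of_int v) z) y \<partial>lborel) \<le> 1"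
        if z: "z \<in> ivecs" for v z k
      proof -
        let ?m = "\<lambda>i. \<lfloor>z \<bullet> i\<rfloor>"
        have Q: "dyadic_cube v ?m = cube (2 powr real_of_int v) z"
          unfolding dyadic_cube_eq_cube dyadic_index_floor[OF z] ..
        have "ennreal ((height (real (wn v k)) (real_of_int v) \<alpha>0 \<tau> (g (wn v k)) y / (\<mu> * L v z k powr iq y)) powr (1 / i0 y)) * indicator (cube (2 powr real_of_int v) z) y
          = ennreal ((norm (F \<alpha>0 (v, ?m) k y) / (\<mu> * lamf (v, ?m) k powr (1 / q y))) powr p0 y)" for y
          unfolding nF Q L_def inv by (cases "y \<in> cube (2 powr real_of_int v) z") simp_all
        then have "(\<integral>\<^sup>+y. ennreal ((height (real (wn v k)) (real_of_int v) \<alpha>0 \<tau> (g (wn v k)) y / (\<mu> * L v z k powr iq y)) powr (1 / i0 y)) * indicator (cube (2 powr real_of_int v) z) y \<partial>lborel)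
          = (\<integral>\<^sup>+y. ennreal ((norm (F \<alpha>0 (v, ?m) k y) / (\<mu> * lamf (v, ?m) k powr (1 / q y))) powr p0 y) \<partial>lborel)"
          by (rule nn_integral_cong)
        also have "\<dots> \<le> 1" using lamf by blast
        finally show ?thesis .
      qed
      \<comment> \<open>All cubes of the same size contribute, since the sampling formula at a point
        of one cube sees the values on all the others.\<close>
      define D where "D v z k = (\<Sum>j. L v (ivec j) k * (1 / wt (ivec j - z) ^ ?N)) + 2 powr (- \<epsilon> * real (wn v k))" for v and z :: 'a and k
      have sG: "(\<Sum>k. ennreal (2 powr (- \<epsilon> * real (wn v k)))) \<le> ennreal G" for v
        unfolding wn_def G_def by (rule suminf_powr_le[OF \<epsilon>0])
      have DL: "L v y k \<le> D v z k * wt (y - z) ^ ?N" if "z \<in> ivecs" "y \<in> ivecs" for v z y k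
        unfolding D_def by (rule cube_weights(1)[where L="L v" and e="\<lambda>k. 2 powr (- \<epsilon> * real (wn v k))",
            OF L0 L2 that(1) powr_ge_zero sG G0 that(2)])
      have De: "2 powr (- \<epsilon> * real (wn v k)) \<le> D v z k" if "z \<in> ivecs" for v z k
        unfolding D_def by (rule cube_weights(2)[where L="L v" and e="\<lambda>k. 2 powr (- \<epsilon> * real (wn v k))",
            OF L0 L2 that powr_ge_zero sG G0])
      have Ds: "(\<Sum>k. ennreal (D v z k)) \<le> ennreal S" if "z \<in> ivecs" for v z
      proof -
        have "(\<Sum>k. ennreal (D v z k)) \<le> ennreal (2 * S0 + G)"
          unfolding D_def S0_def by (rule cube_weights(3)[where L="L v" and e="\<lambda>k. 2 powr (- \<epsilon> * real (wn v k))",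
              OF L0 L2 that powr_ge_zero sG G0])
        also have "\<dots> \<le> ennreal S" by (rule ennreal_leI) (simp add: S_def)
        finally show ?thesis .
      qed
      have D0: "0 < D v z k" if "z \<in> ivecs" for v z k by (rule order_less_le_trans[OF _ De[OF that]]) simp
      have DS: "D v z k \<le> S" if "z \<in> ivecs" for v z k
      proof -
        have "ennreal (D v z k) \<le> (\<Sum>k. ennreal (D v z k))"
          using sum_le_suminf[OF summableI, of "{k}" "\<lambda>k. ennreal (D v z k)"] by simp
        then have "ennreal (D v z k) \<le> ennreal S" using Ds[OF that] by (rule order_trans)
        then show ?thesis using S1 by (subst (asm) ennreal_le_iff) auto
      qed
      have bound1: "height (real (wn v k)) (real_of_int v) \<alpha>0 \<tau> (g (wn v k)) x \<le> C1 * \<mu> * 2 powr (real (wn v k) * DIM('a) * i0 x) * D v z k powr iq x"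
        if z: "z \<in> ivecs" and x: "x \<in> cube (2 powr real_of_int v) z" and vw: "\<bar>real_of_int v\<bar> \<le> real (wn v k)" for v z k x
      proof (rule sup[where lam="\<lambda>z. L v z k", OF vw g \<mu> L0 _ DS[OF z] _ Lint])
        have "2 powr (- real (wn v k)) \<le> 2 powr (- \<epsilon> * real (wn v k))"
          using \<epsilon>1 by (intro powr_mono) (auto simp: mult_left_le_one_le \<epsilon>0 less_imp_le)
        then show "2 powr (- real (wn v k)) \<le> D v z k" using De[OF z, of v k] by linarith
        fix y :: 'a assume "y \<in> ivecs"
        then show "L v y k \<le> D v z k * wt (y - vfloor (2 powr real_of_int v *\<^sub>R x)) ^ ?N"
          using DL[OF z] x by (simp add: cube_def)
      qed
      have bound2: "height (real (wn v k)) (real_of_int v) \<alpha>0 \<tau> (g (wn v k)) x \<le> C2 * \<mu> * 2 powr (real (wn v k) * DIM('a) * i0 x) * D v z k powr iq x"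
        if z: "z \<in> ivecs" and x: "x \<in> cube (2 powr real_of_int v) z" for v z k x
      proof (cases "\<bar>real_of_int v\<bar> \<le> real (wn v k)")
        case True
        show ?thesis
          by (rule order_trans[OF bound1[OF z x True]]) (intro mult_right_mono C12, use \<mu> in auto)
      next
        case False
        \<comment> \<open>For \<open>v \<ge> 0\<close> the level is at least \<open>v\<close>, so
          only cubes of side larger than \<open>2^k\<close> remain. The bound is taken from the unit
          cube containing \<open>x\<close>, where the size factor is 1, and
          \<open>D powr iq x\<close> is recovered from \<open>|P|^(-\<tau>)\<close>.\<close>
        then have v: "v < 0" and wk: "wn v k = k" and kv: "real k \<le> - real_of_int v" by (auto simp: wn_def)
        have w0: "wn 0 k = k" by (simp add: wn_def)
        let ?z = "vfloor x" and ?P = "2 powr (real k * DIM('a) * i0 x)"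
        have "height (real k) 0 \<alpha>0 \<tau> (g k) x \<le> C1 * \<mu> * ?P * D 0 ?z k powr iq x"
          using bound1[of ?z x 0 k] by (simp add: w0 vfloor_in cube_def)
        also have "\<dots> \<le> C1 * \<mu> * ?P * S powr Bq"
        proof (intro mult_left_mono)
          have "D 0 ?z k powr iq x \<le> S powr iq x"
            using D0[OF vfloor_in] DS[OF vfloor_in] ipos(3)[of x] by (intro powr_mono2) (auto simp: less_imp_le)
          also have "\<dots> \<le> S powr Bq" using S1 Bq by (intro powr_mono)
          finally show "D 0 ?z k powr iq x \<le> S powr Bq" .
        qed (use C1 \<mu> in auto)
        finally have h0: "height (real k) 0 \<alpha>0 \<tau> (g k) x \<le> C2 * \<mu> * ?P" unfolding C2_def by (simp only: mult_ac)
        have t: "2 powr (real_of_int v * ?n * \<tau> x) \<le> D v z k powr iq x"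
        proof -
          have "\<epsilon> * iq x \<le> ?n * \<tau> x"
          proof -
            have "\<epsilon> * iq x \<le> \<epsilon> * Bq" using \<epsilon>0 Bq by (intro mult_left_mono) auto
            also have "\<dots> \<le> ?n * m\<tau>" by (rule \<epsilon>B)
            also have "\<dots> \<le> ?n * \<tau> x" using m\<tau>(2) by (intro mult_left_mono) auto
            finally show ?thesis .
          qed
          then have "real k * (\<epsilon> * iq x) \<le> - real_of_int v * (?n * \<tau> x)"
            by (rule mult_mono[OF kv]) (use \<epsilon>0 ipos(3)[of x] v in auto)
          then have "2 powr (real_of_int v * ?n * \<tau> x) \<le> 2 powr ((- \<epsilon> * real k) * iq x)"
            by (intro powr_mono) (auto simp: mult_ac)
          also have "\<dots> = (2 powr (- \<epsilon> * real k)) powr iq x" by (rule powr_powr[symmetric])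
          also have "\<dots> \<le> D v z k powr iq x"
            using De[OF z, of v k] ipos(3)[of x] unfolding wk by (intro powr_mono2) auto
          finally show ?thesis .
        qed
        have "height (real k) (real_of_int v) \<alpha>0 \<tau> (g k) x = height (real k) 0 \<alpha>0 \<tau> (g k) x * 2 powr (real_of_int v * ?n * \<tau> x)"
          unfolding height_def by simp
        also have "\<dots> \<le> (C2 * \<mu> * ?P) * D v z k powr iq x"
          using C2 \<mu> by (intro mult_mono h0 t) auto
        finally show ?thesis unfolding wk .
      qed
      have "mixed_norm p1 q (F \<alpha>1 (v, m)) \<le> ennreal (C * \<mu>)" for v m
      proof (rule mixed_norm_leI)
        define z :: 'a where "z = (\<Sum>i\<in>Basis. of_int (m i) *\<^sub>R i)"
        have z: "z \<in> ivecs" unfolding z_def by (rule dyadic_index_in)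
        have Q: "dyadic_cube v m = cube (2 powr real_of_int v) z" unfolding z_def by (rule dyadic_cube_eq_cube)
        show "0 < C * \<mu>" using C0 \<mu> by simp
        \<comment> \<open>\<open>D / S\<close> is the sequence of witnesses for the inner infima of
          the target norm; by \<open>Ds\<close> its sum is at most 1.\<close>
        show "0 < D v z k / S" for k using D0[OF z] S1 by (intro divide_pos_pos) auto
        have "(\<Sum>k. ennreal (D v z k / S)) = (\<Sum>k. ennreal (1 / S) * ennreal (D v z k))"
          using D0[OF z] S1 by (intro suminf_cong) (simp add: ennreal_mult[symmetric] less_imp_le)
        also have "\<dots> = ennreal (1 / S) * (\<Sum>k. ennreal (D v z k))" by (rule ennreal_suminf_cmult)
        also have "\<dots> \<le> ennreal (1 / S) * ennreal S" by (intro mult_left_mono Ds[OF z]) simp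
        also have "\<dots> = 1" using S1 by (simp add: ennreal_mult[symmetric])
        finally show "(\<Sum>k. ennreal (D v z k / S)) \<le> 1" .
        fix k
        have "(\<integral>\<^sup>+x. ennreal ((norm (F \<alpha>1 (v, m) k x) / (C * \<mu> * (D v z k / S) powr (1 / q x))) powr p1 x) \<partial>lborel)
          \<le> (\<integral>\<^sup>+y. ennreal ((height (real (wn v k)) (real_of_int v) \<alpha>0 \<tau> (g (wn v k)) y / (\<mu> * L v z k powr iq y)) powr (1 / i0 y)) * indicator (cube (2 powr real_of_int v) z) y \<partial>lborel)"
        proof (rule nn_integral_mono)
          fix x :: 'a
          show "ennreal ((norm (F \<alpha>1 (v, m) k x) / (C * \<mu> * (D v z k / S) powr (1 / q x))) powr p1 x)
            \<le> ennreal ((height (real (wn v k)) (real_of_int v) \<alpha>0 \<tau> (g (wn v k)) x / (\<mu> * L v z k powr iq x)) powr (1 / i0 x)) * indicator (cube (2 powr real_of_int v) z) x"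
          proof (cases "x \<in> cube (2 powr real_of_int v) z")
            case True
            have LD: "L v z k \<le> D v z k" using DL[OF z z, of v k] by (simp add: wt_def)
            from weighted_pointwise[where x=x and ?\<alpha>0.0=\<alpha>0 and ?\<alpha>1.0=\<alpha>1 and \<tau>=\<tau> and ?i0.0="i0 x" and ?i1.0="i1 x"
                and iq="iq x" and D="D v z k" and L="L v z k" and w="real (wn v k)" and v="real_of_int v"
                and g="g (wn v k)", OF bound2[OF z True] \<mu> C2 L0 LD S1 ipos(3) Bq ipos(2) i10 e]
            show ?thesis unfolding nF Q inv C_def using True by (simp add: ennreal_leI)
          next
            case False
            then show ?thesis unfolding nF Q by simp
          qed
        qed
        also note Lint[OF z]
        finally show "(\<integral>\<^sup>+x. ennreal ((norm (F \<alpha>1 (v, m) k x) / (C * \<mu> * (D v z k / S) powr (1 / q x))) powr p1 x) \<partial>lborel) \<le> 1" .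
      qed
      then show ?thesis unfolding bn by (intro SUP_least) (metis surj_pair)
    qed
    show ?thesis
    proof (intro exI[of _ C] conjI ballI C0)
      fix f assume f: "f \<in> besov_space Phi phi \<alpha>0 \<tau> p0 q"
      then have tf: "tempered f" and fin: "besov_norm Phi phi \<alpha>0 \<tau> p0 q f < top" by (auto simp: besov_space_def)
      then obtain R where R: "0 \<le> R" "besov_norm Phi phi \<alpha>0 \<tau> p0 q f = ennreal R"
        by (cases "besov_norm Phi phi \<alpha>0 \<tau> p0 q f") auto
      show le: "besov_norm Phi phi \<alpha>1 \<tau> p1 q f \<le> ennreal C * besov_norm Phi phi \<alpha>0 \<tau> p0 q f"
      proof (rule ennreal_le_epsilon)
        \<comment> \<open>\<open>main\<close> asks for a positive number strictly above the norm;
          the slack \<open>d / C\<close> provides it also when the norm is 0.\<close>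
        fix d :: real assume d: "0 < d"
        have "besov_norm Phi phi \<alpha>1 \<tau> p1 q f \<le> ennreal (C * (R + d / C))"
          using d C0 R by (intro main[OF tf]) (auto simp: ennreal_less_iff add_nonneg_pos)
        also have "C * (R + d / C) = C * R + d" using C0 by (simp add: distrib_left)
        also have "ennreal (C * R + d) = ennreal C * ennreal R + ennreal d"
          using C0 R(1) d by (simp add: ennreal_plus ennreal_mult)
        finally show "besov_norm Phi phi \<alpha>1 \<tau> p1 q f \<le> ennreal C * besov_norm Phi phi \<alpha>0 \<tau> p0 q f + ennreal d"
          unfolding R(2) .
      qed
      have "ennreal C * besov_norm Phi phi \<alpha>0 \<tau> p0 q f < top" unfolding R(2) by (simp add: ennreal_mult_less_top)
      with le show "f \<in> besov_space Phi phi \<alpha>1 \<tau> p1 q"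
        using tf by (auto simp: besov_space_def intro: le_less_trans)
    qed
  qed
qed

end
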